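(* Let $f: \mathbb{C}P(2) \rightarrow \mathbb{C}P(2)$ be a biholomorphism and let $\Sigma(f)$ denote its set of fixed points. Then one of the following six possibilities holds: (1) $\Sigma(f)$ has pure dimension zero and is a set of one, two or three points (three possibilities); (2) $\Sigma(f)$ has pure dimension one and consists of two projective lines; (3) $\Sigma(f)$ consists of one point and two projective lines; (4) $\Sigma(f)$ has dimension two and $\Sigma(f)=\mathbb{C}P(2)$. In particular, $f$ is conjugate in $\operatorname{Aut}(\mathbb{C}P(2))$ to a map $g\in\operatorname{Aut}(\mathbb{C}P(2))$ of the following form, where $\lambda_0,\lambda_1,\lambda_2\in\mathbb{C}\smallsetminus\{0\}$: - $g(x:y:z)=(\lambda_0 x+y: \lambda_0 y+z: \lambda_0 z)$ if $\Sigma(f)$ is one point; - $g(x:y:z)=(\lambda_0 x+y: \lambda_0 y: \lambda_1 z)$ if $\Sigma(f)$ is two points; - $g(x:y:z)=(\lambda_0 x: \lambda_1 y: \lambda_2 z)$ if $\Sigma(f)$ is three points; - $g(x:y:z)=(\lambda_0 x: \lambda_0 y: \lambda_1 z)$ if $\Sigma(f)$ is one point and two projective lines; - $g(x:y:z)=(\lambda_0 x+y: \lambda_0 y: \lambda_0 z)$ if $\Sigma(f)$ is two projective lines; - $g(x:y:z)=(x:y:z)$ if $\Sigma(f)=\mathbb{C}P(2)$.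
   Context: $\mathbb{C}P(2)$ is the complex projective plane with homogeneous coordinates $(x:y:z)$, and $\operatorname{Aut}(\mathbb{C}P(2))\cong\operatorname{PGL}(3,\mathbb{C})$ is its group of biholomorphisms.
   Formalization: In cases (2) and (3) and the matching normal forms, "two projective lines" is replaced by one projective line (with the point off the line in case (3)): e.g. (x+y:y:z) fixes exactly one line and (x:y:2z) exactly one line and one point, so the claim as written is false. *)

theory Defs
  imports "HOL-Analysis.Analysis"
begin

section \<open>The complex projective plane\<close>

quotient_type cp2 = "complex ^ 3" / partial:
  "\<lambda>v w. v \<noteq> 0 \<and> w \<noteq> 0 \<and> (\<exists>c. c \<noteq> 0 \<and> w = c *s v)"
proof (rule part_equivpI)
  show "\<exists>x::complex^3. x \<noteq> 0 \<and> x \<noteq> 0 \<and> (\<exists>c. c \<noteq> 0 \<and> x = c *s x)"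
    by (rule exI[of _ "axis 1 1"]) (auto intro!: exI[of _ 1] simp: axis_eq_0_iff)
  show "symp (\<lambda>v w::complex^3. v \<noteq> 0 \<and> w \<noteq> 0 \<and> (\<exists>c. c \<noteq> 0 \<and> w = c *s v))"
  proof (rule sympI, elim conjE exE)
    fix v w :: "complex^3" and c :: complex
    assume "v \<noteq> 0" "w \<noteq> 0" "c \<noteq> 0" "w = c *s v"
    then show "w \<noteq> 0 \<and> v \<noteq> 0 \<and> (\<exists>d. d \<noteq> 0 \<and> v = d *s w)"
      by (intro conjI exI[of _ "inverse c"]) auto
  qed
  show "transp (\<lambda>v w::complex^3. v \<noteq> 0 \<and> w \<noteq> 0 \<and> (\<exists>c. c \<noteq> 0 \<and> w = c *s v))"
  proof (rule transpI, elim conjE exE)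
    fix u v w :: "complex^3" and c d :: complex
    assume "u \<noteq> 0" "w \<noteq> 0" "c \<noteq> 0" "v = c *s u" "d \<noteq> 0" "w = d *s v"
    then show "u \<noteq> 0 \<and> w \<noteq> 0 \<and> (\<exists>e. e \<noteq> 0 \<and> w = e *s u)"
      by (intro conjI exI[of _ "d * c"]) auto
  qed
qed

text \<open>Only the values of \<open>proj\<close> at nonzero vectors, hence only \<open>hpt x y z\<close> with
  \<open>(x, y, z) \<noteq> (0, 0, 0)\<close>, are meaningful.\<close>

definition proj :: "complex ^ 3 \<Rightarrow> cp2" where
  "proj = abs_cp2"

definition hpt :: "complex \<Rightarrow> complex \<Rightarrow> complex \<Rightarrow> cp2" where
  "hpt x y z = proj (vector [x, y, z])"

instantiation cp2 :: topological_space
begin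

text \<open>The quotient topology from \<open>\<complex>\<^sup>3 - {0}\<close>.\<close>

definition open_cp2 :: "cp2 set \<Rightarrow> bool" where
  "open U \<longleftrightarrow> open {v. v \<noteq> 0 \<and> proj v \<in> U}"

instance
proof
  have "{v::complex^3. v \<noteq> 0 \<and> proj v \<in> UNIV} = - {0}" by auto
  then show "open (UNIV :: cp2 set)" by (simp add: open_cp2_def open_Compl)
next
  fix S T :: "cp2 set"
  assume "open S" "open T"
  moreover have "{v. v \<noteq> 0 \<and> proj v \<in> S \<inter> T} =
      {v. v \<noteq> 0 \<and> proj v \<in> S} \<inter> {v. v \<noteq> 0 \<and> proj v \<in> T}" by auto
  ultimately show "open (S \<inter> T)" by (simp only: open_cp2_def open_Int)
next
  fix K :: "cp2 set set"
  assume "\<forall>S\<in>K. open S"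
  moreover have "{v. v \<noteq> 0 \<and> proj v \<in> \<Union>K} = (\<Union>S\<in>K. {v. v \<noteq> 0 \<and> proj v \<in> S})" by auto
  ultimately show "open (\<Union>K)" by (auto simp only: open_cp2_def intro!: open_UN)
qed

end

text \<open>The three standard affine charts: \<open>chart i\<close> maps \<open>chart_domain i\<close> onto \<open>\<complex>\<^sup>2\<close>, with inverse
  \<open>affine_point i\<close>. Outside its domain \<open>chart i\<close> is junk. In the type \<open>3\<close> the indices are
  \<open>1, 2\<close> and \<open>3 = 0\<close>.\<close>

definition chart_domain :: "3 \<Rightarrow> cp2 set" where
  "chart_domain i = proj ` {v. v $ i \<noteq> 0}"

lift_definition chart :: "3 \<Rightarrow> cp2 \<Rightarrow> complex ^ 2" is
  "\<lambda>i v. if i = 1 then vector [v $ 2 / v $ 1, v $ 3 / v $ 1]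
         else if i = 2 then vector [v $ 1 / v $ 2, v $ 3 / v $ 2]
         else vector [v $ 1 / v $ 3, v $ 2 / v $ 3]"
  by auto

definition affine_point :: "3 \<Rightarrow> complex ^ 2 \<Rightarrow> cp2" where
  "affine_point i w =
    (if i = 1 then hpt 1 (w $ 1) (w $ 2)
     else if i = 2 then hpt (w $ 1) 1 (w $ 2)
     else hpt (w $ 1) (w $ 2) 1)"


section \<open>Biholomorphisms\<close>

text \<open>Used for open \<open>W\<close> only: the real derivative exists and is complex linear, \<open>J\<close> being the
  complex Jacobian matrix.\<close>

definition holo_on :: "(complex ^ 'n \<Rightarrow> complex ^ 'm) \<Rightarrow> (complex ^ 'n) set \<Rightarrow> bool" where
  "holo_on F W \<longleftrightarrow> (\<forall>w\<in>W. \<exists>J :: complex ^ 'n ^ 'm. (F has_derivative (*v) J) (at w))"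

definition holomorphic_map :: "(cp2 \<Rightarrow> cp2) \<Rightarrow> bool" where
  "holomorphic_map f \<longleftrightarrow> continuous_on UNIV f \<and>
     (\<forall>i j. holo_on (\<lambda>w. chart j (f (affine_point i w)))
              {w. f (affine_point i w) \<in> chart_domain j})"

definition biholomorphism :: "(cp2 \<Rightarrow> cp2) \<Rightarrow> bool" where
  "biholomorphism f \<longleftrightarrow> bij f \<and> holomorphic_map f \<and> holomorphic_map (inv f)"

definition Aut_cp2 :: "(cp2 \<Rightarrow> cp2) set" where
  "Aut_cp2 = {f. biholomorphism f}"

definition conjugate_in_Aut :: "(cp2 \<Rightarrow> cp2) \<Rightarrow> (cp2 \<Rightarrow> cp2) \<Rightarrow> bool" where
  "conjugate_in_Aut f g \<longleftrightarrow> (\<exists>h\<in>Aut_cp2. g = h \<circ> f \<circ> inv h)"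

definition fixed_points :: "('a \<Rightarrow> 'a) \<Rightarrow> 'a set" where
  "fixed_points f = {p. f p = p}"


section \<open>Projective lines and dimension\<close>

definition projective_line :: "cp2 set \<Rightarrow> bool" where
  "projective_line L \<longleftrightarrow>
     (\<exists>a :: complex ^ 3. a \<noteq> 0 \<and> L = proj ` {v. v \<noteq> 0 \<and> (\<Sum>k\<in>UNIV. a $ k * v $ k) = 0})"

text \<open>\<open>S\<close> is, near \<open>p\<close>, a complex submanifold of dimension \<open>d\<close>: some local biholomorphic
  coordinates \<open>\<Phi>\<close> map it to the coordinate subspace where the coordinates with index in \<open>K\<close>
  vanish.\<close>

definition regular_point :: "cp2 set \<Rightarrow> nat \<Rightarrow> cp2 \<Rightarrow> bool" where
  "regular_point S d p \<longleftrightarrow> p \<in> S \<and>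
     (\<exists>i W (\<Phi> :: complex ^ 2 \<Rightarrow> complex ^ 2) K.
        p \<in> chart_domain i \<and> open W \<and> chart i p \<in> W \<and>
        inj_on \<Phi> W \<and> open (\<Phi> ` W) \<and> holo_on \<Phi> W \<and> holo_on (inv_into W \<Phi>) (\<Phi> ` W) \<and>
        card K + d = 2 \<and>
        (\<forall>w\<in>W. affine_point i w \<in> S \<longleftrightarrow> (\<forall>k\<in>K. \<Phi> w $ k = 0)))"

text \<open>The usual notions for a nonempty analytic subset \<open>S\<close>, such as the fixed point set of an
  automorphism: the dimension of \<open>S\<close> is the largest dimension at a regular point, and \<open>S\<close> has
  pure dimension \<open>d\<close> if its regular points of dimension \<open>d\<close> are dense in it.\<close>

definition cdimension :: "cp2 set \<Rightarrow> nat" where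
  "cdimension S = Max {d. \<exists>p. regular_point S d p}"

definition pure_dimension :: "cp2 set \<Rightarrow> nat \<Rightarrow> bool" where
  "pure_dimension S d \<longleftrightarrow> S \<subseteq> closure {p. regular_point S d p}"

text \<open>The informal classification this formalizes speaks of ``two projective lines'' and of
  ``one point and two projective lines''. Neither occurs as a fixed point set of an
  automorphism: such a set is the union of the projectivized eigenspaces of a matrix, which are
  pairwise disjoint, while any two projective lines meet. The normal forms listed there,
  \<open>(\<lambda>\<^sub>0 x + y : \<lambda>\<^sub>0 y : \<lambda>\<^sub>0 z)\<close> and \<open>(\<lambda>\<^sub>0 x : \<lambda>\<^sub>0 y : \<lambda>\<^sub>1 z)\<close>, fix exactly one line, respectively
  (for \<open>\<lambda>\<^sub>0 \<noteq> \<lambda>\<^sub>1\<close>) one line and one point off it. So a single line is used in both cases.\<close>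

definition point_and_line :: "cp2 set \<Rightarrow> bool" where
  "point_and_line S \<longleftrightarrow> (\<exists>p L. projective_line L \<and> p \<notin> L \<and> S = {p} \<union> L)"

end

theory Submission
  imports Defs "HOL-Complex_Analysis.Conformal_Mappings"
begin

text \<open>Every biholomorphism \<open>f\<close> of the plane is projectively linear because it preserves the canonical
  bundle, which is \<open>O(-3)\<close>. Concretely, let \<open>Y\<close> be a local lift of \<open>f\<close> to homogeneous coordinates and
  let \<open>\<kappa>\<close> be its Jacobian determinant, which never vanishes. Then \<open>Y\<^sub>k ^ 3 / \<kappa>\<close> does not depend on the
  choice of the lift, so on an affine line \<open>t \<mapsto> p + t q\<close> it is an entire function. The change of charts
  at infinity shows that it grows at most like \<open>t ^ 3\<close>, and all its zeros have order at least \<open>3\<close>. Hence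
  it is the cube of an affine function, and \<open>f\<close> is of the form \<open>[p + t q] \<mapsto> [A + t B]\<close> on the line.
  Comparing the lines through the coordinate points yields a matrix inducing \<open>f\<close>.
  The fixed points are then the eigenlines of this matrix, read off from its
  Jordan normal form.\<close>

section \<open>Complex differentiability and projective coordinates\<close>

text \<open>Holomorphy is available only as complex differentiability at each point, so everything
  is restricted to lines, where one-variable theory applies. A Jacobian determinant still needs a
  direction transverse to the line: this is the third vector \<open>u\<close>, which completes
  \<open>p\<close> and \<open>q\<close> to a basis, and the derivative along \<open>u\<close> has to
  be shown holomorphic in \<open>t\<close> (\<open>jacobian_holomorphic\<close>). That the
  determinant has no zeros is where differentiability of the inverse map enters. Two ambiguities
  shape the rest. A cube root is determined only up to a third root of unity, separately for each
  coordinate; connectedness of the plane minus finitely many points turns this into one constant per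
  coordinate, which the lift absorbs. Moreover, the images of two points of a line fix the map on
  that line only up to one factor; some of these factors are absorbed by rescaling the images of the
  coordinate points, the others are shown to be 1 by intersecting lines.\<close>

lemma has_derivative_vec_components:
  fixes F :: "'a::real_normed_vector \<Rightarrow> 'b::euclidean_space ^ 'n"
  assumes "\<And>i. ((\<lambda>x. F x $ i) has_derivative (\<lambda>h. D h $ i)) (at w)"
  shows "(F has_derivative D) (at w)"
proof (subst has_derivative_componentwise_within, intro ballI)
  fix b :: "'b ^ 'n" assume "b \<in> Basis"
  then obtain i u where b: "b = axis i u" by (auto simp: Basis_vec_def)
  show "((\<lambda>x. F x \<bullet> b) has_derivative (\<lambda>x. D x \<bullet> b)) (at w)"
    unfolding b inner_axis by (rule has_derivative_inner_left[OF assms])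
qed

text \<open>Stated at one point, so that chain rule arguments need not carry open domains.\<close>

definition cdiff :: "(complex ^ 'n \<Rightarrow> complex ^ 'm) \<Rightarrow> complex ^ 'n \<Rightarrow> bool" where
  "cdiff F w \<longleftrightarrow> (\<exists>J :: complex ^ 'n ^ 'm. (F has_derivative (*v) J) (at w))"

lemma holo_on_iff_cdiff: "holo_on F W \<longleftrightarrow> (\<forall>w\<in>W. cdiff F w)"
  by (simp add: holo_on_def cdiff_def)

lemma cdiffI:
  assumes D: "(F has_derivative D) (at w)" and hom: "\<And>c x. D (c *s x) = c *s D x"
  shows "cdiff F w"
proof -
  have "Vector_Spaces.linear (*s) (*s) D"
    using has_derivative_linear[OF D] hom
    by (simp add: Vector_Spaces.linear_iff linear_add vec.vector_space_axioms)
  then have "D = (*v) (matrix D)" by (auto simp: matrix_works)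
  with D show ?thesis unfolding cdiff_def by metis
qed

lemma cdiff_comp:
  assumes "cdiff F w" "cdiff G (F w)"
  shows "cdiff (\<lambda>x. G (F x)) w"
proof -
  obtain A B where "(F has_derivative (*v) A) (at w)" "(G has_derivative (*v) B) (at (F w))"
    using assms by (auto simp: cdiff_def)
  from diff_chain_at[OF this] have "((\<lambda>x. G (F x)) has_derivative (*v) (B ** A)) (at w)"
    by (simp add: o_def matrix_vector_mul_assoc)
  then show ?thesis by (auto simp: cdiff_def)
qed

lemma cdiff_transform:
  assumes "cdiff F w" "open U" "w \<in> U" "\<And>x. x \<in> U \<Longrightarrow> F x = G x"
  shows "cdiff G w"
  using assms unfolding cdiff_def by (metis has_derivative_transform_within_open)

lemma cdiff_imp_continuous: "cdiff F w \<Longrightarrow> isCont F w"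
  by (auto simp: cdiff_def intro: has_derivative_continuous)

text \<open>The translation \<open>b\<close> makes this cover the affine maps between charts and
  homogeneous coordinates, not just linear ones.\<close>

lemma cdiff_linear_shift:
  fixes D :: "complex ^ 'n \<Rightarrow> complex ^ 'm"
  assumes "\<And>x y. D (x + y) = D x + D y" "\<And>c x. D (c *s x) = c *s D x"
  shows "cdiff (\<lambda>x. D x + b) w"
proof (rule cdiffI)
  have "linear D"
  proof
    fix r :: real and x
    have "r *\<^sub>R x = of_real r *s x" "r *\<^sub>R D x = of_real r *s D x"
      by (simp_all add: vec_eq_iff scaleR_conv_of_real[where 'a = complex])
    then show "D (r *\<^sub>R x) = r *\<^sub>R D x" by (simp add: assms)
  qed (rule assms)
  then have "bounded_linear D" by (simp add: linear_conv_bounded_linear)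
  then show "((\<lambda>x. D x + b) has_derivative D) (at w)"
    by (auto intro!: derivative_eq_intros bounded_linear_imp_has_derivative)
qed (rule assms)

lemma cdiff_matrix: "cdiff (\<lambda>x. (M :: complex ^ 'n ^ 'm) *v x) w"
  using cdiff_linear_shift[of "(*v) M" 0 w]
  by (simp add: matrix_vector_right_distrib vector_scalar_commute)

text \<open>The derivative is kept explicit because its second term is a multiple of
  \<open>v\<close>: this makes its kernel exactly the line of \<open>v\<close> and lets the term
  disappear from determinants that have \<open>v\<close> as a column.\<close>

lemma dehomogenize_has_derivative:
  fixes v :: "complex ^ 'n"
  assumes "v $ j \<noteq> 0"
  shows "((\<lambda>v. (1 / v $ j) *s v) has_derivative
           (\<lambda>h. (1 / v $ j) *s h - (h $ j / (v $ j)\<^sup>2) *s v)) (at v)"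
proof (rule has_derivative_vec_components)
  fix i
  have "bounded_linear (\<lambda>x::complex^'n. x $ k)" for k by (rule bounded_linear_vec_nth)
  note d = bounded_linear_imp_has_derivative[OF this]
  show "((\<lambda>x. ((1 / x $ j) *s x) $ i) has_derivative
        (\<lambda>h. ((1 / v $ j) *s h - (h $ j / (v $ j)\<^sup>2) *s v) $ i)) (at v)"
    using assms
    by (auto intro!: derivative_eq_intros d simp: fun_eq_iff field_simps power2_eq_square)
qed

lemma dehomogenize_cdiff:
  assumes "v $ j \<noteq> 0"
  shows "cdiff (\<lambda>v. (1 / v $ j) *s v) v"
  by (rule cdiffI[OF dehomogenize_has_derivative[OF assms]])
     (simp add: vec_eq_iff algebra_simps)

section \<open>Homogeneous coordinates and affine charts\<close>

lemma proj_eq_iff: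
  assumes "v \<noteq> 0" "w \<noteq> 0"
  shows "proj v = proj w \<longleftrightarrow> (\<exists>c. c \<noteq> 0 \<and> w = c *s v)"
proof -
  have refl: "\<exists>c. c \<noteq> 0 \<and> u = c *s u" for u :: "complex ^ 3" by (rule exI[of _ 1]) simp
  show ?thesis using Quotient_rel[OF Quotient_cp2, of v w] assms refl[of v] refl[of w]
    by (simp add: proj_def)
qed

lemma proj_eqI: "v \<noteq> 0 \<Longrightarrow> c \<noteq> 0 \<Longrightarrow> proj (c *s v) = proj v"
  by (subst eq_commute, subst proj_eq_iff) auto

lemma proj_cases: obtains v where "v \<noteq> 0" "P = proj v"
proof -
  have "\<exists>v. v \<noteq> 0 \<and> P = proj v"
    unfolding proj_def by (rule cp2.abs_induct[of _ P]) blast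
  then show thesis using that by blast
qed

lemma mem_chart_domain:
  assumes "v \<noteq> 0"
  shows "proj v \<in> chart_domain j \<longleftrightarrow> v $ j \<noteq> 0"
proof
  assume "proj v \<in> chart_domain j"
  then obtain w where w: "w $ j \<noteq> 0" "proj v = proj w" by (auto simp: chart_domain_def)
  then have "w \<noteq> 0" by auto
  with w show "v $ j \<noteq> 0" using proj_eq_iff[OF assms] by auto
qed (auto simp: chart_domain_def)

text \<open>The representative whose coordinate \<open>j\<close> is 1. Outside
  \<open>chart_domain j\<close> it is the zero vector, since 1/0 = 0, so it respects scaling
  everywhere.\<close>

lift_definition affine_rep :: "3 \<Rightarrow> cp2 \<Rightarrow> complex ^ 3" is "\<lambda>j v. (1 / v $ j) *s v"
  by (auto simp: vec_eq_iff)

lemma affine_rep_proj: "v \<noteq> 0 \<Longrightarrow> affine_rep j (proj v) = (1 / v $ j) *s v"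
  unfolding proj_def by (rule affine_rep.abs_eq) (auto intro!: exI[of _ 1])

lemma affine_rep_nth_self: "P \<in> chart_domain j \<Longrightarrow> affine_rep j P $ j = 1"
  by (rule proj_cases[of P]) (auto simp: affine_rep_proj mem_chart_domain)

lemma affine_rep_nth_eq_0:
  "P \<in> chart_domain j \<Longrightarrow> affine_rep j P $ k \<noteq> 0 \<longleftrightarrow> P \<in> chart_domain k"
  by (rule proj_cases[of P]) (auto simp: affine_rep_proj mem_chart_domain)

lemma affine_rep_nonzero: "P \<in> chart_domain j \<Longrightarrow> affine_rep j P \<noteq> 0"
  using affine_rep_nth_self by fastforce

lemma proj_affine_rep: "P \<in> chart_domain j \<Longrightarrow> proj (affine_rep j P) = P"
  by (rule proj_cases[of P]) (auto simp: affine_rep_proj mem_chart_domain intro!: proj_eqI)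

text \<open>For \<open>P\<close> outside \<open>chart_domain k\<close> both sides are the zero
  vector, again by 1/0 = 0.\<close>

lemma affine_rep_change:
  "P \<in> chart_domain j \<Longrightarrow> affine_rep k P = (1 / affine_rep j P $ k) *s affine_rep j P"
  by (rule proj_cases[of P]) (auto simp: affine_rep_proj mem_chart_domain vec_eq_iff)

lemma chart_domain_cover: obtains j where "P \<in> chart_domain j"
  by (rule proj_cases[of P]) (auto simp: mem_chart_domain vec_eq_iff)

text \<open>Together with \<open>drop_coord\<close> this factors the charts: \<open>chart i\<close>
  is \<open>drop_coord i\<close> after \<open>affine_rep i\<close>, and
  \<open>affine_point i\<close> is \<open>proj\<close> after \<open>affine_embed i\<close>. Apart
  from the division in \<open>affine_rep\<close>, only affine maps of vector spaces remain.\<close>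

definition affine_embed :: "3 \<Rightarrow> complex ^ 2 \<Rightarrow> complex ^ 3" where
  "affine_embed i w =
    (if i = 1 then vector [1, w $ 1, w $ 2]
     else if i = 2 then vector [w $ 1, 1, w $ 2]
     else vector [w $ 1, w $ 2, 1])"

definition drop_coord :: "3 \<Rightarrow> complex ^ 3 \<Rightarrow> complex ^ 2" where
  "drop_coord i v =
    (if i = 1 then vector [v $ 2, v $ 3]
     else if i = 2 then vector [v $ 1, v $ 3]
     else vector [v $ 1, v $ 2])"

lemma index3_cases: fixes i :: 3 obtains "i = 1" | "i = 2" | "i = 3"
  using exhaust_3 by blast

lemma affine_point_eq: "affine_point i w = proj (affine_embed i w)"
  by (simp add: affine_point_def affine_embed_def hpt_def)

lemma affine_embed_nth_self: "affine_embed i w $ i = 1"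
  by (cases i rule: index3_cases) (simp_all add: affine_embed_def vector_3)

lemma affine_embed_nonzero: "affine_embed i w \<noteq> 0"
  using affine_embed_nth_self[of i w] by auto

lemma drop_embed: "drop_coord i (affine_embed i w) = w"
  by (simp add: affine_embed_def drop_coord_def vec_eq_iff forall_2 vector_3 vector_2)

lemma embed_drop: "v $ i = 1 \<Longrightarrow> affine_embed i (drop_coord i v) = v"
  by (cases i rule: index3_cases)
     (simp_all add: affine_embed_def drop_coord_def vec_eq_iff forall_3 vector_3 vector_2)

lemma chart_eq: "chart i P = drop_coord i (affine_rep i P)"
proof (rule proj_cases[of P])
  fix v assume v: "v \<noteq> 0" "P = proj v"
  have "v \<noteq> 0 \<and> v \<noteq> 0 \<and> (\<exists>c. c \<noteq> 0 \<and> v = c *s v)" using v by (auto intro!: exI[of _ 1])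
  from chart.abs_eq[OF this, of i] show ?thesis using v
    by (cases i rule: index3_cases)
       (simp_all add: proj_def[symmetric] affine_rep_proj drop_coord_def vec_eq_iff forall_2 vector_2)
qed

lemma affine_point_chart: "P \<in> chart_domain i \<Longrightarrow> affine_point i (chart i P) = P"
  by (simp add: affine_point_eq chart_eq embed_drop affine_rep_nth_self proj_affine_rep)

lemma affine_point_in_chart_domain: "affine_point i w \<in> chart_domain i"
  by (simp add: affine_point_eq mem_chart_domain affine_embed_nonzero affine_embed_nth_self)

lemma chart_affine_point: "chart i (affine_point i w) = w"
  by (simp add: affine_point_eq chart_eq affine_rep_proj affine_embed_nonzero
      affine_embed_nth_self drop_embed)

lemma drop_coord_cdiff: "cdiff (drop_coord i) w"
proof -
  have "cdiff (\<lambda>v. drop_coord i v + 0) w"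
    by (rule cdiff_linear_shift; cases i rule: index3_cases)
       (simp_all add: drop_coord_def vec_eq_iff forall_2 vector_2)
  then show ?thesis by simp
qed

lemma affine_embed_cdiff: "cdiff (affine_embed i) w"
proof -
  have "cdiff (\<lambda>w. (affine_embed i w - axis i 1) + axis i 1) w"
    by (rule cdiff_linear_shift; cases i rule: index3_cases)
       (simp_all add: affine_embed_def vec_eq_iff forall_3 vector_3 axis_def)
  then show ?thesis by simp
qed

section \<open>Local lifts of a map to homogeneous coordinates\<close>

definition local_lift :: "(cp2 \<Rightarrow> cp2) \<Rightarrow> 3 \<Rightarrow> complex ^ 3 \<Rightarrow> complex ^ 3" where
  "local_lift f j v = affine_rep j (f (proj v))"

definition lift_dom :: "(cp2 \<Rightarrow> cp2) \<Rightarrow> 3 \<Rightarrow> (complex ^ 3) set" where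
  "lift_dom f j = {v. v \<noteq> 0 \<and> f (proj v) \<in> chart_domain j}"

lemma open_chart_domain: "open (chart_domain j)"
proof -
  have "{v. v \<noteq> 0 \<and> proj v \<in> chart_domain j} = {v. v $ j \<noteq> 0}"
    by (auto simp: mem_chart_domain) (metis mem_chart_domain zero_index)
  moreover have "open {v::complex^3. v $ j \<noteq> 0}"
    by (intro open_Collect_neq continuous_intros)
  ultimately show ?thesis by (simp add: open_cp2_def)
qed

lemma open_lift_dom:
  assumes "continuous_on UNIV f"
  shows "open (lift_dom f j)"
proof -
  have "open (f -` chart_domain j)" using assms open_chart_domain by (rule open_vimage[rotated])
  then show ?thesis by (simp add: open_cp2_def lift_dom_def vimage_def)
qed

text \<open>Near a vector with nonzero coordinate \<open>i\<close> the lift is a composition of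
  dehomogenization, the expression of \<open>f\<close> in the charts \<open>i\<close> and
  \<open>j\<close>, and \<open>affine_embed j\<close>. Having the source variable in C^3 instead of
  a chart makes the scaling behaviour of the lift usable later.\<close>

lemma local_lift_cdiff:
  assumes f: "holomorphic_map f" and v: "v \<in> lift_dom f j"
  shows "cdiff (local_lift f j) v"
proof -
  obtain i where i: "v $ i \<noteq> 0" using v by (auto simp: lift_dom_def vec_eq_iff)
  let ?n = "\<lambda>v. drop_coord i ((1 / v $ i) *s v)"
  let ?F = "\<lambda>w. chart j (f (affine_point i w))"
  define U where "U = lift_dom f j \<inter> {v. v $ i \<noteq> 0}"
  have pt: "affine_point i (?n x) = proj x" if "x \<in> U" for x
  proof -
    have "x \<noteq> 0" "x $ i \<noteq> 0" using that by (auto simp: U_def lift_dom_def)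
    then show ?thesis
      using affine_point_chart[of "proj x" i] by (simp add: chart_eq affine_rep_proj mem_chart_domain)
  qed
  have "open U" unfolding U_def using f
    by (intro open_Int open_lift_dom open_Collect_neq continuous_intros)
       (auto simp: holomorphic_map_def)
  have "v \<in> U" using v i by (simp add: U_def)
  have "cdiff ?F (?n v)"
    using f v pt[OF \<open>v \<in> U\<close>] by (auto simp: holomorphic_map_def holo_on_iff_cdiff lift_dom_def)
  moreover have "cdiff ?n v"
    by (rule cdiff_comp[OF dehomogenize_cdiff[OF i] drop_coord_cdiff])
  ultimately have "cdiff (\<lambda>v. ?F (?n v)) v" by (rule cdiff_comp[rotated])
  from cdiff_comp[OF this affine_embed_cdiff[of j]]
  show ?thesis
  proof (rule cdiff_transform[OF _ \<open>open U\<close> \<open>v \<in> U\<close>])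
    fix x assume x: "x \<in> U"
    then show "affine_embed j (?F (?n x)) = local_lift f j x"
      by (simp only: pt chart_eq local_lift_def)
         (simp add: U_def lift_dom_def embed_drop affine_rep_nth_self)
  qed
qed

section \<open>Maps induced by invertible matrices\<close>

definition plin :: "complex ^ 3 ^ 3 \<Rightarrow> cp2 \<Rightarrow> cp2" where
  "plin M P = proj (M *v affine_rep (SOME j. P \<in> chart_domain j) P)"

lemma invertible_mult_eq_0: "invertible (M :: complex ^ 3 ^ 3) \<Longrightarrow> M *v v = 0 \<Longrightarrow> v = 0"
  by (metis invertible_def matrix_vector_mul_assoc matrix_vector_mul_lid mult.right_neutral
      matrix_vector_mult_0_right)

lemma invertible_mult_nonzero: "invertible (M :: complex ^ 3 ^ 3) \<Longrightarrow> v \<noteq> 0 \<Longrightarrow> M *v v \<noteq> 0"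
  using invertible_mult_eq_0[of M v] by argo

text \<open>A singular matrix sends some nonzero vectors to 0 and induces no map of points; the
  \<open>SOME\<close> in \<open>plin\<close> still yields a total function. For an invertible matrix
  another representative changes the image vector only by a nonzero factor.\<close>

lemma plin_proj:
  assumes M: "invertible M" and v: "v \<noteq> 0"
  shows "plin M (proj v) = proj (M *v v)"
proof -
  let ?j = "SOME j. proj v \<in> chart_domain j"
  have "proj v \<in> chart_domain ?j" by (rule someI_ex) (metis chart_domain_cover)
  then have "v $ ?j \<noteq> 0" using v by (simp add: mem_chart_domain)
  moreover have "M *v v \<noteq> 0" using M v by (rule invertible_mult_nonzero)
  ultimately show ?thesis
    using v by (simp add: plin_def affine_rep_proj vector_scalar_commute proj_eqI)
qed

lemma plin_holomorphic:
  assumes M: "invertible M"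
  shows "holomorphic_map (plin M)"
  unfolding holomorphic_map_def
proof (intro conjI allI)
  have nz: "M *v v = 0 \<longleftrightarrow> v = 0" for v using invertible_mult_eq_0[OF M, of v] by auto
  have "open (plin M -` B)" if "open B" for B
  proof -
    \<comment> \<open>Openness in the quotient topology is tested on cones in C^3, and the cone over
      the preimage is the linear preimage of the cone over \<open>B\<close>.\<close>
    have eq: "{v. v \<noteq> 0 \<and> plin M (proj v) \<in> B} = ((*v) M) -` {v. v \<noteq> 0 \<and> proj v \<in> B}"
      by (auto simp: plin_proj M nz)
    have "continuous_on UNIV ((*v) M)"
      by (intro continuous_at_imp_continuous_on ballI cdiff_imp_continuous[OF cdiff_matrix])
    moreover have "open {v. v \<noteq> 0 \<and> proj v \<in> B}"
      using that unfolding open_cp2_def .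
    ultimately have "open (((*v) M) -` {v. v \<noteq> 0 \<and> proj v \<in> B})"
      by (rule open_vimage[rotated])
    then have "open {v. v \<noteq> 0 \<and> plin M (proj v) \<in> B}" unfolding eq .
    then show ?thesis unfolding open_cp2_def vimage_def mem_Collect_eq .
  qed
  then show "continuous_on UNIV (plin M)" by (simp add: continuous_on_open_vimage[OF open_UNIV])
next
  fix i j
  show "holo_on (\<lambda>w. chart j (plin M (affine_point i w)))
              {w. plin M (affine_point i w) \<in> chart_domain j}"
    unfolding holo_on_iff_cdiff
  proof (intro ballI)
    fix w assume "w \<in> {w. plin M (affine_point i w) \<in> chart_domain j}"
    moreover have nz: "M *v affine_embed i w \<noteq> 0" for w using M affine_embed_nonzero by (rule invertible_mult_nonzero)
    ultimately have j: "(M *v affine_embed i w) $ j \<noteq> 0"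
      by (simp add: affine_point_eq plin_proj M affine_embed_nonzero mem_chart_domain)
    let ?g = "\<lambda>w. M *v affine_embed i w"
    have "cdiff ?g w" by (rule cdiff_comp[OF affine_embed_cdiff cdiff_matrix])
    from cdiff_comp[OF cdiff_comp[OF this dehomogenize_cdiff[OF j]] drop_coord_cdiff]
    have "cdiff (\<lambda>w. drop_coord j ((1 / ?g w $ j) *s ?g w)) w" .
    moreover have "drop_coord j ((1 / ?g w $ j) *s ?g w) = chart j (plin M (affine_point i w))" for w
      by (simp add: affine_point_eq plin_proj M affine_embed_nonzero chart_eq affine_rep_proj nz)
    ultimately show "cdiff (\<lambda>w. chart j (plin M (affine_point i w))) w" by simp
  qed
qed

lemma plin_mult:
  assumes "invertible M" "invertible N"
  shows "plin M (plin N P) = plin (M ** N) P"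
proof (rule proj_cases[of P])
  fix v assume v: "v \<noteq> 0" "P = proj v"
  then show ?thesis using assms
    by (simp add: plin_proj invertible_mult invertible_mult_nonzero matrix_vector_mul_assoc)
qed

lemma plin_mat_1: "plin (mat 1) P = P"
proof (rule proj_cases[of P])
  fix v assume "v \<noteq> 0" "P = proj v"
  then show ?thesis using plin_proj[of "mat 1" v] by (simp add: invertible_def exI[of _ "mat 1"])
qed

lemma plin_inverse:
  assumes "M ** N = mat 1" "N ** M = mat 1"
  shows "bij (plin M)" "inv (plin M) = plin N"
proof -
  have inv: "invertible M" "invertible N" using assms by (auto simp: invertible_def)
  have 1: "plin M (plin N P) = P" "plin N (plin M P) = P" for P
    by (simp_all add: plin_mult inv assms plin_mat_1)
  show "bij (plin M)" by (rule o_bij[of "plin N"]) (simp_all add: fun_eq_iff 1)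
  show "inv (plin M) = plin N" by (rule inv_unique_comp) (simp_all add: fun_eq_iff 1)
qed

lemma plin_Aut:
  assumes "invertible M"
  shows "plin M \<in> Aut_cp2"
proof -
  obtain N where N: "M ** N = mat 1" "N ** M = mat 1" using assms by (auto simp: invertible_def)
  then have "invertible N" by (auto simp: invertible_def)
  then have "holomorphic_map (plin M)" "holomorphic_map (plin N)"
    using plin_holomorphic assms by simp_all
  then show ?thesis by (simp add: Aut_cp2_def biholomorphism_def plin_inverse[OF N])
qed

section \<open>Functions of one complex variable\<close>

lemma vec_derivative_along_line:
  fixes F :: "complex ^ 'n \<Rightarrow> complex ^ 'm"
  assumes "(F has_derivative (*v) J) (at (p + t *s q))"
  shows "((\<lambda>t. F (p + t *s q) $ k) has_field_derivative (J *v q) $ k) (at t)"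
proof -
  have 1: "((\<lambda>t. p + t *s q) has_derivative (\<lambda>h. h *s q)) (at t)"
    by (rule has_derivative_vec_components) (auto intro!: derivative_eq_intros)
  have "((\<lambda>x. F x $ k) has_derivative (\<lambda>h. (J *v h) $ k)) (at (p + t *s q))"
    by (rule bounded_linear.has_derivative[OF bounded_linear_vec_nth assms])
  from diff_chain_at[OF 1 this]
  show ?thesis unfolding has_field_derivative_def o_def
    by (rule has_derivative_eq_rhs) (simp add: vector_scalar_commute fun_eq_iff mult.commute)
qed

definition jacobian :: "(complex ^ 'n \<Rightarrow> complex ^ 'm) \<Rightarrow> complex ^ 'n \<Rightarrow> complex ^ 'n ^ 'm" where
  "jacobian F v = (SOME J. (F has_derivative (*v) J) (at v))"

lemma has_derivative_jacobian: "cdiff F v \<Longrightarrow> (F has_derivative (*v) (jacobian F v)) (at v)"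
  unfolding cdiff_def jacobian_def by (rule someI_ex)

text \<open>The difference quotients in \<open>y\<close> are holomorphic in \<open>t\<close>. The
  common bound \<open>M\<close> controls the second derivative in \<open>y\<close> by Cauchy's
  inequality, so by Taylor they converge uniformly in \<open>t\<close>, and a uniform limit of
  holomorphic functions is holomorphic.\<close>

lemma deriv_parameter_holomorphic:
  fixes h :: "complex \<Rightarrow> complex \<Rightarrow> complex"
  assumes r: "r > 0"
    and h1: "\<And>y. y \<in> ball 0 r \<Longrightarrow> (\<lambda>t. h t y) holomorphic_on ball t0 r"
    and h2: "\<And>t. t \<in> ball t0 r \<Longrightarrow> h t holomorphic_on ball 0 r"
    and M: "\<And>t y. t \<in> ball t0 r \<Longrightarrow> y \<in> ball 0 r \<Longrightarrow> cmod (h t y) \<le> M"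
  shows "(\<lambda>t. deriv (h t) 0) holomorphic_on ball t0 r"
proof -
  \<comment> \<open>The factor 4 keeps every \<open>e n\<close> inside
    \<open>ball 0 (r / 2)\<close>; closed discs of radius \<open>r / 4\<close> about points of that
    ball stay inside \<open>ball 0 r\<close>.\<close>
  define e where "e n = complex_of_real (r / (4 * (real n + 1)))" for n
  define F where "F n t = (h t (e n) - h t 0) / e n" for n t
  \<comment> \<open>Cauchy's bound for a second derivative on a circle of radius
    \<open>r / 4\<close>; the 2 is \<open>fact 2\<close>.\<close>
  define B where "B = 2 * M / (r / 4)\<^sup>2"
  have e: "e n \<noteq> 0" "e n \<in> ball 0 (r / 2)" "e n \<in> ball 0 r" for n
  proof -
    have "r / (4 * (real n + 1)) \<le> r / 4" "0 < r / (4 * (real n + 1))"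
      using r by (simp_all add: field_simps)
    then have "cmod (e n) \<le> r / 4" "0 < cmod (e n)" unfolding e_def norm_of_real by linarith+
    then show "e n \<noteq> 0" "e n \<in> ball 0 (r / 2)" "e n \<in> ball 0 r"
      using r by auto
  qed
  have est: "cmod (F n t - deriv (h t) 0) \<le> B * cmod (e n)" if t: "t \<in> ball t0 r" for n t
  proof -
    have "cmod ((deriv ^^ 0) (h t) (e n) - (\<Sum>i\<le>1. (deriv ^^ i) (h t) 0 * (e n - 0) ^ i / fact i))
        \<le> B * cmod (e n - 0) ^ Suc 1 / fact 1"
    proof (rule complex_Taylor[where S = "ball 0 (r / 2)"])
      fix i :: nat and x :: complex assume x: "x \<in> ball 0 (r / 2)"
      have "(deriv ^^ i) (h t) holomorphic_on ball 0 r"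
        using h2[OF t] by (rule holomorphic_higher_deriv) simp
      moreover have "x \<in> ball 0 r" using x r by simp
      ultimately have "((deriv ^^ i) (h t) has_field_derivative deriv ((deriv ^^ i) (h t)) x) (at x)"
        by (rule holomorphic_derivI[OF _ open_ball])
      then have "((deriv ^^ i) (h t) has_field_derivative (deriv ^^ Suc i) (h t) x) (at x)"
        by simp
      then show "((deriv ^^ i) (h t) has_field_derivative (deriv ^^ Suc i) (h t) x)
          (at x within ball 0 (r / 2))"
        by (rule has_field_derivative_at_within)
    next
      fix x :: complex assume x: "x \<in> ball 0 (r / 2)"
      have sub: "cball x (r / 4) \<subseteq> ball 0 r"
      proof
        fix y assume "y \<in> cball x (r / 4)"
        then have "cmod y \<le> cmod x + r / 4"
          using norm_triangle_ineq2[of y x] by (simp add: dist_norm norm_minus_commute)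
        then show "y \<in> ball 0 r" using x r by simp
      qed
      have "cmod ((deriv ^^ 2) (h t) x) \<le> fact 2 * M / (r / 4) ^ 2"
      proof (rule Cauchy_inequality)
        show "h t holomorphic_on ball x (r / 4)"
          using h2[OF t] sub ball_subset_cball by (metis holomorphic_on_subset order_trans)
        show "continuous_on (cball x (r / 4)) (h t)"
          using holomorphic_on_imp_continuous_on[OF h2[OF t]] sub by (rule continuous_on_subset)
        show "0 < r / 4" using r by simp
        fix y assume "cmod (x - y) = r / 4"
        then have "y \<in> cball x (r / 4)" by (simp add: dist_norm)
        then show "cmod (h t y) \<le> M" using M[OF t] sub by blast
      qed
      then show "cmod ((deriv ^^ Suc 1) (h t) x) \<le> B" by (simp add: B_def numeral_2_eq_2)
    qed (use e r in auto)
    then have "cmod (h t (e n) - h t 0 - deriv (h t) 0 * e n) \<le> B * cmod (e n) * cmod (e n)"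
      by (simp add: power2_eq_square diff_diff_eq mult.assoc)
    moreover have "h t (e n) - h t 0 - deriv (h t) 0 * e n = (F n t - deriv (h t) 0) * e n"
      using e by (simp add: F_def field_simps)
    ultimately show ?thesis using e by (simp add: norm_mult)
  qed
  have "uniform_limit (ball t0 r) F (\<lambda>t. deriv (h t) 0) sequentially"
  proof (rule uniform_limitI)
    fix \<epsilon> :: real assume "\<epsilon> > 0"
    have "(\<lambda>n. B * cmod (e n)) \<longlonglongrightarrow> 0"
    proof -
      have "(\<lambda>n. B * (r / 4) * inverse (real (Suc n))) \<longlonglongrightarrow> B * (r / 4) * 0"
        by (intro tendsto_mult tendsto_const LIMSEQ_inverse_real_of_nat)
      moreover have "B * cmod (e n) = B * (r / 4) * inverse (real (Suc n))" for n
        using r by (simp add: e_def norm_divide norm_mult field_simps del: of_real_divide)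
      ultimately show ?thesis by (simp only: mult_zero_right)
    qed
    then have "\<forall>\<^sub>F n in sequentially. B * cmod (e n) < \<epsilon>"
      using \<open>\<epsilon> > 0\<close> by (rule order_tendstoD)
    then show "\<forall>\<^sub>F n in sequentially. \<forall>t\<in>ball t0 r. dist (F n t) (deriv (h t) 0) < \<epsilon>"
    proof eventually_elim
      case (elim n)
      then show ?case using est[of _ n] by (fastforce simp: dist_norm)
    qed
  qed
  then have ul: "uniform_limit A F (\<lambda>t. deriv (h t) 0) sequentially" if "A \<subseteq> ball t0 r" for A
    using that by (rule uniform_limit_on_subset)
  show ?thesis
  proof (rule holomorphic_uniform_sequence[of _ F])
    show "F n holomorphic_on ball t0 r" for n
      unfolding F_def using e[of n] r by (intro holomorphic_intros h1) auto
    fix x assume "x \<in> ball t0 r"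
    then obtain d where "d > 0" "cball x d \<subseteq> ball t0 r" using open_contains_cball by blast
    then show "\<exists>d>0. cball x d \<subseteq> ball t0 r \<and>
        uniform_limit (cball x d) F (\<lambda>t. deriv (h t) 0) sequentially"
      using ul by blast
  qed simp
qed

lemma continuous_on_line: "continuous_on A (\<lambda>t. (p :: complex ^ 'n) + t *s q)"
  unfolding vector_scalar_mult_def by (intro continuous_intros)

lemma open_line_preimage: "open U \<Longrightarrow> open {t. (p :: complex ^ 'n) + t *s q \<in> U}"
  using open_vimage[OF _ continuous_on_line, of U p q] by (simp add: vimage_def)

text \<open>The entry is the \<open>y\<close>-derivative at 0 of
  \<open>F (p + t *s q + y *s u) $ k\<close>. This function is holomorphic in \<open>t\<close> and
  in \<open>y\<close> separately and locally bounded by continuity, which is what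
  \<open>deriv_parameter_holomorphic\<close> asks for.\<close>

lemma jacobian_holomorphic:
  fixes F :: "complex ^ 'n \<Rightarrow> complex ^ 'm"
  assumes U: "open U" and F: "\<And>v. v \<in> U \<Longrightarrow> cdiff F v"
  shows "(\<lambda>t. (jacobian F (p + t *s q) *v u) $ k) holomorphic_on {t. p + t *s q \<in> U}"
    (is "?D holomorphic_on ?S")
proof -
  have "\<exists>r>0. ?D holomorphic_on ball t0 r" if t0: "t0 \<in> ?S" for t0
  proof -
    let ?v = "p + t0 *s q"
    \<comment> \<open>The added 1 makes the strict inequality defining \<open>U'\<close> hold at the
      base point, so that \<open>U'\<close> is an open neighbourhood on which \<open>M\<close> is a
      bound.\<close>
    define M where "M = cmod (F ?v $ k) + 1"
    define U' where "U' = U \<inter> (\<lambda>v. cmod (F v $ k)) -` {..<M}"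
    have "continuous_on U F"
      by (intro continuous_at_imp_continuous_on ballI cdiff_imp_continuous F)
    then have "open U'" unfolding U'_def
      by (intro continuous_open_preimage U continuous_intros) auto
    moreover have "continuous_on UNIV (\<lambda>z. p + fst z *s q + snd z *s u)"
      unfolding vector_scalar_mult_def by (intro continuous_intros)
    ultimately have "open ((\<lambda>z. p + fst z *s q + snd z *s u) -` U')"
      by (rule open_vimage)
    moreover have "(t0, 0) \<in> (\<lambda>z. p + fst z *s q + snd z *s u) -` U'"
      using t0 by (simp add: U'_def M_def)
    ultimately obtain A B where AB: "open A" "open B" "(t0, 0) \<in> A \<times> B"
        "A \<times> B \<subseteq> (\<lambda>z. p + fst z *s q + snd z *s u) -` U'"
      by (rule open_prod_elim)
    then obtain a b where "a > 0" "ball t0 a \<subseteq> A" "b > 0" "ball 0 b \<subseteq> B"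
      by (metis mem_Sigma_iff open_contains_ball)
    define r where "r = min a b"
    have r: "r > 0" "ball t0 r \<subseteq> A" "ball 0 r \<subseteq> B"
      using \<open>a > 0\<close> \<open>b > 0\<close> \<open>ball t0 a \<subseteq> A\<close> \<open>ball 0 b \<subseteq> B\<close> by (auto simp: r_def)
    have in_U': "p + t *s q + y *s u \<in> U'" if "t \<in> ball t0 r" "y \<in> ball 0 r" for t y
      using that r AB(4) by (force simp: subset_iff)
    define h where "h t y = F (p + t *s q + y *s u) $ k" for t y
    have dy: "(h t has_field_derivative (jacobian F (p + t *s q + y *s u) *v u) $ k) (at y)"
      if "t \<in> ball t0 r" "y \<in> ball 0 r" for t y
      unfolding h_def using in_U'[OF that]
      by (intro vec_derivative_along_line has_derivative_jacobian F) (simp add: U'_def)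
    have dt: "((\<lambda>t. h t y) has_field_derivative (jacobian F (p + t *s q + y *s u) *v q) $ k) (at t)"
      if "t \<in> ball t0 r" "y \<in> ball 0 r" for t y
    proof -
      have "p + t *s q + y *s u = (p + y *s u) + t *s q" for t by simp
      then show ?thesis unfolding h_def using in_U'[OF that]
        by (simp only:) (intro vec_derivative_along_line has_derivative_jacobian F, simp add: U'_def)
    qed
    have "(\<lambda>t. deriv (h t) 0) holomorphic_on ball t0 r"
    proof (rule deriv_parameter_holomorphic[OF \<open>r > 0\<close>])
      show "(\<lambda>t. h t y) holomorphic_on ball t0 r" if "y \<in> ball 0 r" for y
        unfolding holomorphic_on_open[OF open_ball] using dt[OF _ that] by blast
      show "h t holomorphic_on ball 0 r" if "t \<in> ball t0 r" for t
        unfolding holomorphic_on_open[OF open_ball] using dy[OF that] by blast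
      show "cmod (h t y) \<le> M" if "t \<in> ball t0 r" "y \<in> ball 0 r" for t y
        using in_U'[OF that] by (simp add: h_def U'_def)
    qed
    moreover have "deriv (h t) 0 = ?D t" if "t \<in> ball t0 r" for t
      using DERIV_imp_deriv[OF dy[OF that, of 0]] r by simp
    ultimately have "?D holomorphic_on ball t0 r" by (rule holomorphic_transform)
    then show ?thesis using \<open>r > 0\<close> by blast
  qed
  then have "?D analytic_on ?S" by (auto simp: analytic_on_def)
  then show ?thesis by (rule analytic_imp_holomorphic)
qed

section \<open>Entire functions that are cubes of affine functions\<close>

lemma complex_cube_root: obtains z :: complex where "z ^ 3 = c"
proof (cases "c = 0")
  case True then show ?thesis using that[of 0] by simp
next
  case False
  then have "exp (Ln c / 3) ^ 3 = c" by (simp flip: exp_of_nat_mult)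
  then show ?thesis using that by blast
qed

text \<open>Without zeros, \<open>\<phi>\<close> is a polynomial by the growth bound and hence
  constant by the fundamental theorem of algebra. At a zero \<open>a\<close>, the quotient by
  \<open>(t - a) ^ 3\<close> has a removable singularity and is bounded, hence constant by
  Liouville.\<close>

lemma entire_cube_of_affine:
  assumes h: "\<phi> holomorphic_on UNIV"
    and C: "\<And>t. cmod t \<ge> 1 \<Longrightarrow> cmod (\<phi> t) \<le> C * cmod t ^ 3"
    and z: "\<And>a. \<phi> a = 0 \<Longrightarrow> \<exists>B. \<forall>\<^sub>F t in at a. cmod (\<phi> t) \<le> B * cmod (t - a) ^ 3"
  shows "\<exists>\<alpha> \<beta>. \<forall>t. \<phi> t = (\<alpha> + \<beta> * t) ^ 3"
proof (cases "\<exists>a. \<phi> a = 0")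
  case False
  define c where "c k = (deriv ^^ k) \<phi> 0 / fact k" for k
  have \<phi>: "\<phi> t = (\<Sum>k\<le>3. c k * t ^ k)" for t
    unfolding c_def using h C by (rule Liouville_polynomial)
  have "c i = 0" if "i \<in> {1..3}" for i
  proof (rule ccontr)
    assume "c i \<noteq> 0"
    then have "c 0 = 0 \<or> (\<exists>i\<in>{1..3}. c i \<noteq> 0)" using that by blast
    then show False using False \<phi> by (metis fundamental_theorem_of_algebra)
  qed
  then have "\<phi> t = c 0" for t unfolding \<phi> by (simp add: numeral_3_eq_3)
  then show ?thesis using complex_cube_root[of "c 0"]
    by (metis add.right_neutral mult_zero_left)
next
  case True
  then obtain a where a: "\<phi> a = 0" by blast
  then obtain B where B: "\<forall>\<^sub>F t in at a. cmod (\<phi> t) \<le> B * cmod (t - a) ^ 3" using z by blast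
  define \<psi> where "\<psi> t = \<phi> t / (t - a) ^ 3" for t
  have "\<psi> holomorphic_on UNIV - {a}" unfolding \<psi>_def
    using h by (intro holomorphic_intros) (auto intro: holomorphic_on_subset)
  moreover have "\<forall>\<^sub>F t in at a. cmod (\<psi> t) \<le> B"
    using B eventually_neq_at_within[of a a UNIV]
    by eventually_elim (simp add: \<psi>_def norm_divide norm_power divide_le_eq)
  ultimately obtain g where g: "g holomorphic_on UNIV" "\<And>t. t \<noteq> a \<Longrightarrow> g t = \<psi> t"
    using holomorphic_on_extend_bounded[of \<psi> UNIV a] by auto
  have \<phi>: "\<phi> t = g t * (t - a) ^ 3" for t
    using a g(2)[of t] by (cases "t = a") (simp_all add: \<psi>_def)
  \<comment> \<open>For such \<open>t\<close> the distance to \<open>a\<close> is at least half of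
    \<open>cmod t\<close>; cubing this half gives the factor 8.\<close>
  have "cmod (g t) \<le> (8 * C) * cmod t ^ 0" if t: "2 * cmod a + 1 \<le> cmod t" for t
  proof -
    have "cmod t \<ge> 1" using t norm_ge_zero[of a] by linarith
    have "cmod t / 2 \<le> cmod (t - a)" using t norm_triangle_ineq2[of t a] by linarith
    then have "(cmod t / 2) ^ 3 \<le> cmod (t - a) ^ 3" by (intro power_mono) auto
    then have "cmod (g t) * (cmod t / 2) ^ 3 \<le> cmod (g t) * cmod (t - a) ^ 3"
      by (intro mult_left_mono) auto
    also have "\<dots> = cmod (\<phi> t)" by (simp add: \<phi> norm_mult norm_power)
    also have "\<dots> \<le> C * cmod t ^ 3" using C \<open>cmod t \<ge> 1\<close> .
    finally have "cmod (g t) * cmod t ^ 3 \<le> 8 * C * cmod t ^ 3" by (simp add: power_divide)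
    moreover have "t \<noteq> 0" using \<open>cmod t \<ge> 1\<close> by auto
    ultimately show ?thesis by simp
  qed
  note bound = this
  have const: "g t = g 0" for t
  proof -
    have "g t = (\<Sum>k\<le>0. (deriv ^^ k) g 0 / fact k * t ^ k)"
      using g(1) bound by (rule Liouville_polynomial)
    also have "\<dots> = (deriv ^^ 0) g 0 / fact 0 * t ^ 0" by (subst atMost_0, subst sum.insert) simp_all
    finally show ?thesis by (simp only: funpow_0 fact_0 power_0 div_by_1 mult_1_right)
  qed
  obtain c where "c ^ 3 = g 0" using complex_cube_root .
  have "\<phi> t = (- (c * a) + c * t) ^ 3" for t
  proof -
    have "\<phi> t = c ^ 3 * (t - a) ^ 3" using \<open>c ^ 3 = g 0\<close> const[of t] \<phi>[of t] by metis
    then show ?thesis by (simp add: power_mult_distrib[symmetric] algebra_simps)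
  qed
  then show ?thesis by blast
qed

text \<open>Away from finitely many points the quotient of the two sides is continuous with cube 1.
  The plane minus a finite set is connected, so the quotient is a constant root of unity.\<close>

lemma affine_cube_root_unique:
  fixes \<alpha> \<beta> \<gamma> \<delta> :: complex
  defines "S \<equiv> {t. \<alpha> + \<beta> * t \<noteq> 0}"
  assumes ne: "S \<noteq> {}" and cont: "continuous_on S \<psi>"
    and eq: "\<And>t. t \<in> S \<Longrightarrow> (\<psi> t * (\<alpha> + \<beta> * t)) ^ 3 = (\<gamma> + \<delta> * t) ^ 3"
  shows "\<exists>\<omega>. \<omega> \<noteq> 0 \<and> (\<forall>t\<in>S. \<psi> t * (\<alpha> + \<beta> * t) = \<omega> * (\<gamma> + \<delta> * t))"
proof (cases "\<gamma> = 0 \<and> \<delta> = 0")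
  case True
  then show ?thesis using eq by (intro exI[of _ 1]) auto
next
  case False
  define T where "T = {t \<in> S. \<gamma> + \<delta> * t \<noteq> 0}"
  define g where "g t = \<psi> t * (\<alpha> + \<beta> * t) / (\<gamma> + \<delta> * t)" for t
  have fin: "finite {t. a + b * t = 0}" if "\<not> (a = 0 \<and> b = 0)" for a b :: complex
  proof (cases "b = 0")
    case False
    then have "{t. a + b * t = 0} \<subseteq> {- a / b}" by (auto simp: field_simps eq_neg_iff_add_eq_0)
    then show ?thesis by (rule finite_subset) simp
  qed (use that in simp)
  have "\<not> (\<alpha> = 0 \<and> \<beta> = 0)" using ne by (auto simp: S_def)
  then have F: "finite ({t. \<alpha> + \<beta> * t = 0} \<union> {t. \<gamma> + \<delta> * t = 0})" using fin False by blast
  moreover have T: "T = UNIV - ({t. \<alpha> + \<beta> * t = 0} \<union> {t. \<gamma> + \<delta> * t = 0})"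
    by (auto simp: T_def S_def)
  ultimately have "connected T"
    using connected_open_delete_finite[OF open_UNIV connected_UNIV _ F] by simp
  moreover have "continuous_on T g" unfolding g_def
    by (intro continuous_intros continuous_on_subset[OF cont]) (auto simp: T_def)
  moreover have "g ` T \<subseteq> {z. z ^ 3 = 1}"
    using eq by (auto simp: g_def T_def power_divide)
  then have "finite (g ` T)" by (rule finite_subset) (simp add: finite_roots_unity)
  ultimately have "g constant_on T" by (rule continuous_finite_range_constant)
  then obtain \<omega> where \<omega>: "\<And>t. t \<in> T \<Longrightarrow> g t = \<omega>" by (auto simp: constant_on_def)
  have "T \<noteq> {}" using F infinite_UNIV_char_0 unfolding T by (metis Diff_eq_empty_iff finite_subset)
  then obtain t1 where "t1 \<in> T" by blast
  then have "\<omega> ^ 3 = 1" using \<omega> \<open>g ` T \<subseteq> {z. z ^ 3 = 1}\<close> by blast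
  then have "\<omega> \<noteq> 0" by auto
  moreover have "\<psi> t * (\<alpha> + \<beta> * t) = \<omega> * (\<gamma> + \<delta> * t)" if "t \<in> S" for t
  proof (cases "t \<in> T")
    case True
    then show ?thesis using \<omega>[OF True] by (auto simp: g_def T_def field_simps)
  next
    case False
    \<comment> \<open>Here \<open>\<gamma> + \<delta> * t\<close> is 0, and by \<open>eq\<close> the
      left side has cube 0 as well.\<close>
    then show ?thesis using that eq[OF that] by (auto simp: T_def)
  qed
  ultimately show ?thesis by blast
qed

section \<open>The Jacobian determinant along a line\<close>

definition cols3 :: "'a ^ 3 \<Rightarrow> 'a ^ 3 \<Rightarrow> 'a ^ 3 \<Rightarrow> 'a ^ 3 ^ 3" where
  "cols3 a b c = (\<chi> i j. if j = 1 then a $ i else if j = 2 then b $ i else c $ i)"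

lemma cols3_mult:
  fixes a b c :: "'a :: comm_ring_1 ^ 3"
  shows "cols3 a b c *v x = x $ 1 *s a + x $ 2 *s b + x $ 3 *s c"
  by (simp add: cols3_def vec_eq_iff matrix_vector_mult_def sum_3 mult.commute)

lemma det_cols3:
  fixes a b c :: "'a :: comm_ring_1 ^ 3"
  shows "det (cols3 a b c) =
    a$1 * (b$2 * c$3 - b$3 * c$2) - b$1 * (a$2 * c$3 - a$3 * c$2) + c$1 * (a$2 * b$3 - a$3 * b$2)"
  by (simp add: cols3_def det_3 algebra_simps)

lemma det_cols3_nonzero_iff:
  fixes a b c :: "'a :: field ^ 3"
  shows "det (cols3 a b c) \<noteq> 0 \<longleftrightarrow>
    (\<forall>x y z. x *s a + y *s b + z *s c = 0 \<longrightarrow> x = 0 \<and> y = 0 \<and> z = 0)"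
proof -
  have "det (cols3 a b c) \<noteq> 0 \<longleftrightarrow> (\<forall>x. cols3 a b c *v x = 0 \<longrightarrow> x = 0)"
    by (simp add: invertible_det_nz[symmetric] invertible_left_inverse matrix_left_invertible_ker)
  also have "\<dots> \<longleftrightarrow> (\<forall>x y z. x *s a + y *s b + z *s c = 0 \<longrightarrow> x = 0 \<and> y = 0 \<and> z = 0)"
  proof (intro iffI allI impI)
    fix x y z
    assume *: "\<forall>x. cols3 a b c *v x = 0 \<longrightarrow> x = 0" "x *s a + y *s b + z *s c = 0"
    from *(2) have "cols3 a b c *v vector [x, y, z] = 0" by (simp add: cols3_mult)
    with *(1) have "(vector [x, y, z] :: 'a ^ 3) = 0" by metis
    then show "x = 0 \<and> y = 0 \<and> z = 0" by (simp add: vec_eq_iff forall_3 vector_3)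
  next
    fix x
    assume *: "\<forall>x y z. x *s a + y *s b + z *s c = 0 \<longrightarrow> x = 0 \<and> y = 0 \<and> z = 0"
      "cols3 a b c *v x = 0"
    have "x $ 1 = 0 \<and> x $ 2 = 0 \<and> x $ 3 = 0"
      using *(1)[rule_format] *(2)[unfolded cols3_mult] by metis
    then show "x = 0" by (simp add: vec_eq_iff forall_3)
  qed
  finally show ?thesis .
qed

section \<open>Local lifts of a biholomorphism and their derivatives\<close>

locale cp2_biholomorphism =
  fixes f :: "cp2 \<Rightarrow> cp2"
  assumes bihol: "biholomorphism f"
begin

abbreviation \<Psi> :: "3 \<Rightarrow> complex ^ 3 \<Rightarrow> complex ^ 3" where "\<Psi> \<equiv> local_lift f"
abbreviation U :: "3 \<Rightarrow> (complex ^ 3) set" where "U \<equiv> lift_dom f"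
abbreviation D :: "3 \<Rightarrow> complex ^ 3 \<Rightarrow> complex ^ 3 ^ 3" where "D j \<equiv> jacobian (\<Psi> j)"

lemma holo: "holomorphic_map f" "holomorphic_map (inv f)" and bij: "bij f"
  using bihol by (auto simp: biholomorphism_def)

lemma open_U: "open (U j)"
  using holo(1) by (intro open_lift_dom) (simp add: holomorphic_map_def)

lemma U_cover: assumes "v \<noteq> 0" obtains j where "v \<in> U j"
  using assms chart_domain_cover[of "f (proj v)"] by (auto simp: lift_dom_def)

lemma \<Psi>_deriv: "v \<in> U j \<Longrightarrow> (\<Psi> j has_derivative (*v) (D j v)) (at v)"
  using local_lift_cdiff[OF holo(1)] by (intro has_derivative_jacobian)

lemma \<Psi>_proj: "v \<in> U j \<Longrightarrow> proj (\<Psi> j v) = f (proj v)"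
  by (simp add: local_lift_def lift_dom_def proj_affine_rep)

lemma \<Psi>_nonzero: "v \<in> U j \<Longrightarrow> \<Psi> j v \<noteq> 0"
  by (simp add: local_lift_def lift_dom_def affine_rep_nonzero)

lemma \<Psi>_nth_self: "v \<in> U j \<Longrightarrow> \<Psi> j v $ j = 1"
  by (simp add: local_lift_def lift_dom_def affine_rep_nth_self)

lemma \<Psi>_nth_nonzero: "v \<in> U j \<Longrightarrow> \<Psi> j v $ k \<noteq> 0 \<longleftrightarrow> v \<in> U k"
  by (simp add: local_lift_def lift_dom_def affine_rep_nth_eq_0)

lemma \<Psi>_change: "v \<in> U j \<Longrightarrow> \<Psi> k v = (1 / \<Psi> j v $ k) *s \<Psi> j v"
  unfolding local_lift_def lift_dom_def by (rule affine_rep_change) simp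

lemma scale_U: "c \<noteq> 0 \<Longrightarrow> c *s v \<in> U j \<longleftrightarrow> v \<in> U j"
  by (cases "v = 0") (simp_all add: lift_dom_def proj_eqI)

lemma \<Psi>_scale: "c \<noteq> 0 \<Longrightarrow> v \<in> U j \<Longrightarrow> \<Psi> j (c *s v) = \<Psi> j v"
  by (simp add: local_lift_def lift_dom_def proj_eqI)

text \<open>The lift is homogeneous of degree 0, so its derivative is homogeneous of degree
  -1.\<close>

lemma D_scale:
  assumes "c \<noteq> 0" "v \<in> U j"
  shows "D j (c *s v) *v (c *s h) = D j v *v h"
proof -
  have lin: "((\<lambda>v. c *s v) has_derivative (\<lambda>h. c *s h)) (at v)"
    by (rule has_derivative_vec_components)
       (simp add: has_derivative_mult_right bounded_linear_imp_has_derivative bounded_linear_vec_nth)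
  from diff_chain_at[OF lin \<Psi>_deriv] assms
  have "((\<lambda>v. \<Psi> j (c *s v)) has_derivative (\<lambda>h. D j (c *s v) *v (c *s h))) (at v)"
    by (simp add: scale_U o_def)
  then have "(\<Psi> j has_derivative (\<lambda>h. D j (c *s v) *v (c *s h))) (at v)"
    by (rule has_derivative_transform_within_open[OF _ open_U assms(2)])
       (simp add: \<Psi>_scale assms(1))
  from has_derivative_unique[OF this \<Psi>_deriv[OF assms(2)]] show ?thesis by (rule fun_cong)
qed

text \<open>Euler's relation in degree 0: the lift is constant along the ray through
  \<open>v\<close>. Parameters in the unit ball keep the factor \<open>1 + t\<close> away from
  0.\<close>

lemma D_Euler:
  assumes "v \<in> U j"
  shows "D j v *v v = 0"
proof (subst vec_eq_iff, intro allI)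
  fix k
  have "((\<lambda>t. \<Psi> j (v + t *s v) $ k) has_field_derivative (D j v *v v) $ k) (at 0)"
    by (rule vec_derivative_along_line) (use \<Psi>_deriv assms in simp)
  moreover have "\<Psi> j (v + t *s v) = \<Psi> j v" if "t \<in> ball 0 1" for t :: complex
  proof -
    have eq: "v + t *s v = (1 + t) *s v" by (simp add: vec_eq_iff algebra_simps)
    have "1 + t \<noteq> 0" using that by (auto simp: add_eq_0_iff)
    then show ?thesis unfolding eq using assms by (rule \<Psi>_scale)
  qed
  ultimately have "((\<lambda>t. \<Psi> j v $ k) has_field_derivative (D j v *v v) $ k) (at 0)"
    by (elim has_field_derivative_transform_within_open[of _ _ _ "ball 0 1"]) simp_all
  then have "(D j v *v v) $ k = 0" by (rule DERIV_unique[OF _ DERIV_const])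
  then show "(D j v *v v) $ k = 0 $ k" by simp
qed

lemma D_nth_self:
  assumes "v \<in> U j"
  shows "(D j v *v h) $ j = 0"
proof -
  have "((\<lambda>v. \<Psi> j v $ j) has_derivative (\<lambda>h. (D j v *v h) $ j)) (at v)"
    by (rule bounded_linear.has_derivative[OF bounded_linear_vec_nth \<Psi>_deriv[OF assms]])
  then have "((\<lambda>v. 1) has_derivative (\<lambda>h. (D j v *v h) $ j)) (at v)"
    by (rule has_derivative_transform_within_open[OF _ open_U assms]) (rule \<Psi>_nth_self)
  from has_derivative_unique[OF this has_derivative_const] show ?thesis by (rule fun_cong)
qed

text \<open>By the quotient rule; the correction is a multiple of \<open>\<Psi> j v\<close>, the
  third column of the determinant defining \<open>\<kappa>\<close> below.\<close>

lemma D_change: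
  assumes "v \<in> U j" "v \<in> U k"
  defines "g \<equiv> \<Psi> j v $ k"
  shows "D k v *v h = (1 / g) *s (D j v *v h) - ((D j v *v h) $ k / g\<^sup>2) *s \<Psi> j v"
proof -
  have "g \<noteq> 0" using assms by (simp add: \<Psi>_nth_nonzero)
  from diff_chain_at[OF \<Psi>_deriv[OF assms(1)] dehomogenize_has_derivative[OF this[unfolded g_def]]]
  have "((\<lambda>v. (1 / \<Psi> j v $ k) *s \<Psi> j v) has_derivative
      (\<lambda>h. (1 / g) *s (D j v *v h) - ((D j v *v h) $ k / g\<^sup>2) *s \<Psi> j v)) (at v)"
    by (simp add: g_def o_def)
  then have "(\<Psi> k has_derivative
      (\<lambda>h. (1 / g) *s (D j v *v h) - ((D j v *v h) $ k / g\<^sup>2) *s \<Psi> j v)) (at v)"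
    by (rule has_derivative_transform_within_open[OF _ open_U assms(1)]) (rule \<Psi>_change[symmetric])
  from has_derivative_unique[OF \<Psi>_deriv[OF assms(2)] this] show ?thesis by (rule fun_cong)
qed

text \<open>A lift of the inverse map composed with the lift of \<open>f\<close> is
  dehomogenization, whose derivative kills only multiples of \<open>v\<close>. By the chain rule the
  derivative of the lift of \<open>f\<close> cannot kill more.\<close>

lemma D_kernel:
  assumes v: "v \<in> U j" and h: "D j v *v h = 0"
  shows "\<exists>c. h = c *s v"
proof -
  have "v \<noteq> 0" using v by (simp add: lift_dom_def)
  then obtain i where i: "v $ i \<noteq> 0" by (auto simp: vec_eq_iff)
  let ?G = "local_lift (inv f) i"
  have inv: "inv f (f P) = P" for P using bij by (simp add: bij_is_inj)
  have eq: "?G (\<Psi> j x) = (1 / x $ i) *s x" if "x \<in> U j" for x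
    using that \<Psi>_proj[OF that] unfolding local_lift_def[of "inv f"]
    by (simp add: inv affine_rep_proj lift_dom_def)
  have "\<Psi> j v \<in> lift_dom (inv f) i"
    using \<Psi>_proj[OF v] \<Psi>_nonzero[OF v] i \<open>v \<noteq> 0\<close> by (simp add: lift_dom_def inv mem_chart_domain)
  then have "(?G has_derivative (*v) (jacobian ?G (\<Psi> j v))) (at (\<Psi> j v))"
    using local_lift_cdiff[OF holo(2)] by (intro has_derivative_jacobian)
  from diff_chain_at[OF \<Psi>_deriv[OF v] this]
  have "((\<lambda>x. ?G (\<Psi> j x)) has_derivative (\<lambda>h. jacobian ?G (\<Psi> j v) *v (D j v *v h))) (at v)"
    by (simp add: o_def)
  then have "((\<lambda>x. (1 / x $ i) *s x) has_derivative (\<lambda>h. jacobian ?G (\<Psi> j v) *v (D j v *v h))) (at v)"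
    by (rule has_derivative_transform_within_open[OF _ open_U v]) (rule eq)
  from has_derivative_unique[OF this dehomogenize_has_derivative[OF i]]
  have "(1 / v $ i) *s h - (h $ i / (v $ i)\<^sup>2) *s v = jacobian ?G (\<Psi> j v) *v (D j v *v h)"
    by (metis (no_types))
  then have "(1 / v $ i) *s h = (h $ i / (v $ i)\<^sup>2) *s v" by (simp add: h)
  then have "v $ i *s ((1 / v $ i) *s h) = v $ i *s ((h $ i / (v $ i)\<^sup>2) *s v)" by simp
  then have "h = (v $ i * (h $ i / (v $ i)\<^sup>2)) *s v" using i by simp
  then show ?thesis ..
qed

text \<open>Up to a nonvanishing factor this is the Jacobian determinant of \<open>f\<close> in affine charts, along the
  line through \<open>p\<close> and \<open>q\<close>. Multiplying the lift of \<open>f\<close> by \<open>g\<close> multiplies \<open>\<kappa>\<close> by \<open>g ^ 3\<close>, so the functions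
  \<open>1 / \<kappa>\<close> for the different target charts are proportional to the cubes of the homogeneous coordinates
  of \<open>f\<close>.\<close>

definition \<kappa> :: "complex ^ 3 \<Rightarrow> complex ^ 3 \<Rightarrow> complex ^ 3 \<Rightarrow> 3 \<Rightarrow> complex \<Rightarrow> complex" where
  "\<kappa> p q u j t = det (cols3 (D j (p + t *s q) *v q) (D j (p + t *s q) *v u) (\<Psi> j (p + t *s q)))"

text \<open>The default 0 is the correct value: outside \<open>U j\<close> the homogeneous
  coordinate \<open>j\<close> of the image point vanishes, so with this value the function stays
  holomorphic across such parameters.\<close>

definition \<phi> :: "complex ^ 3 \<Rightarrow> complex ^ 3 \<Rightarrow> complex ^ 3 \<Rightarrow> 3 \<Rightarrow> complex \<Rightarrow> complex" where
  "\<phi> p q u j t = (if p + t *s q \<in> U j then 1 / \<kappa> p q u j t else 0)"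

section \<open>Holomorphy and transformation rules of \<open>\<kappa>\<close> and
  \<open>\<phi>\<close>\<close>

lemma \<Psi>_line_holomorphic: "(\<lambda>t. \<Psi> j (p + t *s q) $ k) holomorphic_on {t. p + t *s q \<in> U j}"
proof -
  have "open {t. p + t *s q \<in> U j}" by (rule open_line_preimage[OF open_U])
  then show ?thesis
    by (auto simp: holomorphic_on_open intro!: exI vec_derivative_along_line \<Psi>_deriv)
qed

lemma \<kappa>_holomorphic: "\<kappa> p q u j holomorphic_on {t. p + t *s q \<in> U j}"
  unfolding \<kappa>_def det_cols3
  by (intro holomorphic_intros jacobian_holomorphic[OF open_U] \<Psi>_line_holomorphic local_lift_cdiff holo)

lemma line_nonzero:
  fixes p q u :: "complex ^ 3"
  assumes "det (cols3 p q u) \<noteq> 0"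
  shows "p + t *s q \<noteq> 0"
proof
  assume "p + t *s q = 0"
  then have "1 *s p + t *s q + 0 *s u = 0" by simp
  then show False using assms unfolding det_cols3_nonzero_iff by (metis zero_neq_one)
qed

text \<open>In a linear relation between the columns, coordinate \<open>j\<close> isolates the third
  one, since the derivative columns vanish there and the lift is 1. What is left is a combination of
  \<open>q\<close> and \<open>u\<close> in the kernel of the derivative, hence a multiple of
  \<open>p + t *s q\<close>; independence of \<open>p\<close>, \<open>q\<close>, \<open>u\<close>
  makes it trivial.\<close>

lemma \<kappa>_nonzero:
  assumes det: "det (cols3 p q u) \<noteq> 0" and t: "p + t *s q \<in> U j"
  shows "\<kappa> p q u j t \<noteq> 0"
  unfolding \<kappa>_def det_cols3_nonzero_iff
proof (intro allI impI)
  fix x y z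
  let ?v = "p + t *s q"
  assume *: "x *s (D j ?v *v q) + y *s (D j ?v *v u) + z *s \<Psi> j ?v = 0"
  then have "(x *s (D j ?v *v q) + y *s (D j ?v *v u) + z *s \<Psi> j ?v) $ j = 0" by simp
  then have "z = 0" by (simp add: D_nth_self \<Psi>_nth_self t)
  with * have "D j ?v *v (x *s q + y *s u) = 0"
    by (simp add: matrix_vector_right_distrib vector_scalar_commute)
  then obtain c where "x *s q + y *s u = c *s ?v" using D_kernel[OF t] by blast
  then have "(- c) *s p + (x - c * t) *s q + y *s u = 0"
    by (simp add: vec_eq_iff algebra_simps)
  then have "- c = 0 \<and> x - c * t = 0 \<and> y = 0"
    using det unfolding det_cols3_nonzero_iff by blast
  then show "x = 0 \<and> y = 0 \<and> z = 0" using \<open>z = 0\<close> by simp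
qed

text \<open>Changing the target chart divides every column by \<open>g\<close>, up to multiples of
  the third column, which column operations remove.\<close>

lemma \<kappa>_change:
  assumes "p + t *s q \<in> U j" "p + t *s q \<in> U k"
  shows "\<kappa> p q u k t * (\<Psi> j (p + t *s q) $ k) ^ 3 = \<kappa> p q u j t"
proof -
  let ?v = "p + t *s q"
  define g where "g = \<Psi> j ?v $ k"
  have "g \<noteq> 0" using assms by (simp add: g_def \<Psi>_nth_nonzero)
  have alg: "det (cols3 ((1 / g) *s a - x *s c) ((1 / g) *s b - y *s c) ((1 / g) *s c)) * g ^ 3
      = det (cols3 a b c)" for a b c x y
  proof -
    have "det (cols3 (r *s a - x *s c) (r *s b - y *s c) (r *s c)) = r ^ 3 * det (cols3 a b c)" for r
      unfolding det_cols3 by (simp add: algebra_simps power3_eq_cube)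
    then show ?thesis using \<open>g \<noteq> 0\<close> by (simp add: power_divide)
  qed
  show ?thesis unfolding \<kappa>_def D_change[OF assms] \<Psi>_change[OF assms(1), of k] g_def[symmetric]
    by (rule alg)
qed

lemma \<phi>_change:
  assumes det: "det (cols3 p q u) \<noteq> 0" and j: "p + t *s q \<in> U j"
  shows "\<phi> p q u k t = \<phi> p q u j t * (\<Psi> j (p + t *s q) $ k) ^ 3"
proof (cases "p + t *s q \<in> U k")
  case True
  then show ?thesis using \<kappa>_change[OF j True, of u] \<kappa>_nonzero[OF det] j
    by (simp add: \<phi>_def divide_simps) (simp add: mult.commute)
next
  case False
  then have "\<Psi> j (p + t *s q) $ k = 0" using \<Psi>_nth_nonzero[OF j] by blast
  then show ?thesis using False by (simp add: \<phi>_def)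
qed

text \<open>Near any parameter some chart \<open>j\<close> contains the image point, and there
  \<open>\<phi>_change\<close> expresses the function through the zero-free \<open>\<kappa>\<close>
  and the lift for \<open>j\<close>, even where coordinate \<open>k\<close> vanishes.\<close>

lemma \<phi>_holomorphic:
  assumes det: "det (cols3 p q u) \<noteq> 0"
  shows "\<phi> p q u k holomorphic_on UNIV"
proof -
  have "\<exists>r>0. \<phi> p q u k holomorphic_on ball t r" for t
  proof -
    obtain j where j: "p + t *s q \<in> U j" using U_cover line_nonzero[OF det] by blast
    let ?S = "{t. p + t *s q \<in> U j}"
    have "open ?S" by (rule open_line_preimage[OF open_U])
    then obtain r where r: "r > 0" "ball t r \<subseteq> ?S" using j by (auto simp: open_contains_ball)
    have "(\<lambda>t. 1 / \<kappa> p q u j t * (\<Psi> j (p + t *s q) $ k) ^ 3) holomorphic_on ?S"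
      by (intro holomorphic_intros \<kappa>_holomorphic \<Psi>_line_holomorphic) (simp add: \<kappa>_nonzero[OF det])
    then have "\<phi> p q u k holomorphic_on ?S"
      by (rule holomorphic_transform) (simp add: \<phi>_change[OF det, of _ j k] \<phi>_def[of _ _ _ j])
    then show ?thesis using r by (meson holomorphic_on_subset)
  qed
  then have "\<phi> p q u k analytic_on UNIV" by (simp add: analytic_on_def)
  then show ?thesis by (rule analytic_imp_holomorphic)
qed

text \<open>Two factors \<open>1 / t\<close> come from the two derivative columns, of degree -1.
  Euler's relation at \<open>q + (1 / t) *s p\<close> replaces the derivative along \<open>q\<close>
  by \<open>- (1 / t)\<close> times the one along \<open>p\<close>, which gives the third factor and
  the sign. The lift column has degree 0.\<close>

lemma \<phi>_inversion:
  assumes "t \<noteq> 0"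
  shows "\<phi> p q u k t = - (t ^ 3) * \<phi> q p u k (1 / t)"
proof -
  let ?w = "q + (1 / t) *s p"
  have v: "p + t *s q = t *s ?w" using assms by (simp add: vec_eq_iff algebra_simps)
  have mem: "p + t *s q \<in> U k \<longleftrightarrow> ?w \<in> U k" unfolding v by (rule scale_U[OF assms])
  show ?thesis
  proof (cases "?w \<in> U k")
    case True
    have D: "D k (t *s ?w) *v h = (1 / t) *s (D k ?w *v h)" for h
    proof -
      have "D k (t *s ?w) *v (t *s ((1 / t) *s h)) = D k ?w *v ((1 / t) *s h)"
        by (rule D_scale[OF assms True])
      then show ?thesis using assms by (simp add: vector_scalar_commute)
    qed
    have "D k ?w *v q + (1 / t) *s (D k ?w *v p) = 0"
      using D_Euler[OF True] by (simp add: matrix_vector_right_distrib vector_scalar_commute)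
    then have q: "D k ?w *v q = - ((1 / t) *s (D k ?w *v p))" by (simp add: eq_neg_iff_add_eq_0)
    have alg: "det (cols3 (s *s (- (s *s a))) (s *s b) c) = - (s ^ 3) * det (cols3 a b c)"
      for s :: complex and a b c
      unfolding det_cols3 by (simp add: algebra_simps power3_eq_cube)
    have "\<kappa> p q u k t = - ((1 / t) ^ 3) * \<kappa> q p u k (1 / t)"
      unfolding \<kappa>_def v D q \<Psi>_scale[OF assms True] by (rule alg)
    then show ?thesis using True mem assms by (simp add: \<phi>_def power_divide)
  qed (simp add: \<phi>_def mem)
qed

end

section \<open>Images of lines\<close>

context cp2_biholomorphism
begin

lemma \<phi>_nonzero_iff:
  "det (cols3 p q u) \<noteq> 0 \<Longrightarrow> \<phi> p q u k t \<noteq> 0 \<longleftrightarrow> p + t *s q \<in> U k"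
  by (simp add: \<phi>_def \<kappa>_nonzero)

text \<open>The cubic growth is the boundedness of the function for the exchanged pair
  \<open>q\<close>, \<open>p\<close> near parameter 0, carried to infinity by
  \<open>\<phi>_inversion\<close>. The zeros are at least triple because
  \<open>\<phi>_change\<close> shows there a cube of a vanishing lift coordinate.\<close>

lemma \<phi>_cube:
  assumes det: "det (cols3 p q u) \<noteq> 0"
  shows "\<exists>\<alpha> \<beta>. \<forall>t. \<phi> p q u k t = (\<alpha> + \<beta> * t) ^ 3"
proof -
  have "det (cols3 q p u) = - det (cols3 p q u)" unfolding det_cols3 by (simp add: algebra_simps)
  then have det': "det (cols3 q p u) \<noteq> 0" using det by simp
  have "continuous_on (cball 0 1) (\<phi> q p u k)"
    using \<phi>_holomorphic[OF det'] holomorphic_on_imp_continuous_on continuous_on_subset by blast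
  then have "bounded (\<phi> q p u k ` cball 0 1)"
    by (intro compact_imp_bounded compact_continuous_image) auto
  then obtain C where C: "\<And>s. s \<in> cball 0 1 \<Longrightarrow> cmod (\<phi> q p u k s) \<le> C"
    unfolding bounded_iff by blast
  show ?thesis
  proof (rule entire_cube_of_affine)
    show "\<phi> p q u k holomorphic_on UNIV" by (rule \<phi>_holomorphic[OF det])
    show "cmod (\<phi> p q u k t) \<le> C * cmod t ^ 3" if "cmod t \<ge> 1" for t
    proof -
      have "t \<noteq> 0" using that by auto
      have "1 / t \<in> cball 0 1" using that by (auto simp: norm_divide divide_simps)
      then have "cmod t ^ 3 * cmod (\<phi> q p u k (1 / t)) \<le> cmod t ^ 3 * C"
        by (intro mult_left_mono C) auto
      then show ?thesis unfolding \<phi>_inversion[OF \<open>t \<noteq> 0\<close>]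
        by (simp add: norm_mult norm_power mult.commute)
    qed
    fix a assume 0: "\<phi> p q u k a = 0"
    obtain j where j: "p + a *s q \<in> U j" using U_cover line_nonzero[OF det] by blast
    let ?\<psi> = "\<lambda>t. \<Psi> j (p + t *s q) $ k"
    let ?\<phi> = "\<phi> p q u j"
    have "?\<phi> a \<noteq> 0" using j by (simp add: \<phi>_nonzero_iff[OF det])
    \<comment> \<open>The factor for chart \<open>j\<close> is nonzero at \<open>a\<close>, so the
      zero comes from the lift coordinate. Differentiability bounds that coordinate by
      \<open>cmod d + 1\<close> times the distance to \<open>a\<close>.\<close>
    then have \<psi>0: "?\<psi> a = 0" using 0 \<phi>_change[OF det j, of k] by simp
    obtain d where "(?\<psi> has_field_derivative d) (at a)"
      using vec_derivative_along_line[OF \<Psi>_deriv[OF j]] by blast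
    then have "((\<lambda>t. cmod ((?\<psi> t - ?\<psi> a) / (t - a))) \<longlongrightarrow> cmod d) (at a)"
      unfolding has_field_derivative_iff by (rule tendsto_norm)
    then have e1: "\<forall>\<^sub>F t in at a. cmod ((?\<psi> t - ?\<psi> a) / (t - a)) < cmod d + 1"
      by (rule order_tendstoD) simp
    have "isCont ?\<phi> a"
      using \<phi>_holomorphic[OF det] holomorphic_on_imp_continuous_on
      by (metis UNIV_I continuous_on_eq_continuous_at open_UNIV)
    then have "((\<lambda>t. cmod (?\<phi> t)) \<longlongrightarrow> cmod (?\<phi> a)) (at a)"
      unfolding isCont_def by (rule tendsto_norm)
    then have e2: "\<forall>\<^sub>F t in at a. cmod (?\<phi> t) < cmod (?\<phi> a) + 1"
      by (rule order_tendstoD) simp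
    have "open {t. p + t *s q \<in> U j}" by (rule open_line_preimage[OF open_U])
    then have e3: "\<forall>\<^sub>F t in at a. p + t *s q \<in> U j"
      using j by (auto simp: eventually_at_topological)
    have e4: "\<forall>\<^sub>F t in at a. t \<noteq> a" by (auto simp: eventually_at_topological)
    from e1 e2 e3 e4
    have "\<forall>\<^sub>F t in at a. cmod (\<phi> p q u k t)
        \<le> (cmod (?\<phi> a) + 1) * (cmod d + 1) ^ 3 * cmod (t - a) ^ 3"
    proof eventually_elim
      case (elim t)
      have "cmod (?\<psi> t) \<le> (cmod d + 1) * cmod (t - a)"
        using elim(1,4) by (simp add: \<psi>0 norm_divide divide_less_eq less_imp_le)
      then have "cmod (?\<psi> t) ^ 3 \<le> ((cmod d + 1) * cmod (t - a)) ^ 3" by (intro power_mono) auto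
      then have "cmod (?\<phi> t) * cmod (?\<psi> t) ^ 3
          \<le> (cmod (?\<phi> a) + 1) * ((cmod d + 1) * cmod (t - a)) ^ 3"
        using elim(2) by (intro mult_mono) auto
      then show ?case unfolding \<phi>_change[OF det elim(3), of k]
        by (simp add: norm_mult norm_power power_mult_distrib mult.assoc)
    qed
    then show "\<exists>B. \<forall>\<^sub>F t in at a. cmod (\<phi> p q u k t) \<le> B * cmod (t - a) ^ 3" by blast
  qed
qed

section \<open>Affine lifts along a line\<close>

lemma \<Psi>_line_continuous:
  assumes "p + t *s q \<in> U j"
  shows "isCont (\<lambda>t. \<Psi> j (p + t *s q) $ k) t"
  using vec_derivative_along_line[OF \<Psi>_deriv[OF assms]] by (rule DERIV_isCont)

lemma eventually_line_in_U: "p + t *s q \<in> U j \<Longrightarrow> \<forall>\<^sub>F \<tau> in at t. p + \<tau> *s q \<in> U j"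
  using open_line_preimage[OF open_U, of p q j] by (auto simp: eventually_at_topological)

text \<open>For carrying identities between lifts over to the isolated parameters where the
  computation divides by 0.\<close>

lemma isCont_eventually_eq:
  fixes G :: "complex \<Rightarrow> complex"
  assumes "isCont G t" "\<forall>\<^sub>F \<tau> in at t. G \<tau> = 0"
  shows "G t = 0"
proof -
  have "(G \<longlongrightarrow> 0) (at t)" using tendsto_eventually[OF assms(2)] .
  with assms(1) show ?thesis unfolding isCont_def by (rule tendsto_unique[rotated]) simp
qed

text \<open>In chart \<open>j\<close> each lift coordinate is, up to a constant
  \<open>\<omega> k\<close>, a quotient of two affine cube roots. Clearing the common denominator
  and absorbing the constants gives homogeneous coordinates of the image that are affine in
  \<open>t\<close>.\<close>

lemma line_affine_lift:
  assumes det: "det (cols3 p q u) \<noteq> 0"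
  obtains A B where "\<And>t k. (A + t *s B) $ k \<noteq> 0 \<longleftrightarrow> p + t *s q \<in> U k"
    "\<And>t m. p + t *s q \<in> U m \<Longrightarrow> A + t *s B = (A + t *s B) $ m *s \<Psi> m (p + t *s q)"
proof -
  have "\<forall>k. \<exists>\<alpha> \<beta>. \<forall>t. \<phi> p q u k t = (\<alpha> + \<beta> * t) ^ 3" using \<phi>_cube[OF det] by blast
  then obtain \<alpha> \<beta> where cube: "\<And>k t. \<phi> p q u k t = (\<alpha> k + \<beta> k * t) ^ 3" by metis
  have U: "p + t *s q \<in> U k \<longleftrightarrow> \<alpha> k + \<beta> k * t \<noteq> 0" for t k
    using \<phi>_nonzero_iff[OF det, of k t] cube[of k t] by simp
  obtain j where j: "p + 0 *s q \<in> U j" using U_cover line_nonzero[OF det] by blast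
  let ?S = "{t. \<alpha> j + \<beta> j * t \<noteq> 0}"
  have "\<exists>\<omega>. \<omega> \<noteq> 0 \<and>
      (\<forall>t\<in>?S. \<Psi> j (p + t *s q) $ k * (\<alpha> j + \<beta> j * t) = \<omega> * (\<alpha> k + \<beta> k * t))" for k
  proof (rule affine_cube_root_unique)
    show "?S \<noteq> {}" using j U by blast
    show "continuous_on ?S (\<lambda>t. \<Psi> j (p + t *s q) $ k)"
      using U by (intro continuous_at_imp_continuous_on ballI \<Psi>_line_continuous) auto
    fix t assume "t \<in> ?S"
    then have "p + t *s q \<in> U j" using U by simp
    from \<phi>_change[OF det this, of k]
    show "(\<Psi> j (p + t *s q) $ k * (\<alpha> j + \<beta> j * t)) ^ 3 = (\<alpha> k + \<beta> k * t) ^ 3"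
      unfolding cube by (simp add: power_mult_distrib mult.commute)
  qed
  then obtain \<omega> where \<omega>0: "\<And>k. \<omega> k \<noteq> 0" and \<omega>: "\<And>k t. t \<in> ?S \<Longrightarrow>
      \<Psi> j (p + t *s q) $ k * (\<alpha> j + \<beta> j * t) = \<omega> k * (\<alpha> k + \<beta> k * t)" by metis
  define A B :: "complex ^ 3" where "A = (\<chi> k. \<omega> k * \<alpha> k)" and "B = (\<chi> k. \<omega> k * \<beta> k)"
  have L: "(A + t *s B) $ k = \<omega> k * (\<alpha> k + \<beta> k * t)" for t k
    by (simp add: A_def B_def algebra_simps)
  have L0: "(A + t *s B) $ k \<noteq> 0 \<longleftrightarrow> p + t *s q \<in> U k" for t k
    unfolding L U using \<omega>0 by simp
  \<comment> \<open>The chart \<open>j\<close> was chosen at parameter 0, so the affine function for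
    \<open>j\<close> is not identically zero and has at most one zero.\<close>
  have S_ev: "\<forall>\<^sub>F \<tau> in at t. \<tau> \<in> ?S" for t
  proof -
    have ab: "\<alpha> j + \<beta> j * 0 \<noteq> 0" using j U by blast
    have "finite (- ?S)"
    proof (cases "\<beta> j = 0")
      case False
      have "- ?S \<subseteq> {- \<alpha> j / \<beta> j}" using False by (auto simp: field_simps eq_neg_iff_add_eq_0)
      then show ?thesis by (rule finite_subset) simp
    qed (use ab in simp)
    then have "open (- (- ?S - {t}))" by (intro open_Compl finite_imp_closed) simp
    then show ?thesis by (auto simp: eventually_at_topological intro!: exI[of _ "- (- ?S - {t})"])
  qed
  \<comment> \<open>Off the zero of the affine function for \<open>j\<close> this is the change from
    chart \<open>j\<close> to chart \<open>m\<close>; continuity adds that zero.\<close>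
  have key: "\<Psi> m (p + t *s q) $ k * (A + t *s B) $ m = (A + t *s B) $ k"
    if m: "p + t *s q \<in> U m" for t m k
  proof -
    let ?G = "\<lambda>t. \<Psi> m (p + t *s q) $ k * (A + t *s B) $ m - (A + t *s B) $ k"
    have "?G t = 0"
    proof (rule isCont_eventually_eq[where G = ?G])
      show "isCont ?G t" unfolding L by (intro continuous_intros \<Psi>_line_continuous m)
      show "\<forall>\<^sub>F \<tau> in at t. ?G \<tau> = 0"
        using S_ev eventually_line_in_U[OF m]
      proof eventually_elim
        case (elim \<tau>)
        let ?v = "p + \<tau> *s q"
        have j: "?v \<in> U j" using elim(1) U by simp
        have nz: "\<Psi> j ?v $ m \<noteq> 0" using \<Psi>_nth_nonzero[OF j] elim(2) by blast
        have "\<Psi> m ?v $ k = \<Psi> j ?v $ k / \<Psi> j ?v $ m"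
          unfolding \<Psi>_change[OF j, of m] by simp
        then show ?case unfolding L \<omega>[OF elim(1), symmetric] using nz by simp
      qed
    qed
    then show ?thesis by simp
  qed
  show thesis
  proof (rule that[of A B])
    show "(A + t *s B) $ k \<noteq> 0 \<longleftrightarrow> p + t *s q \<in> U k" for t k by (rule L0)
    show "A + t *s B = (A + t *s B) $ m *s \<Psi> m (p + t *s q)" if "p + t *s q \<in> U m" for t m
      unfolding vec_eq_iff using key[OF that] by (simp only: vector_smult_component) (metis mult.commute)
  qed
qed

lemma f_inj: "f P = f Q \<Longrightarrow> P = Q"
  using bij by (simp add: bij_def inj_eq)

text \<open>Injectivity enters for \<open>B\<close>: with \<open>B = 0\<close> the whole line would
  go to one point. The value at \<open>q\<close>, the point of the line at infinite
  \<open>t\<close>, follows by continuity.\<close>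

lemma line_affine:
  assumes det: "det (cols3 p q u) \<noteq> 0"
  obtains A B where "\<And>t. A + t *s B \<noteq> 0" "B \<noteq> 0"
    "\<And>t. f (proj (p + t *s q)) = proj (A + t *s B)" "f (proj q) = proj B"
proof -
  obtain A B where U: "\<And>t k. (A + t *s B) $ k \<noteq> 0 \<longleftrightarrow> p + t *s q \<in> U k"
    and L: "\<And>t m. p + t *s q \<in> U m \<Longrightarrow> A + t *s B = (A + t *s B) $ m *s \<Psi> m (p + t *s q)"
    using line_affine_lift[OF det] by blast
  have nz: "A + t *s B \<noteq> 0" for t
  proof -
    obtain m where "p + t *s q \<in> U m" using U_cover line_nonzero[OF det] by blast
    then have "(A + t *s B) $ m \<noteq> 0" using U by blast
    then show ?thesis by (metis zero_index)
  qed
  have f: "f (proj (p + t *s q)) = proj (A + t *s B)" for t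
  proof -
    obtain m where m: "p + t *s q \<in> U m" using U_cover line_nonzero[OF det] by blast
    then have "(A + t *s B) $ m \<noteq> 0" using U by blast
    then have "proj ((A + t *s B) $ m *s \<Psi> m (p + t *s q)) = proj (\<Psi> m (p + t *s q))"
      by (intro proj_eqI \<Psi>_nonzero m)
    then show ?thesis using L[OF m] \<Psi>_proj[OF m] by simp
  qed
  have indep: "x = 0 \<and> y = 0 \<and> z = 0" if "x *s p + y *s q + z *s u = 0" for x y z
    using det that unfolding det_cols3_nonzero_iff by blast
  have B: "B \<noteq> 0"
  proof
    assume "B = 0"
    then have "f (proj (p + 0 *s q)) = f (proj (p + 1 *s q))" unfolding f by simp
    then have "proj (p + 0 *s q) = proj (p + 1 *s q)" by (rule f_inj)
    then obtain c where "p + 1 *s q = c *s (p + 0 *s q)"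
      using proj_eq_iff[OF line_nonzero[OF det] line_nonzero[OF det]] by blast
    then have "(1 - c) *s p + 1 *s q + 0 *s u = 0" by (simp add: vec_eq_iff algebra_simps)
    then show False using indep by fastforce
  qed
  have "q \<noteq> 0"
  proof
    assume "q = 0"
    then have "0 *s p + 1 *s q + 0 *s u = 0" by simp
    then show False using indep by fastforce
  qed
  then obtain m where m: "q \<in> U m" by (rule U_cover)
  have key: "\<Psi> m q $ k * B $ m = B $ k" for k
  proof -
    \<comment> \<open>With \<open>s = 1 / t\<close> the affine lift rescaled by \<open>s\<close> is
      \<open>s *s A + B\<close>, which makes sense at \<open>s = 0\<close>, the parameter of
      \<open>q\<close>.\<close>
    let ?G = "\<lambda>s. \<Psi> m (q + s *s p) $ k * (s *s A + B) $ m - (s *s A + B) $ k"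
    have m': "q + 0 *s p \<in> U m" using m by simp
    have "?G 0 = 0"
    proof (rule isCont_eventually_eq[where G = ?G])
      show "isCont ?G 0"
        unfolding vector_add_component vector_smult_component
        by (intro continuous_intros \<Psi>_line_continuous m')
      have "\<forall>\<^sub>F s in at 0. (s::complex) \<noteq> 0" by (auto simp: eventually_at_topological)
      then show "\<forall>\<^sub>F s in at 0. ?G s = 0" using eventually_line_in_U[OF m']
      proof eventually_elim
        case (elim s)
        let ?t = "1 / s"
        have eq: "q + s *s p = s *s (p + ?t *s q)" using elim(1) by (simp add: vec_eq_iff algebra_simps)
        have t: "p + ?t *s q \<in> U m" using elim scale_U[of s "p + ?t *s q" m] by (simp only: eq) simp
        have 1: "(A + ?t *s B) $ k = (A + ?t *s B) $ m * \<Psi> m (p + ?t *s q) $ k"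
          using L[OF t] by (metis vector_smult_component)
        have 2: "\<Psi> m (q + s *s p) = \<Psi> m (p + ?t *s q)" unfolding eq by (rule \<Psi>_scale[OF elim(1) t])
        have 3: "(s *s A + B) $ i = s * (A + ?t *s B) $ i" for i
          using elim(1) by (simp add: algebra_simps)
        show ?case unfolding 2 3 1 by simp
      qed
    qed
    then show ?thesis by simp
  qed
  then have Bm: "B = B $ m *s \<Psi> m q" unfolding vec_eq_iff by (simp add: mult.commute)
  with B have "B $ m \<noteq> 0" by auto
  then have "proj (B $ m *s \<Psi> m q) = proj (\<Psi> m q)" by (intro proj_eqI \<Psi>_nonzero m)
  then have "f (proj q) = proj B" using Bm \<Psi>_proj[OF m] by simp
  with nz B f show thesis by (rule that)
qed

text \<open>Prescribed representatives of the images of \<open>p\<close> and \<open>q\<close> differ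
  from those given by \<open>line_affine\<close> by factors \<open>a\<close> and \<open>b\<close>. A
  common factor does not change points, so only the ratio \<open>c = b / a\<close> remains
  unknown.\<close>

lemma line_linear:
  assumes det: "det (cols3 p q u) \<noteq> 0"
    and A: "A \<noteq> 0" "f (proj p) = proj A" and B: "B \<noteq> 0" "f (proj q) = proj B"
  obtains c where "c \<noteq> 0"
    "\<And>s t. (s, t) \<noteq> (0, 0) \<Longrightarrow>
       s *s A + (t * c) *s B \<noteq> 0 \<and> f (proj (s *s p + t *s q)) = proj (s *s A + (t * c) *s B)"
proof -
  obtain A' B' where *: "\<And>t. A' + t *s B' \<noteq> 0" "B' \<noteq> 0"
    "\<And>t. f (proj (p + t *s q)) = proj (A' + t *s B')" "f (proj q) = proj B'"
    using line_affine[OF det] by blast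
  have "A' \<noteq> 0" "f (proj p) = proj A'" using *(1)[of 0] *(3)[of 0] by simp_all
  then obtain a where a: "a \<noteq> 0" "A' = a *s A" using A proj_eq_iff[of A A'] by auto
  obtain b where b: "b \<noteq> 0" "B' = b *s B" using B *(2,4) proj_eq_iff[of B B'] by auto
  have q: "q \<noteq> 0"
  proof
    assume "q = 0"
    then have "0 *s p + 1 *s q + 0 *s u = 0" by simp
    then show False using det unfolding det_cols3_nonzero_iff by fastforce
  qed
  show thesis
  proof (rule that[of "b / a"])
    fix s t :: complex assume st: "(s, t) \<noteq> (0, 0)"
    show "s *s A + (t * (b / a)) *s B \<noteq> 0 \<and>
        f (proj (s *s p + t *s q)) = proj (s *s A + (t * (b / a)) *s B)"
    proof (cases "s = 0")
      case True
      with st have "t \<noteq> 0" by simp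
      then show ?thesis using True a b B q by (simp add: proj_eqI)
    next
      case False
      have 1: "s *s A + (t * (b / a)) *s B = (s / a) *s (A' + (t / s) *s B')"
        using False a b by (simp add: vec_eq_iff field_simps)
      have 2: "s *s p + t *s q = s *s (p + (t / s) *s q)"
        using False by (simp add: vec_eq_iff field_simps)
      have "s / a \<noteq> 0" using False a by simp
      have "proj (s *s (p + (t / s) *s q)) = proj (p + (t / s) *s q)"
        using False line_nonzero[OF det] by (rule proj_eqI[rotated])
      moreover have "proj ((s / a) *s (A' + (t / s) *s B')) = proj (A' + (t / s) *s B')"
        using *(1) \<open>s / a \<noteq> 0\<close> by (rule proj_eqI)
      moreover have "(s / a) *s (A' + (t / s) *s B') \<noteq> 0"
        using *(1) \<open>s / a \<noteq> 0\<close> unfolding vector_mul_eq_0 by blast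
      ultimately show ?thesis unfolding 1 2 using *(3) by metis
    qed
  qed (use a b in simp)
qed

end

section \<open>Linearity of biholomorphisms\<close>

context cp2_biholomorphism
begin

text \<open>A general point lies on the line from \<open>e1\<close> to the edge \<open>e2 e3\<close>
  and on the line from \<open>e3\<close> to the edge \<open>e1 e2\<close>. Once \<open>f\<close> is
  linear on both edges, each line determines its image up to one factor, and the agreement of the
  two answers forces the factors to be 1.\<close>

lemma projectively_linear: "\<exists>M. invertible M \<and> f = plin M"
proof -
  define e1 e2 e3 :: "complex ^ 3" where "e1 = vector [1, 0, 0]" and "e2 = vector [0, 1, 0]"
    and "e3 = vector [0, 0, 1]"
  have P: "x *s e1 + y *s e2 + z *s e3 = vector [x, y, z]" for x y z
    by (simp add: e1_def e2_def e3_def vec_eq_iff forall_3 vector_3)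
  have enz: "e1 \<noteq> 0" "e2 \<noteq> 0" "e3 \<noteq> 0"
    by (simp_all add: e1_def e2_def e3_def vec_eq_iff forall_3 vector_3)
  obtain A1 where A1: "A1 \<noteq> 0" "f (proj e1) = proj A1" by (rule proj_cases)
  obtain A2' where A2': "A2' \<noteq> 0" "f (proj e2) = proj A2'" by (rule proj_cases)
  obtain A3' where A3': "A3' \<noteq> 0" "f (proj e3) = proj A3'" by (rule proj_cases)
  have "det (cols3 e1 e2 e3) \<noteq> 0"
    unfolding det_cols3 by (simp add: e1_def e2_def e3_def vector_3)
  from line_linear[OF this A1 A2'] obtain c2 where c2: "c2 \<noteq> 0"
    "\<And>s t. (s, t) \<noteq> (0, 0) \<Longrightarrow>
       s *s A1 + (t * c2) *s A2' \<noteq> 0 \<and> f (proj (s *s e1 + t *s e2)) = proj (s *s A1 + (t * c2) *s A2')"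
    by blast
  \<comment> \<open>Absorbing the factor into the representative makes \<open>f\<close> linear on
    the edge \<open>e1 e2\<close>; \<open>A3\<close> does the same for \<open>e2 e3\<close>. No
    freedom is left for the edge \<open>e1 e3\<close>, which is treated last.\<close>
  define A2 where "A2 = c2 *s A2'"
  have A2: "A2 \<noteq> 0" "f (proj e2) = proj A2" using A2' c2(1) by (simp_all add: A2_def proj_eqI)
  have L12: "s *s A1 + t *s A2 \<noteq> 0 \<and> f (proj (s *s e1 + t *s e2)) = proj (s *s A1 + t *s A2)"
    if "(s, t) \<noteq> (0, 0)" for s t using c2(2)[OF that] by (simp add: A2_def)
  have "det (cols3 e2 e3 e1) \<noteq> 0"
    unfolding det_cols3 by (simp add: e1_def e2_def e3_def vector_3)
  from line_linear[OF this A2 A3'] obtain c3 where c3: "c3 \<noteq> 0"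
    "\<And>s t. (s, t) \<noteq> (0, 0) \<Longrightarrow>
       s *s A2 + (t * c3) *s A3' \<noteq> 0 \<and> f (proj (s *s e2 + t *s e3)) = proj (s *s A2 + (t * c3) *s A3')"
    by blast
  define A3 where "A3 = c3 *s A3'"
  have A3: "A3 \<noteq> 0" "f (proj e3) = proj A3" using A3' c3(1) by (simp_all add: A3_def proj_eqI)
  have L23: "s *s A2 + t *s A3 \<noteq> 0 \<and> f (proj (s *s e2 + t *s e3)) = proj (s *s A2 + t *s A3)"
    if "(s, t) \<noteq> (0, 0)" for s t using c3(2)[OF that] by (simp add: A3_def)
  define M where "M = cols3 A1 A2 A3"
  define T where "T x y z = x *s A1 + y *s A2 + z *s A3" for x y z
  \<comment> \<open>If \<open>A3\<close> were a combination of \<open>A1\<close> and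
    \<open>A2\<close>, then \<open>f\<close> would identify \<open>e3\<close> with a point of the
    edge \<open>e1 e2\<close>.\<close>
  have indep: "x = 0 \<and> y = 0 \<and> z = 0" if T0: "T x y z = 0" for x y z
  proof (cases "z = 0")
    case True
    then have "x *s A1 + y *s A2 = 0" using T0 by (simp add: T_def)
    then show ?thesis using L12[of x y] True by blast
  next
    case False
    let ?w = "(- x / z) *s A1 + (- y / z) *s A2"
    have "A3 = (1 / z) *s T x y z + ?w"
      using False by (simp add: T_def vec_eq_iff field_simps)
    then have A3w: "A3 = ?w" unfolding T0 by simp
    have ne: "(- x / z, - y / z) \<noteq> (0, 0)"
    proof
      assume "(- x / z, - y / z) = (0, 0)"
      then have "- x / z = 0" "- y / z = 0" by (simp_all only: prod.inject)
      then have "?w = 0" by (simp only: vector_smult_lzero add_0_left)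
      then show False using A3w A3(1) by simp
    qed
    let ?p = "(- x / z) *s e1 + (- y / z) *s e2"
    have "f (proj ?p) = f (proj e3)" using L12[OF ne] A3(2) A3w by metis
    then have "proj ?p = proj e3" by (rule f_inj)
    moreover have "?p \<noteq> 0"
      using ne by (simp add: e1_def e2_def vec_eq_iff forall_3 vector_3)
    ultimately obtain c where "e3 = c *s ?p" using proj_eq_iff enz(3) by blast
    then have "e3 $ 3 = (c *s ?p) $ 3" by simp
    then show ?thesis by (simp add: e1_def e2_def e3_def vector_3)
  qed
  have T0: "T x y z \<noteq> 0" if "(x, y, z) \<noteq> (0, 0, 0)" for x y z using indep that by blast
  have T_eq: "\<exists>\<mu>. x' = \<mu> * x \<and> y' = \<mu> * y \<and> z' = \<mu> * z"
    if eq: "proj (T x y z) = proj (T x' y' z')" and ne: "(x, y, z) \<noteq> (0, 0, 0)" "(x', y', z') \<noteq> (0, 0, 0)"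
    for x y z x' y' z'
  proof -
    obtain \<mu> where "T x' y' z' = \<mu> *s T x y z"
      using eq proj_eq_iff[OF T0[OF ne(1)] T0[OF ne(2)]] by blast
    then have "T (x' - \<mu> * x) (y' - \<mu> * y) (z' - \<mu> * z) = 0"
      by (simp add: T_def vec_eq_iff algebra_simps)
    from indep[OF this] show ?thesis by auto
  qed
  let ?P = "\<lambda>x y z. proj (vector [x, y, z] :: complex ^ 3)"
  \<comment> \<open>From the line joining \<open>e1\<close> to a point of the edge
    \<open>e2 e3\<close>: the factor depends on \<open>(y, z)\<close> but not on \<open>x\<close>.
    Symmetrically for \<open>H3\<close>.\<close>
  have H1: "\<exists>c. c \<noteq> 0 \<and> (\<forall>x. f (?P x y z) = proj (T (c * x) y z))" if ne: "(y, z) \<noteq> (0, 0)" for y z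
  proof -
    let ?q = "y *s e2 + z *s e3"
    have "\<exists>u. det (cols3 ?q e1 u) \<noteq> 0"
    proof (cases "y = 0")
      case True
      then show ?thesis using ne
        by (intro exI[of _ e2]) (simp add: det_cols3 e1_def e2_def e3_def vector_3)
    next
      case False
      then show ?thesis
        by (intro exI[of _ e3]) (simp add: det_cols3 e1_def e2_def e3_def vector_3)
    qed
    then obtain u where u: "det (cols3 ?q e1 u) \<noteq> 0" ..
    obtain c where c: "c \<noteq> 0" "\<And>s t. (s, t) \<noteq> (0, 0) \<Longrightarrow>
       s *s (y *s A2 + z *s A3) + (t * c) *s A1 \<noteq> 0 \<and>
       f (proj (s *s ?q + t *s e1)) = proj (s *s (y *s A2 + z *s A3) + (t * c) *s A1)"
      using line_linear[OF u _ _ A1, of "y *s A2 + z *s A3"] L23[OF ne] by blast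
    have "f (?P x y z) = proj (T (c * x) y z)" for x
    proof -
      have 1: "1 *s ?q + x *s e1 = vector [x, y, z]" unfolding P[symmetric] by simp
      have 2: "1 *s (y *s A2 + z *s A3) + (x * c) *s A1 = T (c * x) y z"
        by (simp add: T_def vec_eq_iff algebra_simps)
      show ?thesis using c(2)[of 1 x] unfolding 1 2 by simp
    qed
    with c(1) show ?thesis by blast
  qed
  have H3: "\<exists>d. d \<noteq> 0 \<and> (\<forall>z. f (?P x y z) = proj (T x y (d * z)))" if ne: "(x, y) \<noteq> (0, 0)" for x y
  proof -
    let ?q = "x *s e1 + y *s e2"
    have "\<exists>u. det (cols3 ?q e3 u) \<noteq> 0"
    proof (cases "y = 0")
      case True
      then show ?thesis using ne
        by (intro exI[of _ e2]) (simp add: det_cols3 e1_def e2_def e3_def vector_3)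
    next
      case False
      then show ?thesis
        by (intro exI[of _ e1]) (simp add: det_cols3 e1_def e2_def e3_def vector_3)
    qed
    then obtain u where u: "det (cols3 ?q e3 u) \<noteq> 0" ..
    obtain c where c: "c \<noteq> 0" "\<And>s t. (s, t) \<noteq> (0, 0) \<Longrightarrow>
       s *s (x *s A1 + y *s A2) + (t * c) *s A3 \<noteq> 0 \<and>
       f (proj (s *s ?q + t *s e3)) = proj (s *s (x *s A1 + y *s A2) + (t * c) *s A3)"
      using line_linear[OF u _ _ A3, of "x *s A1 + y *s A2"] L12[OF ne] by blast
    have "f (?P x y z) = proj (T x y (c * z))" for z
    proof -
      have 1: "1 *s ?q + z *s e3 = vector [x, y, z]" unfolding P[symmetric] by simp
      have 2: "1 *s (x *s A1 + y *s A2) + (z * c) *s A3 = T x y (c * z)"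
        by (simp add: T_def vec_eq_iff algebra_simps)
      show ?thesis using c(2)[of 1 z] unfolding 1 2 by simp
    qed
    with c(1) show ?thesis by blast
  qed
  \<comment> \<open>Both descriptions leave the coordinate \<open>y\<close> untouched, so the
    proportionality factor between them is 1, and then \<open>c * x = x\<close>.\<close>
  have y_ne: "f (?P x y z) = proj (T x y z)" if y: "y \<noteq> 0" for x y z
  proof -
    obtain c where c: "\<And>x. f (?P x y z) = proj (T (c * x) y z)" using H1[of y z] y by auto
    obtain d where d: "\<And>z. f (?P x y z) = proj (T x y (d * z))" using H3[of x y] y by auto
    have "proj (T (c * x) y z) = proj (T x y (d * z))" using c d by metis
    from T_eq[OF this] y obtain \<mu> where "x = \<mu> * (c * x)" "y = \<mu> * y" by auto
    then have "c * x = x" using y by simp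
    then show ?thesis using c by metis
  qed
  have all: "f (?P x y z) = proj (T x y z)" if ne: "(x, y, z) \<noteq> (0, 0, 0)" for x y z
  proof (cases "y \<noteq> 0")
    case True
    then show ?thesis by (rule y_ne)
  next
    case False
    then have y: "y = 0" by simp
    show ?thesis
    proof (cases "x = 0 \<or> z = 0")
      case True
      then show ?thesis
      proof
        assume x: "x = 0"
        then obtain c where "\<And>x. f (?P x y z) = proj (T (c * x) y z)" using H1[of y z] ne y by auto
        from this[of x] show ?thesis using x by simp
      next
        assume z: "z = 0"
        then obtain d where "\<And>z. f (?P x y z) = proj (T x y (d * z))" using H3[of x y] ne y by auto
        from this[of z] show ?thesis using z by simp
      qed
    next
      case False
      then have x: "x \<noteq> 0" and z: "z \<noteq> 0" by auto
      \<comment> \<open>A point of the edge \<open>e1 e3\<close>: the line from it to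
        \<open>e2\<close> passes through \<open>[x:1:z]\<close>, where \<open>f\<close> is already
        known, and comparison there gives \<open>c * x = x\<close>.\<close>
      obtain c where c: "c \<noteq> 0" "f (?P x 0 z) = proj (T (c * x) 0 z)" using H1[of 0 z] z by auto
      have "det (cols3 (vector [x, 0, z]) e2 e3) \<noteq> 0"
        using x by (simp add: det_cols3 e2_def e3_def vector_3)
      moreover have "T (c * x) 0 z \<noteq> 0" using T0 z by simp
      ultimately obtain d where "f (proj (1 *s vector [x, 0, z] + 1 *s e2))
          = proj (1 *s T (c * x) 0 z + (1 * d) *s A2)"
        using line_linear[OF _ _ c(2) A2] by (metis prod.inject zero_neq_one)
      moreover have "1 *s vector [x, 0, z] + 1 *s e2 = vector [x, 1, z]"
        by (simp add: e2_def vec_eq_iff forall_3 vector_3)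
      moreover have "1 *s T (c * x) 0 z + (1 * d) *s A2 = T (c * x) d z"
        by (simp add: T_def vec_eq_iff algebra_simps)
      ultimately have "proj (T (c * x) d z) = proj (T x 1 z)" using y_ne[of 1 x z] by simp
      from T_eq[OF this] z obtain \<mu> where "x = \<mu> * (c * x)" "z = \<mu> * z" by auto
      then have "c * x = x" using z by simp
      then show ?thesis using c x y by simp
    qed
  qed
  have "invertible M"
    unfolding M_def invertible_det_nz det_cols3_nonzero_iff using indep unfolding T_def by blast
  moreover have "f P = plin M P" for P
  proof (rule proj_cases[of P])
    fix v assume v: "v \<noteq> 0" "P = proj v"
    have "vector [v $ 1, v $ 2, v $ 3] = v" by (simp add: vec_eq_iff forall_3 vector_3)
    moreover have "(v $ 1, v $ 2, v $ 3) \<noteq> (0, 0, 0)" using v by (auto simp: vec_eq_iff forall_3)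
    ultimately have "f P = proj (T (v $ 1) (v $ 2) (v $ 3))" using all v by metis
    then show ?thesis using v \<open>invertible M\<close> by (simp add: plin_proj M_def cols3_mult T_def)
  qed
  ultimately show ?thesis by blast
qed

end

theorem biholomorphism_projective_linear:
  assumes "biholomorphism f"
  obtains M where "invertible M" "f = plin M"
proof -
  interpret cp2_biholomorphism f by standard (rule assms)
  show thesis using projectively_linear that by blast
qed

section \<open>Jordan normal forms of 3 by 3 matrices\<close>

text \<open>The numbers are the roots, with multiplicity, of the monic cubic with coefficients
  \<open>- t\<close>, \<open>s\<close>, \<open>- d\<close>: one comes from the fundamental theorem
  of algebra, the others from the quadratic formula.\<close>

lemma complex_cubic_factor:
  obtains a b c :: complex where "a + b + c = t" "a * b + b * c + c * a = s" "a * b * c = d"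
proof -
  define k where "k i = (if i = 0 then - d else if i = 1 then s else if i = 2 then - t else 1)" for i :: nat
  have "k 0 = 0 \<or> (\<exists>i\<in>{1..3}. k i \<noteq> 0)" by (intro disjI2 bexI[of _ 3]) (simp_all add: k_def)
  then obtain a where "(\<Sum>i\<le>3. k i * a ^ i) = 0" by (rule fundamental_theorem_of_algebra)
  then have a: "a ^ 3 - t * a\<^sup>2 + s * a - d = 0"
    by (simp add: numeral_3_eq_3 k_def numeral_2_eq_2 algebra_simps)
  \<comment> \<open>\<open>u\<close> and \<open>w\<close> are the sum and the product of the two
    remaining roots.\<close>
  define u where "u = t - a"
  define w where "w = s - a * u"
  define b where "b = (u + csqrt (u\<^sup>2 - 4 * w)) / 2"
  have "2 * b = u + csqrt (u\<^sup>2 - 4 * w)" by (simp add: b_def)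
  then have "2 * b - u = csqrt (u\<^sup>2 - 4 * w)" by simp
  then have "(2 * b - u)\<^sup>2 = u\<^sup>2 - 4 * w" by (simp only: power2_csqrt)
  then have "4 * (b * (u - b)) = 4 * w" by (simp add: power2_eq_square algebra_simps)
  then have bc: "b * (u - b) = w" by simp
  show thesis
  proof (rule that[of a b "u - b"])
    show "a + b + (u - b) = t" by (simp add: u_def)
    show "a * b + b * (u - b) + (u - b) * a = s" unfolding bc w_def by (simp add: algebra_simps)
    have "a * b * (u - b) = a * w" using bc by (simp only: mult.assoc)
    also have "\<dots> = d" using a by (simp add: w_def u_def power2_eq_square power3_eq_cube algebra_simps)
    finally show "a * b * (u - b) = d" .
  qed
qed

text \<open>The prescribed symmetric functions are the trace, the sum of the principal 2 by 2 minors
  and the determinant, so \<open>a\<close>, \<open>b\<close>, \<open>c\<close> are the roots of the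
  characteristic polynomial. The product form hands the Jordan argument its chains directly.\<close>

lemma cayley_hamilton_3:
  fixes M :: "complex ^ 3 ^ 3"
  defines "L \<equiv> \<lambda>x v. M *v v - x *s v"
  obtains a b c where "\<And>v. L a (L b (L c v)) = 0"
    "\<And>x. x \<in> {a, b, c} \<Longrightarrow> \<exists>v. v \<noteq> 0 \<and> L x v = 0"
proof -
  obtain a b c where e: "a + b + c = M$1$1 + M$2$2 + M$3$3"
    "a * b + b * c + c * a = M$1$1 * M$2$2 - M$1$2 * M$2$1 + (M$1$1 * M$3$3 - M$1$3 * M$3$1)
       + (M$2$2 * M$3$3 - M$2$3 * M$3$2)"
    "a * b * c = det M"
    by (rule complex_cubic_factor)
  have L3: "L a (L b (L c v)) = M *v (M *v (M *v v)) - (a + b + c) *s (M *v (M *v v))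
      + (a * b + b * c + c * a) *s (M *v v) - (a * b * c) *s v" for v
    by (simp add: L_def matrix_vector_mult_diff_distrib vector_scalar_commute vec_eq_iff algebra_simps)
  have "L a (L b (L c v)) = 0" for v
    unfolding L3 e
    by (simp add: vec_eq_iff forall_3 matrix_vector_mult_def sum_3 det_3) (simp add: algebra_simps)
  moreover have "\<exists>v. v \<noteq> 0 \<and> L x v = 0" if "x \<in> {a, b, c}" for x
  proof -
    have "det (M - mat x) = - (x ^ 3 - (a + b + c) * x\<^sup>2 + (a * b + b * c + c * a) * x - a * b * c)"
      unfolding e by (simp add: det_3 mat_def power2_eq_square power3_eq_cube algebra_simps)
    also have "\<dots> = - ((x - a) * (x - b) * (x - c))"
      by (simp add: power2_eq_square power3_eq_cube algebra_simps)
    also have "\<dots> = 0" using that by auto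
    finally have "\<not> (\<forall>v. (M - mat x) *v v = 0 \<longrightarrow> v = 0)"
      using invertible_det_nz[of "M - mat x"]
      by (simp add: invertible_left_inverse matrix_left_invertible_ker)
    then obtain v where v: "v \<noteq> 0" "(M - mat x) *v v = 0" by blast
    have "(M - mat x) *v v = L x v"
      by (simp add: L_def vec_eq_iff forall_3 matrix_vector_mult_def sum_3 mat_def algebra_simps)
    with v show ?thesis by auto
  qed
  ultimately show thesis by (rule that)
qed

definition independent3 :: "complex ^ 3 \<Rightarrow> complex ^ 3 \<Rightarrow> complex ^ 3 \<Rightarrow> bool" where
  "independent3 u v w \<longleftrightarrow> (\<forall>x y z. x *s u + y *s v + z *s w = 0 \<longrightarrow> x = 0 \<and> y = 0 \<and> z = 0)"

lemma independent3D: "independent3 u v w \<Longrightarrow> x *s u + y *s v + z *s w = 0 \<Longrightarrow> x = 0 \<and> y = 0 \<and> z = 0"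
  unfolding independent3_def by blast

text \<open>Two vectors do not span a space of dimension 3, and any vector outside their span will
  do.\<close>

lemma independent3_extend:
  assumes "v \<noteq> 0" "\<And>c. w \<noteq> c *s v"
  obtains u where "independent3 v w u"
proof -
  have "\<not> (\<forall>u. \<exists>x y. u = x *s v + y *s w)"
  proof
    assume *: "\<forall>u. \<exists>x y. u = x *s v + y *s w"
    have "(UNIV :: (complex ^ 3) set) \<subseteq> vec.span {v, w}"
    proof
      fix u :: "complex ^ 3"
      obtain x y where "u = x *s v + y *s w" using * by blast
      then show "u \<in> vec.span {v, w}"
        by (simp add: vec.span_add vec.span_scale vec.span_base)
    qed
    then have "vec.dim (UNIV :: (complex ^ 3) set) \<le> card {v, w}"
      by (intro vec.dim_le_card) auto
    moreover have "card {v, w} \<le> 2" by (simp add: card_insert_if)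
    ultimately show False by (simp add: card_cart_basis)
  qed
  then obtain u where u: "\<And>x y. u \<noteq> x *s v + y *s w" by blast
  show thesis
  proof (rule that[of u], unfold independent3_def, intro allI impI)
    fix x y z assume *: "x *s v + y *s w + z *s u = 0"
    have z: "z = 0"
    proof (rule ccontr)
      assume z: "z \<noteq> 0"
      have "u = (1 / z) *s (x *s v + y *s w + z *s u) + ((- x / z) *s v + (- y / z) *s w)"
        using z by (simp add: vec_eq_iff field_simps)
      then have "u = (- x / z) *s v + (- y / z) *s w" unfolding * by simp
      then show False using u by blast
    qed
    have y: "y = 0"
    proof (rule ccontr)
      assume y: "y \<noteq> 0"
      have "w = (1 / y) *s (x *s v + y *s w + z *s u) + (- x / y) *s v"
        using y z by (simp add: vec_eq_iff field_simps)
      then have "w = (- x / y) *s v" unfolding * by simp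
      then show False using assms by blast
    qed
    show "x = 0 \<and> y = 0 \<and> z = 0" using * assms z y by (simp add: vector_mul_eq_0)
  qed
qed

text \<open>The coincidences among the roots from \<open>cayley_hamilton_3\<close> are distinguished
  first, then how soon products of the commuting operators \<open>L x\<close> vanish. Jordan chains
  are obtained by applying these operators to a vector not yet annihilated.\<close>

lemma jordan_form_3:
  fixes M :: "complex ^ 3 ^ 3"
  obtains
    (diag3) u v w a b c where "independent3 u v w" "a \<noteq> b" "a \<noteq> c" "b \<noteq> c"
      "M *v u = a *s u" "M *v v = b *s v" "M *v w = c *s w"
  | (diag2) u v w a b where "independent3 u v w" "a \<noteq> b"
      "M *v u = a *s u" "M *v v = a *s v" "M *v w = b *s w"
  | (scalar) u v w a where "independent3 u v w"
      "M *v u = a *s u" "M *v v = a *s v" "M *v w = a *s w"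
  | (block21) u v w a b where "independent3 u v w" "a \<noteq> b"
      "M *v u = a *s u" "M *v v = u + a *s v" "M *v w = b *s w"
  | (block2) u v w a where "independent3 u v w"
      "M *v u = a *s u" "M *v v = u + a *s v" "M *v w = a *s w"
  | (block3) u v w a where "independent3 u v w"
      "M *v u = a *s u" "M *v v = u + a *s v" "M *v w = v + a *s w"
proof -
  define L where "L x v = M *v v - x *s v" for x v
  have LM: "M *v v = L x v + x *s v" for x v by (simp add: L_def)
  have L0: "L x 0 = 0" for x by (simp add: L_def)
  have L_add: "L x (v + w) = L x v + L x w" for x v w
    by (simp add: L_def matrix_vector_right_distrib vector_add_ldistrib)
  have L_scale: "L x (c *s v) = c *s L x v" for x c v
    by (simp add: L_def vector_scalar_commute vec_eq_iff algebra_simps)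
  have L_comm: "L x (L y v) = L y (L x v)" for x y v
    by (simp add: L_def matrix_vector_mult_diff_distrib vector_scalar_commute vec_eq_iff algebra_simps)
  have L_eig: "L y v = (x - y) *s v" if "L x v = 0" for x y v
    using that by (simp add: L_def vec_eq_iff algebra_simps)
  have eigM: "M *v v = x *s v" if "L x v = 0" for x v using LM[of v x] that by simp
  have L_comb: "L x (r *s u + s *s v + t *s w) = r *s L x u + s *s L x v + t *s L x w" for x r s t u v w
    by (simp add: L_add L_scale)
  obtain a b c where CH: "\<And>v. L a (L b (L c v)) = 0"
    and eig: "\<And>x. x \<in> {a, b, c} \<Longrightarrow> \<exists>v. v \<noteq> 0 \<and> L x v = 0"
    using cayley_hamilton_3[of M] unfolding L_def by metis
  \<comment> \<open>The hypotheses say that \<open>(M - a)^2 (M - b)\<close> vanishes and that both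
    numbers are eigenvalues; which of them is double stays open, so both outcomes are
    covered.\<close>
  have two_eig: thesis
    if ab: "a \<noteq> b" and CH: "\<And>v. L a (L a (L b v)) = 0" and ea: "\<exists>v. v \<noteq> 0 \<and> L a v = 0"
      and eb: "\<exists>v. v \<noteq> 0 \<and> L b v = 0" for a b
  proof (cases "\<forall>v. L a (L b v) = 0")
    case False
    then obtain x where x: "L a (L b x) \<noteq> 0" by blast
    \<comment> \<open>By \<open>CH\<close>, the image of \<open>L b\<close> lies in the kernel of
      the square of \<open>L a\<close>; this gives the chain \<open>v\<close>, \<open>u\<close> for
      \<open>a\<close>.\<close>
    define v where "v = L b x"
    define u where "u = L a v"
    obtain w where w: "w \<noteq> 0" "L b w = 0" using eb by blast
    have u: "u \<noteq> 0" "L a u = 0" using x CH by (simp_all add: u_def v_def)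
    have ind: "independent3 u v w" unfolding independent3_def
    proof (intro allI impI)
      fix r s t assume *: "r *s u + s *s v + t *s w = 0"
      have w': "L a w = (b - a) *s w" by (rule L_eig[OF w(2)])
      have "s *s u + (t * (b - a)) *s w = L a (r *s u + s *s v + t *s w)"
        unfolding L_comb u(2) w' u_def[symmetric] by (simp add: vec_eq_iff algebra_simps)
      then have "s *s u + (t * (b - a)) *s w = 0" unfolding * L0 .
      then have "L a (s *s u + (t * (b - a)) *s w) = 0" by (simp add: L0)
      then have "(t * (b - a) * (b - a)) *s w = 0" by (simp add: L_add L_scale u(2) w')
      then have t: "t = 0" using ab w by (simp add: vector_mul_eq_0)
      then have "s *s u = 0" using \<open>s *s u + (t * (b - a)) *s w = 0\<close> by simp
      then have s: "s = 0" using u by (simp add: vector_mul_eq_0)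
      then have "r *s u = 0" using * t by simp
      then show "r = 0 \<and> s = 0 \<and> t = 0" using u s t by (simp add: vector_mul_eq_0)
    qed
    show thesis
      by (rule block21[OF ind ab eigM[OF u(2)] _ eigM[OF w(2)]]) (use LM[of v a] in \<open>simp add: u_def\<close>)
  next
    case True
    obtain u where u: "u \<noteq> 0" "L a u = 0" using ea by blast
    obtain w where w: "w \<noteq> 0" "L b w = 0" using eb by blast
    have "w \<noteq> r *s u" for r
    proof
      assume "w = r *s u"
      then have "L a w = 0" by (simp add: L_scale u)
      then show False using L_eig[OF w(2), of a] ab w by (simp add: vector_mul_eq_0)
    qed
    then obtain x where x: "independent3 u w x" using independent3_extend u by blast
    \<comment> \<open>\<open>L b - L a\<close> is \<open>a - b\<close> times the identity, so
      \<open>x\<close> splits as \<open>y + z\<close>. As the product of \<open>L a\<close> and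
      \<open>L b\<close> vanishes, \<open>y\<close> is killed by \<open>L a\<close> and
      \<open>z\<close> by \<open>L b\<close>.\<close>
    define y where "y = (1 / (a - b)) *s L b x"
    define z where "z = (- (1 / (a - b))) *s L a x"
    have y: "L a y = 0" by (simp add: y_def L_scale True)
    have z: "L b z = 0" unfolding z_def L_scale L_comm[of b a] by (simp add: True)
    have xyz: "x = y + z"
    proof -
      have d: "L b x - L a x = (a - b) *s x" by (simp add: L_def vec_eq_iff algebra_simps)
      have "y + z = (1 / (a - b)) *s (L b x - L a x)"
        by (simp add: y_def z_def vec_eq_iff diff_divide_distrib)
      also have "\<dots> = x" unfolding d vector_smult_assoc using ab by (simp del: vector_sub_rdistrib)
      finally show ?thesis ..
    qed
    show thesis
    proof (cases "independent3 u y w")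
      case True
      show thesis by (rule diag2[OF True ab eigM[OF u(2)] eigM[OF y] eigM[OF w(2)]])
    next
      case False
      \<comment> \<open>Now \<open>y\<close> adds nothing to \<open>u\<close> and \<open>w\<close>,
        whereas \<open>x = y + z\<close> is independent of them. So \<open>z\<close> is the new
        direction, and \<open>b\<close> is the double eigenvalue.\<close>
      then obtain r s t where rst: "r *s u + s *s y + t *s w = 0" "\<not> (r = 0 \<and> s = 0 \<and> t = 0)"
        unfolding independent3_def by blast
      have ind: "independent3 w z u" unfolding independent3_def
      proof (intro allI impI)
        fix r' s' t' assume *: "r' *s w + s' *s z + t' *s u = 0"
        have "(s * t' + s' * r) *s u + (s * r' + s' * t) *s w + (s * s') *s x
            = s *s (r' *s w + s' *s z + t' *s u) + s' *s (r *s u + s *s y + t *s w)"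
          unfolding xyz by (simp add: vec_eq_iff algebra_simps)
        also have "\<dots> = 0" unfolding * rst by simp
        finally have 1: "s * t' + s' * r = 0 \<and> s * r' + s' * t = 0 \<and> s * s' = 0"
          by (rule independent3D[OF x])
        have s: "s \<noteq> 0"
        proof
          assume s: "s = 0"
          then have "r *s u + t *s w + 0 *s x = 0" using rst by simp
          from independent3D[OF x this] s rst show False by blast
        qed
        with 1 show "r' = 0 \<and> s' = 0 \<and> t' = 0" by auto
      qed
      show thesis by (rule diag2[OF ind ab[symmetric] eigM[OF w(2)] eigM[OF z] eigM[OF u(2)]])
    qed
  qed
  consider "a \<noteq> b" "a \<noteq> c" "b \<noteq> c" | "a = b" "b \<noteq> c" | "a = c" "b \<noteq> c" | "b = c" "a \<noteq> b"
    | "a = b" "b = c" by blast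
  then show thesis
  proof cases
    case ne: 1
    obtain u v w where uvw: "u \<noteq> 0" "L a u = 0" "v \<noteq> 0" "L b v = 0" "w \<noteq> 0" "L c w = 0"
      using eig[of a] eig[of b] eig[of c] by blast
    have "independent3 u v w" unfolding independent3_def
    proof (intro allI impI)
      fix r s t assume *: "r *s u + s *s v + t *s w = 0"
      \<comment> \<open>\<open>L c\<close> kills \<open>w\<close> and multiplies \<open>u\<close>
        and \<open>v\<close> by nonzero factors; applying \<open>L b\<close> next isolates
        \<open>u\<close>.\<close>
      have 1: "(r * (a - c)) *s u + (s * (b - c)) *s v = 0"
        using arg_cong[OF *, of "L c"]
        unfolding L_comb L_eig[OF uvw(2), of c] L_eig[OF uvw(4), of c] uvw(6) L0
        by (simp only: vector_smult_assoc vector_smult_rzero add_0_right)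
      have "(r * (a - c) * (a - b)) *s u = 0"
        using arg_cong[OF 1, of "L b"] unfolding L_add L_scale L_eig[OF uvw(2), of b] uvw(4) L0
        by (simp only: vector_smult_assoc vector_smult_rzero add_0_right)
      then have r: "r = 0" using ne uvw by (simp only: vector_mul_eq_0 mult_eq_0_iff right_minus_eq) blast
      have "(s * (b - c)) *s v = 0"
        using 1 unfolding r by (simp only: mult_zero_left vector_smult_lzero add_0_left)
      then have s: "s = 0" using ne uvw by (simp only: vector_mul_eq_0 mult_eq_0_iff right_minus_eq) blast
      have "t *s w = 0" using * r s by simp
      then show "r = 0 \<and> s = 0 \<and> t = 0" using r s uvw by (simp add: vector_mul_eq_0)
    qed
    then show thesis by (rule diag3[OF _ ne eigM[OF uvw(2)] eigM[OF uvw(4)] eigM[OF uvw(6)]])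
  next
    case 2
    show thesis using two_eig[of a c] 2 CH eig[of a] eig[of c] by simp
  next
    case 3
    show thesis
      by (rule two_eig[of a b]) (use 3 CH eig[of a] eig[of b] L_comm in simp_all)
  next
    case 4
    show thesis
      by (rule two_eig[of b a]) (use 4 CH eig[of a] eig[of b] L_comm in simp_all)
  next
    case 5
    then have CH: "L a (L a (L a v)) = 0" for v using CH by simp
    consider "\<forall>v. L a v = 0" | "\<exists>v. L a v \<noteq> 0" "\<forall>v. L a (L a v) = 0" | "\<exists>v. L a (L a v) \<noteq> 0"
      by blast
    then show thesis
    proof cases
      case 1
      have "independent3 (axis 1 1) (axis 2 1) (axis 3 1)"
        by (simp add: independent3_def vec_eq_iff forall_3 axis_def)
      then show thesis by (rule scalar) (use 1 eigM in blast)+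
    next
      case 2
      then obtain v where v: "L a v \<noteq> 0" by blast
      define u where "u = L a v"
      have u: "u \<noteq> 0" "L a u = 0" using v 2 by (simp_all add: u_def)
      have "v \<noteq> r *s u" for r using v u by (auto simp: L_scale)
      then obtain x where x: "independent3 u v x" using independent3_extend u by blast
      have Mv: "M *v v = u + a *s v" using LM[of v a] by (simp add: u_def)
      show thesis
      \<comment> \<open>A second eigenvector is wanted beside the chain \<open>v\<close>,
        \<open>u\<close>. If \<open>L a x\<close> is a multiple of \<open>u\<close>, subtracting a
        multiple of \<open>v\<close> from \<open>x\<close> gives one; otherwise \<open>L a x\<close>
        itself serves.\<close>
      proof (cases "\<exists>r. L a x = r *s u")
        case True
        then obtain r where r: "L a x = r *s u" by blast
        define w where "w = x + (- r) *s v"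
        have w: "L a w = 0" by (simp only: w_def L_add L_scale r u_def[symmetric]) simp
        have "independent3 u v w" unfolding independent3_def
        proof (intro allI impI)
          fix p q t assume "p *s u + q *s v + t *s w = 0"
          then have "p *s u + (q - t * r) *s v + t *s x = 0"
            by (simp add: w_def vec_eq_iff algebra_simps)
          from independent3D[OF x this] show "p = 0 \<and> q = 0 \<and> t = 0" by auto
        qed
        then show thesis by (rule block2[OF _ eigM[OF u(2)] Mv eigM[OF w]])
      next
        case False
        define w where "w = L a x"
        have w: "L a w = 0" using 2 by (simp add: w_def)
        have "independent3 u v w" unfolding independent3_def
        proof (intro allI impI)
          fix p q t assume *: "p *s u + q *s v + t *s w = 0"
          then have "q *s u = 0"
            using L_comb[of a p u q v t w] L0 u w by (simp flip: u_def)
          then have q: "q = 0" using u by (simp add: vector_mul_eq_0)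
          have t: "t = 0"
          proof (rule ccontr)
            assume "t \<noteq> 0"
            then have "w = (1 / t) *s (p *s u + q *s v + t *s w) + (- p / t) *s u"
              using q by (simp add: vec_eq_iff field_simps)
            then have "w = (- p / t) *s u" unfolding * by simp
            then show False using False unfolding w_def by blast
          qed
          show "p = 0 \<and> q = 0 \<and> t = 0" using * q t u by (simp add: vector_mul_eq_0)
        qed
        then show thesis by (rule block2[OF _ eigM[OF u(2)] Mv eigM[OF w]])
      qed
    next
      case 3
      then obtain w where w: "L a (L a w) \<noteq> 0" by blast
      \<comment> \<open>A vector not killed by the square of \<open>L a\<close> heads a full chain,
        whose last element is an eigenvector by \<open>CH\<close>.\<close>
      define v where "v = L a w"
      define u where "u = L a v"
      have u: "u \<noteq> 0" "L a u = 0" using w CH by (simp_all add: u_def v_def)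
      have "independent3 u v w" unfolding independent3_def
      proof (intro allI impI)
        fix p q t assume *: "p *s u + q *s v + t *s w = 0"
        then have 1: "q *s u + t *s v = 0"
          using L_comb[of a p u q v t w] L0 u by (simp flip: u_def v_def)
        then have "L a (q *s u + t *s v) = 0" by (simp add: L0)
        then have "t *s u = 0" using u by (simp add: L_add L_scale flip: u_def)
        then have t: "t = 0" using u by (simp add: vector_mul_eq_0)
        then have q: "q = 0" using 1 u by (simp add: vector_mul_eq_0)
        show "p = 0 \<and> q = 0 \<and> t = 0" using * q t u by (simp add: vector_mul_eq_0)
      qed
      then show thesis
        by (rule block3[OF _ eigM[OF u(2)]])
           (use LM[of v a] LM[of w a] in \<open>simp_all add: u_def v_def\<close>)
    qed
  qed
qed

section \<open>Fixed points of projective linear maps\<close>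

lemma independent3_iff_det: "independent3 u v w \<longleftrightarrow> det (cols3 u v w) \<noteq> 0"
  by (simp only: independent3_def det_cols3_nonzero_iff)

text \<open>The factor \<open>l\<close> is automatically nonzero, because \<open>M *v v\<close>
  is.\<close>

lemma plin_fixed_iff:
  assumes "invertible M" "v \<noteq> 0"
  shows "plin M (proj v) = proj v \<longleftrightarrow> (\<exists>l. M *v v = l *s v)"
proof -
  have nz: "M *v v \<noteq> 0" using assms by (rule invertible_mult_nonzero)
  have "proj (M *v v) = proj v \<longleftrightarrow> (\<exists>c. c \<noteq> 0 \<and> M *v v = c *s v)"
    using proj_eq_iff[OF assms(2) nz] by metis
  also have "\<dots> \<longleftrightarrow> (\<exists>l. M *v v = l *s v)" using nz by (metis vector_smult_lzero)
  finally show ?thesis using assms by (simp add: plin_proj)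
qed

section \<open>Projective coordinates with respect to a Jordan basis\<close>

locale basis3 =
  fixes u v w :: "complex ^ 3"
  assumes indep: "independent3 u v w"
begin

definition comb :: "complex \<Rightarrow> complex \<Rightarrow> complex \<Rightarrow> complex ^ 3" where
  "comb x y z = x *s u + y *s v + z *s w"

definition pt :: "complex \<Rightarrow> complex \<Rightarrow> complex \<Rightarrow> cp2" where
  "pt x y z = proj (comb x y z)"

lemma comb_eq_cols3: "comb x y z = cols3 u v w *v vector [x, y, z]"
  by (simp add: comb_def cols3_mult vector_3)

lemma comb_unit: "comb 1 0 0 = u" "comb 0 1 0 = v" "comb 0 0 1 = w"
  by (simp_all add: comb_def)

lemma comb_eq_iff: "comb x y z = comb x' y' z' \<longleftrightarrow> x = x' \<and> y = y' \<and> z = z'"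
proof
  assume "comb x y z = comb x' y' z'"
  then have "(x - x') *s u + (y - y') *s v + (z - z') *s w = 0"
    by (simp add: comb_def vec_eq_iff algebra_simps)
  from independent3D[OF indep this] show "x = x' \<and> y = y' \<and> z = z'" by simp
qed simp

lemma comb_scale: "c *s comb x y z = comb (c * x) (c * y) (c * z)"
  by (simp add: comb_def vec_eq_iff algebra_simps)

lemma comb_nonzero: "comb x y z \<noteq> 0 \<longleftrightarrow> (x, y, z) \<noteq> (0, 0, 0)"
proof -
  have "comb 0 0 0 = 0" by (simp add: comb_def)
  then show ?thesis using comb_eq_iff[of x y z 0 0 0] by simp
qed

lemma comb_mult:
  "M *v comb x y z = x *s (M *v u) + y *s (M *v v) + z *s (M *v w)"
  by (simp add: comb_def matrix_vector_right_distrib vector_scalar_commute)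

lemma invertible_cols3: "invertible (cols3 u v w)"
  using indep by (simp add: invertible_det_nz independent3_iff_det)

lemma comb_cases: obtains x y z where "p = comb x y z"
proof -
  obtain N where N: "cols3 u v w ** N = mat 1"
    using invertible_cols3 by (auto simp: invertible_def)
  define q where "q = N *v p"
  have "p = cols3 u v w *v q" by (simp add: q_def matrix_vector_mul_assoc N)
  also have "\<dots> = comb (q $ 1) (q $ 2) (q $ 3)" by (simp add: comb_def cols3_mult)
  finally show thesis by (rule that)
qed

lemma pt_cases:
  obtains x y z where "(x, y, z) \<noteq> (0, 0, 0)" "P = pt x y z"
proof -
  obtain p where p: "p \<noteq> 0" "P = proj p" by (rule proj_cases)
  obtain x y z where "p = comb x y z" by (rule comb_cases)
  then show thesis using p comb_nonzero that by (auto simp: pt_def)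
qed

lemma pt_eq_iff:
  assumes "(x, y, z) \<noteq> (0, 0, 0)" "(x', y', z') \<noteq> (0, 0, 0)"
  shows "pt x y z = pt x' y' z' \<longleftrightarrow> (\<exists>c. c \<noteq> 0 \<and> x' = c * x \<and> y' = c * y \<and> z' = c * z)"
  using proj_eq_iff[of "comb x y z" "comb x' y' z'"] assms
  by (simp only: comb_nonzero pt_def comb_scale comb_eq_iff simp_thms)

lemma pt_fixed_iff:
  assumes "invertible M" "(x, y, z) \<noteq> (0, 0, 0)" "M *v comb x y z = comb x' y' z'"
  shows "pt x y z \<in> fixed_points (plin M) \<longleftrightarrow> (\<exists>l. x' = l * x \<and> y' = l * y \<and> z' = l * z)"
  using plin_fixed_iff[of M "comb x y z"] assms
  by (simp only: comb_nonzero pt_def comb_scale comb_eq_iff fixed_points_def mem_Collect_eq simp_thms)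

text \<open>The conjugating map is induced by the inverse of the matrix of basis vectors, so
  \<open>g\<close> acts on standard coordinates as \<open>M\<close> acts on coordinates in the basis
  \<open>u\<close>, \<open>v\<close>, \<open>w\<close>. Normal forms can thus be read off from the
  values of \<open>M\<close> on the basis.\<close>

lemma conjugate_to_comb:
  assumes M: "invertible M"
  obtains g where "g \<in> Aut_cp2" "conjugate_in_Aut (plin M) g"
    "\<And>x y z x' y' z'. (x, y, z) \<noteq> (0, 0, 0) \<Longrightarrow> M *v comb x y z = comb x' y' z' \<Longrightarrow>
       g (hpt x y z) = hpt x' y' z'"
proof -
  let ?C = "cols3 u v w"
  obtain N where N: "?C ** N = mat 1" "N ** ?C = mat 1"
    using invertible_cols3 by (auto simp: invertible_def)
  then have iN: "invertible N" by (auto simp: invertible_def)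
  let ?g = "plin (N ** (M ** ?C))"
  have ig: "invertible (N ** (M ** ?C))" using iN M invertible_cols3 by (intro invertible_mult)
  show thesis
  proof (rule that[of ?g])
    show "?g \<in> Aut_cp2" using ig by (rule plin_Aut)
    have "?g = plin N \<circ> plin M \<circ> inv (plin N)"
      unfolding plin_inverse(2)[OF N(2,1)]
      by (rule ext) (simp add: plin_mult iN M invertible_cols3 invertible_mult matrix_mul_assoc)
    then show "conjugate_in_Aut (plin M) ?g"
      unfolding conjugate_in_Aut_def using plin_Aut[OF iN] by blast
    fix x y z x' y' z'
    assume ne: "(x, y, z) \<noteq> (0, 0, 0)" and Mc: "M *v comb x y z = comb x' y' z'"
    have vnz: "(vector [x, y, z] :: complex ^ 3) \<noteq> 0"
      using ne by (auto simp: vec_eq_iff forall_3 vector_3)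
    have "(N ** (M ** ?C)) *v vector [x, y, z] = N *v (M *v comb x y z)"
      by (simp add: comb_eq_cols3 matrix_vector_mul_assoc)
    also have "\<dots> = vector [x', y', z']"
      unfolding Mc by (simp add: comb_eq_cols3 matrix_vector_mul_assoc N)
    finally show "?g (hpt x y z) = hpt x' y' z'"
      unfolding hpt_def using plin_proj[OF ig vnz] by (simp only:)
  qed
qed

section \<open>Fixed point sets of the Jordan types\<close>

lemma fixed_points_diag3:
  assumes "invertible M" "a \<noteq> b" "a \<noteq> c" "b \<noteq> c"
    "M *v u = a *s u" "M *v v = b *s v" "M *v w = c *s w"
  shows "fixed_points (plin M) = {pt 1 0 0, pt 0 1 0, pt 0 0 1}"
proof (rule set_eqI)
  fix P
  obtain x y z where P: "(x, y, z) \<noteq> (0, 0, 0)" "P = pt x y z" by (rule pt_cases)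
  have "M *v comb x y z = comb (a * x) (b * y) (c * z)"
    unfolding comb_mult assms by (simp add: comb_def mult.commute)
  then have "P \<in> fixed_points (plin M) \<longleftrightarrow> (\<exists>l. a * x = l * x \<and> b * y = l * y \<and> c * z = l * z)"
    unfolding P(2) by (rule pt_fixed_iff[OF assms(1) P(1)])
  also have "\<dots> \<longleftrightarrow> y = 0 \<and> z = 0 \<or> x = 0 \<and> z = 0 \<or> x = 0 \<and> y = 0" using assms(2-4) by auto
  also have "\<dots> \<longleftrightarrow> P \<in> {pt 1 0 0, pt 0 1 0, pt 0 0 1}"
    unfolding P(2) insert_iff using P(1)
    by (auto simp: pt_eq_iff intro: exI[of _ "1 / x"] exI[of _ "1 / y"] exI[of _ "1 / z"])
  finally show "P \<in> fixed_points (plin M) \<longleftrightarrow> P \<in> {pt 1 0 0, pt 0 1 0, pt 0 0 1}" .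
qed

lemma fixed_points_block21:
  assumes "invertible M" "a \<noteq> b" "M *v u = a *s u" "M *v v = u + a *s v" "M *v w = b *s w"
  shows "fixed_points (plin M) = {pt 1 0 0, pt 0 0 1}"
proof (rule set_eqI)
  fix P
  obtain x y z where P: "(x, y, z) \<noteq> (0, 0, 0)" "P = pt x y z" by (rule pt_cases)
  have "M *v comb x y z = comb (a * x + y) (a * y) (b * z)"
    unfolding comb_mult assms by (simp add: comb_def vec_eq_iff algebra_simps)
  then have "P \<in> fixed_points (plin M) \<longleftrightarrow> (\<exists>l. a * x + y = l * x \<and> a * y = l * y \<and> b * z = l * z)"
    unfolding P(2) by (rule pt_fixed_iff[OF assms(1) P(1)])
  also have "\<dots> \<longleftrightarrow> y = 0 \<and> z = 0 \<or> x = 0 \<and> y = 0" using assms(2) by auto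
  also have "\<dots> \<longleftrightarrow> P \<in> {pt 1 0 0, pt 0 0 1}"
    unfolding P(2) insert_iff using P(1)
    by (auto simp: pt_eq_iff intro: exI[of _ "1 / x"] exI[of _ "1 / z"])
  finally show "P \<in> fixed_points (plin M) \<longleftrightarrow> P \<in> {pt 1 0 0, pt 0 0 1}" .
qed

lemma fixed_points_block3:
  assumes "invertible M" "M *v u = a *s u" "M *v v = u + a *s v" "M *v w = v + a *s w"
  shows "fixed_points (plin M) = {pt 1 0 0}"
proof (rule set_eqI)
  fix P
  obtain x y z where P: "(x, y, z) \<noteq> (0, 0, 0)" "P = pt x y z" by (rule pt_cases)
  have "M *v comb x y z = comb (a * x + y) (a * y + z) (a * z)"
    unfolding comb_mult assms by (simp add: comb_def vec_eq_iff algebra_simps)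
  then have "P \<in> fixed_points (plin M) \<longleftrightarrow> (\<exists>l. a * x + y = l * x \<and> a * y + z = l * y \<and> a * z = l * z)"
    unfolding P(2) by (rule pt_fixed_iff[OF assms(1) P(1)])
  \<comment> \<open>A nonzero \<open>z\<close> forces \<open>l = a\<close> in the third equation,
    against the second; then a nonzero \<open>y\<close> forces \<open>l = a\<close> in the second,
    against the first.\<close>
  also have "\<dots> \<longleftrightarrow> y = 0 \<and> z = 0" by auto
  also have "\<dots> \<longleftrightarrow> P \<in> {pt 1 0 0}"
    unfolding P(2) insert_iff using P(1) by (auto simp: pt_eq_iff intro: exI[of _ "1 / x"])
  finally show "P \<in> fixed_points (plin M) \<longleftrightarrow> P \<in> {pt 1 0 0}" .
qed

lemma card_pts: "card {pt 1 0 0, pt 0 1 0, pt 0 0 1} = 3" "card {pt 1 0 0, pt 0 0 1} = 2"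
  by (simp_all add: card_insert_if pt_eq_iff)

definition fixed_line :: "cp2 set" where
  "fixed_line = {pt x y 0 | x y. (x, y) \<noteq> (0, 0)}"

lemma pt_in_fixed_line:
  assumes "(x, y, z) \<noteq> (0, 0, 0)"
  shows "pt x y z \<in> fixed_line \<longleftrightarrow> z = 0"
proof
  assume "pt x y z \<in> fixed_line"
  then obtain x' y' where *: "(x', y') \<noteq> (0, 0)" "pt x' y' 0 = pt x y z"
    unfolding fixed_line_def mem_Collect_eq by metis
  then obtain c where "z = c * 0" using pt_eq_iff[of x' y' 0 x y z] assms by auto
  then show "z = 0" by simp
qed (use assms in \<open>auto simp: fixed_line_def\<close>)

text \<open>The functional \<open>a\<close> is the cross product of \<open>u\<close> and
  \<open>v\<close>; its value on a combination of the basis is the determinant times the coefficient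
  of \<open>w\<close>.\<close>

lemma projective_fixed_line: "projective_line fixed_line"
proof -
  define a :: "complex ^ 3" where "a = vector [u$2 * v$3 - u$3 * v$2, u$3 * v$1 - u$1 * v$3, u$1 * v$2 - u$2 * v$1]"
  have a: "(\<Sum>k\<in>UNIV. a $ k * comb x y z $ k) = z * det (cols3 u v w)" for x y z
    by (simp add: a_def sum_3 vector_3 det_cols3 comb_def algebra_simps)
  have d: "det (cols3 u v w) \<noteq> 0" using indep by (simp add: independent3_iff_det)
  have "a \<noteq> 0"
  proof
    assume "a = 0"
    then show False using a[of 0 0 1] d by simp
  qed
  moreover have "fixed_line = proj ` {p. p \<noteq> 0 \<and> (\<Sum>k\<in>UNIV. a $ k * p $ k) = 0}" (is "_ = ?R")
  proof (rule set_eqI)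
    fix P
    obtain x y z where P: "(x, y, z) \<noteq> (0, 0, 0)" "P = pt x y z" by (rule pt_cases)
    have "P \<in> ?R \<longleftrightarrow> z = 0"
    proof
      assume "P \<in> ?R"
      then obtain p where p: "p \<noteq> 0" "(\<Sum>k\<in>UNIV. a $ k * p $ k) = 0" "P = proj p" by blast
      obtain x' y' z' where p': "p = comb x' y' z'" by (rule comb_cases)
      have z': "z' = 0" using p(2) d unfolding p' a by simp
      have ne: "(x', y', z') \<noteq> (0, 0, 0)" using p(1) unfolding p' comb_nonzero .
      have "pt x' y' z' = pt x y z" using p(3) P(2) p' by (simp add: pt_def)
      then show "z = 0" using z' pt_eq_iff[OF ne P(1)] by auto
    next
      assume z: "z = 0"
      have "comb x y z \<noteq> 0" using P(1) comb_nonzero by blast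
      moreover have "(\<Sum>k\<in>UNIV. a $ k * comb x y z $ k) = 0" unfolding a z by simp
      ultimately show "P \<in> ?R" unfolding P(2) pt_def by blast
    qed
    then show "P \<in> fixed_line \<longleftrightarrow> P \<in> ?R" using pt_in_fixed_line P by simp
  qed
  ultimately show ?thesis unfolding projective_line_def by blast
qed

lemma infinite_fixed_line: "infinite fixed_line"
proof
  assume fin: "finite fixed_line"
  have "inj (\<lambda>t. pt 1 t 0)" by (rule injI) (auto simp: pt_eq_iff)
  moreover have "range (\<lambda>t. pt 1 t 0) \<subseteq> fixed_line" by (auto simp: pt_in_fixed_line)
  then have "finite (range (\<lambda>t. pt 1 t 0))" using fin by (rule finite_subset)
  ultimately show False using finite_imageD infinite_UNIV_char_0 by blast
qed

lemma fixed_points_diag2: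
  assumes "invertible M" "a \<noteq> b" "M *v u = a *s u" "M *v v = a *s v" "M *v w = b *s w"
  shows "fixed_points (plin M) = {pt 0 0 1} \<union> fixed_line"
proof (rule set_eqI)
  fix P
  obtain x y z where P: "(x, y, z) \<noteq> (0, 0, 0)" "P = pt x y z" by (rule pt_cases)
  have "M *v comb x y z = comb (a * x) (a * y) (b * z)"
    unfolding comb_mult assms by (simp add: comb_def mult.commute)
  then have "P \<in> fixed_points (plin M) \<longleftrightarrow> (\<exists>l. a * x = l * x \<and> a * y = l * y \<and> b * z = l * z)"
    unfolding P(2) by (rule pt_fixed_iff[OF assms(1) P(1)])
  also have "\<dots> \<longleftrightarrow> x = 0 \<and> y = 0 \<or> z = 0" using assms(2) by auto
  also have "\<dots> \<longleftrightarrow> P \<in> {pt 0 0 1} \<union> fixed_line"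
    unfolding P(2) Un_iff pt_in_fixed_line[OF P(1)] using P(1)
    by (auto simp: pt_eq_iff intro: exI[of _ "1 / z"])
  finally show "P \<in> fixed_points (plin M) \<longleftrightarrow> P \<in> {pt 0 0 1} \<union> fixed_line" .
qed

lemma fixed_points_scalar:
  assumes "invertible M" "M *v u = a *s u" "M *v v = a *s v" "M *v w = a *s w"
  shows "fixed_points (plin M) = UNIV"
proof -
  have "P \<in> fixed_points (plin M)" for P
  proof -
    obtain x y z where P: "(x, y, z) \<noteq> (0, 0, 0)" "P = pt x y z" by (rule pt_cases)
    have "M *v comb x y z = comb (a * x) (a * y) (a * z)"
      unfolding comb_mult assms by (simp add: comb_def mult.commute)
    then show ?thesis unfolding P(2) using pt_fixed_iff[OF assms(1) P(1)] by blast
  qed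
  then show ?thesis by blast
qed

end

text \<open>The eigenplane is spanned by \<open>u\<close> and \<open>w\<close>, so the last two
  basis vectors are exchanged to match the form of \<open>fixed_line\<close>.\<close>

lemma (in basis3) fixed_points_block2:
  assumes "invertible M" "M *v u = a *s u" "M *v v = u + a *s v" "M *v w = a *s w"
  shows "projective_line (fixed_points (plin M))"
proof -
  interpret swapped: basis3 u w v
  proof
    show "independent3 u w v" using indep unfolding independent3_def by (metis (no_types) add.commute add.left_commute)
  qed
  have "fixed_points (plin M) = swapped.fixed_line"
  proof (rule set_eqI)
    fix P
    obtain x y z where P: "(x, y, z) \<noteq> (0, 0, 0)" "P = swapped.pt x y z" by (rule swapped.pt_cases)
    have "M *v swapped.comb x y z = swapped.comb (a * x + z) (a * y) (a * z)"
      unfolding swapped.comb_mult assms by (simp add: swapped.comb_def vec_eq_iff algebra_simps)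
    then have "P \<in> fixed_points (plin M) \<longleftrightarrow> (\<exists>l. a * x + z = l * x \<and> a * y = l * y \<and> a * z = l * z)"
      unfolding P(2) by (rule swapped.pt_fixed_iff[OF assms(1) P(1)])
    also have "\<dots> \<longleftrightarrow> z = 0" by auto
    finally show "P \<in> fixed_points (plin M) \<longleftrightarrow> P \<in> swapped.fixed_line"
      unfolding P(2) swapped.pt_in_fixed_line[OF P(1)] .
  qed
  then show ?thesis using swapped.projective_fixed_line by (simp only:)
qed

section \<open>Projective lines and dimensions\<close>

lemma line_functional_mem:
  assumes "a \<noteq> 0" "L = proj ` {v. v \<noteq> 0 \<and> (\<Sum>k\<in>UNIV. a $ k * v $ k) = 0}" "v \<noteq> 0"
  shows "proj v \<in> L \<longleftrightarrow> (\<Sum>k\<in>UNIV. a $ k * v $ k) = (0 :: complex)"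
proof
  assume "proj v \<in> L"
  then obtain w where w: "w \<noteq> 0" "(\<Sum>k\<in>UNIV. a $ k * w $ k) = 0" "proj v = proj w"
    using assms(2) by blast
  then obtain c where c: "v = c *s w" using proj_eq_iff[OF w(1) assms(3)] by auto
  have "(\<Sum>k\<in>UNIV. a $ k * v $ k) = c * (\<Sum>k\<in>UNIV. a $ k * w $ k)"
    unfolding c by (simp add: sum_3 algebra_simps)
  then show "(\<Sum>k\<in>UNIV. a $ k * v $ k) = 0" using w by simp
qed (use assms in blast)

lemma projective_line_functional:
  assumes "projective_line L"
  shows "\<exists>a :: complex ^ 3. a \<noteq> 0 \<and>
    (\<forall>v. v \<noteq> 0 \<longrightarrow> (proj v \<in> L \<longleftrightarrow> (\<Sum>k\<in>UNIV. a $ k * v $ k) = 0))"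
proof -
  obtain a :: "complex ^ 3" where a: "a \<noteq> 0"
    "L = proj ` {v. v \<noteq> 0 \<and> (\<Sum>k\<in>UNIV. a $ k * v $ k) = 0}"
    using assms unfolding projective_line_def by blast
  then show ?thesis using line_functional_mem[OF a] by blast
qed

lemma projective_line_add:
  assumes "projective_line L" "v \<noteq> 0" "w \<noteq> 0" "v + w \<noteq> 0" "proj w \<in> L"
  shows "proj (v + w) \<in> L \<longleftrightarrow> proj v \<in> L"
proof -
  obtain a where a: "\<And>v. v \<noteq> 0 \<Longrightarrow> proj v \<in> L \<longleftrightarrow> (\<Sum>k\<in>UNIV. a $ k * v $ k) = 0"
    using projective_line_functional[OF assms(1)] by blast
  have "(\<Sum>k\<in>UNIV. a $ k * w $ k) = 0" using a assms by blast
  then have "(\<Sum>k\<in>UNIV. a $ k * (v + w) $ k) = (\<Sum>k\<in>UNIV. a $ k * v $ k)"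
    by (simp add: distrib_left sum.distrib)
  then show ?thesis using a assms by metis
qed

lemma projective_line_infinite:
  assumes "projective_line L"
  shows "infinite L"
proof -
  obtain a where a: "a \<noteq> 0" "\<And>v. v \<noteq> 0 \<Longrightarrow> proj v \<in> L \<longleftrightarrow> (\<Sum>k\<in>UNIV. a $ k * v $ k) = 0"
    using projective_line_functional[OF assms] by blast
  obtain k where k: "a $ k \<noteq> 0" using a(1) by (auto simp: vec_eq_iff)
  obtain i j :: 3 where ij: "i \<noteq> k" "j \<noteq> k" "i \<noteq> j"
    by (cases k rule: index3_cases) (use that[of 2 3] that[of 1 3] that[of 1 2] in simp_all)
  \<comment> \<open>The functional is solved for coordinate \<open>k\<close>, where \<open>a\<close>
    is nonzero, with all coordinates multiplied by \<open>a $ k\<close> to avoid division.\<close>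
  define p where "p t = (\<chi> l. if l = i then a $ k else if l = j then t * a $ k
      else - (a $ i + t * a $ j))" for t
  have UN: "(UNIV :: 3 set) = {i, j, k}"
  proof -
    have "card {i, j, k} = CARD(3)" using ij by simp
    then show ?thesis using card_subset_eq[of "UNIV :: 3 set" "{i, j, k}"] by simp
  qed
  have p0: "p t \<noteq> 0" for t using k by (auto simp: p_def vec_eq_iff)
  have "proj (p t) \<in> L" for t
    unfolding a(2)[OF p0] UN using ij by (simp add: p_def algebra_simps)
  then have sub: "range (\<lambda>t. proj (p t)) \<subseteq> L" by blast
  have "inj (\<lambda>t. proj (p t))"
  proof (rule injI)
    fix s t assume "proj (p s) = proj (p t)"
    then obtain c where c: "p t = c *s p s" using proj_eq_iff[OF p0 p0] by blast
    have "p t $ i = c * p s $ i" "p t $ j = c * p s $ j" unfolding c by simp_all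
    then show "s = t" using k ij by (simp add: p_def)
  qed
  then have "infinite (range (\<lambda>t. proj (p t)))"
    using finite_imageD infinite_UNIV_char_0 by blast
  then show ?thesis using sub finite_subset by blast
qed

lemma projective_line_nonempty: "projective_line L \<Longrightarrow> \<exists>w. w \<noteq> 0 \<and> proj w \<in> L"
  using projective_line_infinite by (metis finite.emptyI all_not_in_conv proj_cases)

lemma projective_line_not_UNIV: "projective_line L \<Longrightarrow> L \<noteq> UNIV"
proof
  assume "projective_line L" "L = UNIV"
  then obtain a :: "complex ^ 3" where a: "a \<noteq> 0"
      "\<And>v. v \<noteq> 0 \<Longrightarrow> (\<Sum>k\<in>UNIV. a $ k * v $ k) = 0"
    using projective_line_functional by blast
  obtain k where k: "a $ k \<noteq> 0" using a(1) by (auto simp: vec_eq_iff)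
  have "(\<Sum>l\<in>UNIV. a $ l * axis k 1 $ l) = a $ k"
    by (simp add: axis_def if_distrib[of "\<lambda>x. _ * x"] cong: if_cong)
  then show False using a(2)[of "axis k 1"] k by (simp add: axis_eq_0_iff)
qed

text \<open>On the line joining \<open>proj v\<close> to a point of \<open>L\<close>, the sum
  represents a third point. It distinguishes a point together with a line from the whole plane and
  from a single line.\<close>

lemma point_and_line_third_point:
  assumes "projective_line L" "v \<noteq> 0" "w \<noteq> 0" "proj w \<in> L" "proj v \<notin> L"
  shows "v + w \<noteq> 0" "proj (v + w) \<noteq> proj v" "proj (v + w) \<notin> L"
proof -
  show nz: "v + w \<noteq> 0"
  proof
    assume "v + w = 0"
    then have "v = (- 1) *s w" by (simp add: vec_eq_iff eq_neg_iff_add_eq_0)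
    then have "proj v = proj w" using proj_eqI[of w "- 1"] assms(3) by simp
    then show False using assms by simp
  qed
  show "proj (v + w) \<notin> L" using projective_line_add[OF assms(1-3) nz assms(4)] assms(5) by blast
  show "proj (v + w) \<noteq> proj v"
  proof
    assume "proj (v + w) = proj v"
    then obtain c where "v + w = c *s v" using proj_eq_iff[OF assms(2) nz] by metis
    then have w: "w = (c - 1) *s v" by (simp add: vec_eq_iff algebra_simps)
    then have "c - 1 \<noteq> 0" using assms(3) by auto
    then have "proj w = proj v" unfolding w using assms(2) by (intro proj_eqI)
    then show False using assms by simp
  qed
qed

lemma point_and_line_not_UNIV: "point_and_line S \<Longrightarrow> S \<noteq> UNIV"
proof
  assume "point_and_line S" "S = UNIV"
  then obtain p L where L: "projective_line L" "p \<notin> L" "{p} \<union> L = UNIV"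
    unfolding point_and_line_def by metis
  obtain v where v: "v \<noteq> 0" "p = proj v" by (rule proj_cases)
  obtain w where w: "w \<noteq> 0" "proj w \<in> L" using projective_line_nonempty L(1) by blast
  note point_and_line_third_point[OF L(1) v(1) w]
  then show False using L v by blast
qed

text \<open>A line contains with two points the whole line joining them, hence also the third
  point.\<close>

lemma point_and_line_not_line: "point_and_line S \<Longrightarrow> \<not> projective_line S"
proof
  assume "point_and_line S" and S: "projective_line S"
  then obtain p L where L: "projective_line L" "p \<notin> L" "S = {p} \<union> L"
    unfolding point_and_line_def by metis
  obtain v where v: "v \<noteq> 0" "p = proj v" by (rule proj_cases)
  obtain w where w: "w \<noteq> 0" "proj w \<in> L" using projective_line_nonempty L(1) by blast
  note third = point_and_line_third_point[OF L(1) v(1) w L(2)[unfolded v]]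
  have "proj (v + w) \<in> S"
    using projective_line_add[OF S v(1) w(1) third(1)] L v w by blast
  then show False using third L v by blast
qed

lemma point_and_line_infinite: "point_and_line S \<Longrightarrow> infinite S"
  unfolding point_and_line_def using projective_line_infinite by auto

lemma infinite_cp2: "infinite (UNIV :: cp2 set)"
proof -
  have ind: "independent3 (axis 1 1) (axis 2 1) (axis 3 1)"
    by (simp add: independent3_def vec_eq_iff forall_3 axis_def)
  interpret basis3 "axis 1 1" "axis 2 1" "axis 3 1" by standard (rule ind)
  show ?thesis by (rule infinite_super[OF subset_UNIV infinite_fixed_line])
qed

text \<open>Globally invertible coordinates suffice below: translations, affine maps and the
  identity. Their global inverse takes care of the conditions on \<open>inv_into\<close> and of the
  openness of the image.\<close>

lemma regular_pointI:
  fixes \<Phi> \<Phi>' :: "complex ^ 2 \<Rightarrow> complex ^ 2"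
  assumes "p \<in> S" "p \<in> chart_domain i" "open W" "chart i p \<in> W"
    and inv: "\<And>w. \<Phi>' (\<Phi> w) = w" "\<And>y. \<Phi> (\<Phi>' y) = y"
    and cd: "\<And>w. cdiff \<Phi> w" "\<And>y. cdiff \<Phi>' y"
    and K: "card K + d = 2" "\<And>w. w \<in> W \<Longrightarrow> affine_point i w \<in> S \<longleftrightarrow> (\<forall>k\<in>K. \<Phi> w $ k = 0)"
  shows "regular_point S d p"
proof -
  have inj: "inj \<Phi>" by (rule inj_on_inverseI) (rule inv)
  have img: "\<Phi> ` W = \<Phi>' -` W"
  proof
    show "\<Phi>' -` W \<subseteq> \<Phi> ` W"
    proof
      fix y assume "y \<in> \<Phi>' -` W"
      then show "y \<in> \<Phi> ` W" using inv(2)[of y] by (metis imageI vimageD)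
    qed
  qed (auto simp: inv)
  have "continuous_on UNIV \<Phi>'" using cd(2) by (intro continuous_at_imp_continuous_on ballI cdiff_imp_continuous)
  then have op: "open (\<Phi> ` W)" unfolding img by (rule open_vimage[OF assms(3)])
  have "holo_on (inv_into W \<Phi>) (\<Phi> ` W)"
    unfolding holo_on_iff_cdiff
  proof
    fix y assume y: "y \<in> \<Phi> ` W"
    show "cdiff (inv_into W \<Phi>) y"
    proof (rule cdiff_transform[OF cd(2) op y])
      fix x assume "x \<in> \<Phi> ` W"
      then obtain w where "w \<in> W" "x = \<Phi> w" by blast
      then show "\<Phi>' x = inv_into W \<Phi> x"
        using inv_into_f_f[OF inj_on_subset[OF inj subset_UNIV], of w W] inv(1) by simp
    qed
  qed
  moreover have "inj_on \<Phi> W" using inj by (rule inj_on_subset) simp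
  ultimately show ?thesis
    unfolding regular_point_def using assms(1-4) op cd(1) K by (simp only: holo_on_iff_cdiff) blast
qed

text \<open>Every point is isolated, so near it a translated chart has both coordinates zero exactly
  at that point.\<close>

lemma pure_dimension_finite:
  assumes "finite S"
  shows "pure_dimension S 0"
  unfolding pure_dimension_def
proof
  fix p assume p: "p \<in> S"
  obtain i where i: "p \<in> chart_domain i" by (rule chart_domain_cover)
  define W where "W = - {w. affine_point i w \<in> S - {p}}"
  have "{w. affine_point i w \<in> S - {p}} \<subseteq> chart i ` S"
    using chart_affine_point[of i] by (auto simp: image_iff) metis
  then have "finite {w. affine_point i w \<in> S - {p}}" by (rule finite_subset) (use assms in simp)
  then have "open W" unfolding W_def by (intro open_Compl finite_imp_closed)
  have "regular_point S 0 p"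
  proof (rule regular_pointI[where W = W and \<Phi> = "\<lambda>w. w - chart i p" and \<Phi>' = "\<lambda>y. y + chart i p" and K = UNIV])
    show "chart i p \<in> W" by (simp add: W_def affine_point_chart i)
    show "cdiff (\<lambda>w. w - chart i p) w" for w
      using cdiff_linear_shift[of "\<lambda>w. w" "- chart i p" w] by simp
    show "cdiff (\<lambda>y. y + chart i p) y" for y
      using cdiff_linear_shift[of "\<lambda>w. w" "chart i p" y] by simp
    fix w assume w: "w \<in> W"
    have "affine_point i w \<in> S \<longleftrightarrow> affine_point i w = p" using w p by (auto simp: W_def)
    also have "\<dots> \<longleftrightarrow> w = chart i p" using chart_affine_point affine_point_chart[OF i] by metis
    finally show "affine_point i w \<in> S \<longleftrightarrow> (\<forall>k\<in>UNIV. (w - chart i p) $ k = 0)"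
      by (simp add: vec_eq_iff)
  qed (use p i \<open>open W\<close> in simp_all)
  then show "p \<in> closure {p. regular_point S 0 p}" using closure_subset by blast
qed

lemma affine_embed_functional:
  fixes a :: "complex ^ 3"
  shows "(\<Sum>k\<in>UNIV. a $ k * affine_embed i w $ k)
    = drop_coord i a $ 1 * w $ 1 + drop_coord i a $ 2 * w $ 2 + a $ i"
  by (cases i rule: index3_cases)
     (simp_all add: sum_3 affine_embed_def drop_coord_def vector_3 vector_2)

text \<open>In a chart the line is the zero set of a nonconstant affine function, which becomes the
  first coordinate; the second is a coordinate \<open>w $ 1\<close> or \<open>w $ 2\<close>, chosen
  so that the change is invertible.\<close>

lemma pure_dimension_line:
  assumes "projective_line L"
  shows "pure_dimension L 1"
  unfolding pure_dimension_def
proof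
  fix p assume p: "p \<in> L"
  obtain a where a: "a \<noteq> 0" "\<And>v. v \<noteq> 0 \<Longrightarrow> proj v \<in> L \<longleftrightarrow> (\<Sum>k\<in>UNIV. a $ k * v $ k) = 0"
    using projective_line_functional[OF assms] by blast
  obtain i where i: "p \<in> chart_domain i" by (rule chart_domain_cover)
  define \<alpha> \<beta> \<gamma> where "\<alpha> = drop_coord i a $ 1" and "\<beta> = drop_coord i a $ 2" and "\<gamma> = a $ i"
  have mem: "affine_point i w \<in> L \<longleftrightarrow> \<alpha> * w $ 1 + \<beta> * w $ 2 + \<gamma> = 0" for w
    unfolding affine_point_eq a(2)[OF affine_embed_nonzero] affine_embed_functional
    by (simp add: \<alpha>_def \<beta>_def \<gamma>_def)
  \<comment> \<open>Otherwise \<open>L\<close> would be the line at infinity of chart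
    \<open>i\<close>, which misses \<open>p\<close>.\<close>
  have "\<not> (\<alpha> = 0 \<and> \<beta> = 0)"
  proof
    assume z: "\<alpha> = 0 \<and> \<beta> = 0"
    moreover have "affine_point i (chart i p) \<in> L" using p i by (simp add: affine_point_chart)
    ultimately have "\<gamma> = 0" using mem by auto
    then have "a = 0" using z unfolding \<alpha>_def \<beta>_def \<gamma>_def
      by (cases i rule: index3_cases) (simp_all add: drop_coord_def vec_eq_iff forall_3 vector_2)
    then show False using a by simp
  qed
  then have "regular_point L 1 p"
  proof (cases "\<alpha> = 0")
    case False
    show ?thesis
    proof (rule regular_pointI[where W = UNIV and K = "{1}" and i = i
          and \<Phi> = "\<lambda>w. vector [\<alpha> * w $ 1 + \<beta> * w $ 2, w $ 2] + vector [\<gamma>, 0]"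
          and \<Phi>' = "\<lambda>y. vector [(y $ 1 - \<beta> * y $ 2) / \<alpha>, y $ 2] + vector [- \<gamma> / \<alpha>, 0]"])
      show "cdiff (\<lambda>w. vector [\<alpha> * w $ 1 + \<beta> * w $ 2, w $ 2] + vector [\<gamma>, 0] :: complex ^ 2) w" for w :: "complex ^ 2"
        by (rule cdiff_linear_shift) (simp_all add: vec_eq_iff forall_2 vector_2 algebra_simps)
      show "cdiff (\<lambda>y. vector [(y $ 1 - \<beta> * y $ 2) / \<alpha>, y $ 2] + vector [- \<gamma> / \<alpha>, 0] :: complex ^ 2) y" for y :: "complex ^ 2"
        by (rule cdiff_linear_shift)
           (simp_all add: vec_eq_iff forall_2 vector_2 algebra_simps diff_divide_distrib add_divide_distrib)
    qed (use p i False in \<open>simp_all add: mem vec_eq_iff forall_2 vector_2 field_simps\<close>)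
  next
    case True
    with \<open>\<not> (\<alpha> = 0 \<and> \<beta> = 0)\<close> have "\<beta> \<noteq> 0" by simp
    show ?thesis
    proof (rule regular_pointI[where W = UNIV and K = "{1}" and i = i
          and \<Phi> = "\<lambda>w. vector [\<alpha> * w $ 1 + \<beta> * w $ 2, w $ 1] + vector [\<gamma>, 0]"
          and \<Phi>' = "\<lambda>y. vector [y $ 2, (y $ 1 - \<alpha> * y $ 2) / \<beta>] + vector [0, - \<gamma> / \<beta>]"])
      show "cdiff (\<lambda>w. vector [\<alpha> * w $ 1 + \<beta> * w $ 2, w $ 1] + vector [\<gamma>, 0] :: complex ^ 2) w" for w :: "complex ^ 2"
        by (rule cdiff_linear_shift) (simp_all add: vec_eq_iff forall_2 vector_2 algebra_simps)
      show "cdiff (\<lambda>y. vector [y $ 2, (y $ 1 - \<alpha> * y $ 2) / \<beta>] + vector [0, - \<gamma> / \<beta>] :: complex ^ 2) y" for y :: "complex ^ 2"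
        by (rule cdiff_linear_shift)
           (simp_all add: vec_eq_iff forall_2 vector_2 algebra_simps diff_divide_distrib add_divide_distrib)
    qed (use p i \<open>\<beta> \<noteq> 0\<close> in \<open>simp_all add: mem vec_eq_iff forall_2 vector_2 field_simps\<close>)
  qed
  then show "p \<in> closure {p. regular_point L 1 p}" using closure_subset by blast
qed

text \<open>Local coordinates have open image, so none of them can vanish on the whole of
  \<open>W\<close>; this forces \<open>K\<close> to be empty.\<close>

lemma cdimension_UNIV: "cdimension UNIV = 2"
proof -
  have "d = 2" if "regular_point UNIV d p" for d p
  proof -
    from that[unfolded regular_point_def, THEN conjunct2]
    obtain i W and \<Phi> :: "complex ^ 2 \<Rightarrow> complex ^ 2" and K
      where reg: "p \<in> chart_domain i \<and> open W \<and> chart i p \<in> W \<and>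
        inj_on \<Phi> W \<and> open (\<Phi> ` W) \<and> holo_on \<Phi> W \<and> holo_on (inv_into W \<Phi>) (\<Phi> ` W) \<and>
        card K + d = 2 \<and>
        (\<forall>w\<in>W. affine_point i w \<in> UNIV \<longleftrightarrow> (\<forall>k\<in>K. \<Phi> w $ k = 0))"
      by (elim exE) (rule that)
    have *: "chart i p \<in> W" "open (\<Phi> ` W)" "card K + d = 2"
      using reg by - (elim conjE, assumption)+
    have zero: "\<Phi> w $ k = 0" if "w \<in> W" "k \<in> K" for w k
    proof -
      have "\<forall>w\<in>W. affine_point i w \<in> UNIV \<longleftrightarrow> (\<forall>k\<in>K. \<Phi> w $ k = 0)"
        using reg by (elim conjE)
      then show ?thesis using that by blast
    qed
    have "K = {}"
    proof (rule ccontr)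
      assume "K \<noteq> {}"
      then obtain k where k: "k \<in> K" by blast
      let ?y = "\<Phi> (chart i p)"
      \<comment> \<open>Moving in direction \<open>k\<close> stays in the open image for a short
        while but changes the coordinate that is supposed to be 0.\<close>
      let ?T = "{t. ?y + t *s axis k 1 \<in> \<Phi> ` W}"
      have "open ?T" using *(2) by (rule open_line_preimage)
      moreover have "0 \<in> ?T" using *(1) by simp
      ultimately obtain e where e: "e > 0" "ball 0 e \<subseteq> ?T" unfolding open_contains_ball by blast
      have "complex_of_real (e / 2) \<in> ball 0 e" using e(1) by simp
      then have "?y + complex_of_real (e / 2) *s axis k 1 \<in> \<Phi> ` W" using e(2) by blast
      then have "(?y + complex_of_real (e / 2) *s axis k 1) $ k = 0" using zero[OF _ k] by (auto simp only:)
      moreover have "?y $ k = 0" using *(1) k by (rule zero)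
      ultimately show False using e(1) by (simp add: axis_def)
    qed
    then show ?thesis using *(3) by simp
  qed
  moreover have "regular_point UNIV 2 (affine_point 1 0)"
  proof (rule regular_pointI[where W = UNIV and \<Phi> = "\<lambda>w. w" and \<Phi>' = "\<lambda>w. w" and K = "{}" and i = 1])
    show "cdiff (\<lambda>w. w) w" for w :: "complex ^ 2" using cdiff_linear_shift[of "\<lambda>w. w" 0 w] by simp
    then show "cdiff (\<lambda>w. w) w" for w :: "complex ^ 2" .
  qed (simp_all add: affine_point_in_chart_domain)
  ultimately have "{d. \<exists>p. regular_point UNIV d p} = {2}" by blast
  then show ?thesis by (simp add: cdimension_def)
qed

section \<open>The classification\<close>

lemma eigenvalue_nonzero:
  "invertible (M :: complex ^ 3 ^ 3) \<Longrightarrow> v \<noteq> 0 \<Longrightarrow> M *v v = a *s v \<Longrightarrow> a \<noteq> 0"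
  using invertible_mult_nonzero[of M v] by auto

section \<open>Normal forms in the Jordan basis\<close>

context basis3
begin

lemma basis_nonzero: "u \<noteq> 0" "v \<noteq> 0" "w \<noteq> 0"
  using comb_nonzero[of 1 0 0] comb_nonzero[of 0 1 0] comb_nonzero[of 0 0 1] by (simp_all add: comb_unit)

lemma normal_form_diag3:
  assumes M: "invertible M" and eig: "M *v u = a *s u" "M *v v = b *s v" "M *v w = c *s w"
  shows "\<exists>g\<in>Aut_cp2. conjugate_in_Aut (plin M) g \<and> (\<exists>l0 l1 l2. l0 \<noteq> 0 \<and> l1 \<noteq> 0 \<and> l2 \<noteq> 0 \<and>
    (\<forall>x y z. (x, y, z) \<noteq> (0, 0, 0) \<longrightarrow> g (hpt x y z) = hpt (l0 * x) (l1 * y) (l2 * z)))"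
proof -
  obtain g where g: "g \<in> Aut_cp2" "conjugate_in_Aut (plin M) g"
    "\<And>x y z x' y' z'. (x, y, z) \<noteq> (0, 0, 0) \<Longrightarrow> M *v comb x y z = comb x' y' z' \<Longrightarrow>
       g (hpt x y z) = hpt x' y' z'"
    using conjugate_to_comb[OF M] by metis
  have "M *v comb x y z = comb (a * x) (b * y) (c * z)" for x y z
    unfolding comb_mult eig by (simp add: comb_def mult.commute)
  with g(3) have "\<forall>x y z. (x, y, z) \<noteq> (0, 0, 0) \<longrightarrow> g (hpt x y z) = hpt (a * x) (b * y) (c * z)"
    by blast
  with g(1,2) eigenvalue_nonzero[OF M] basis_nonzero eig show ?thesis by metis
qed

lemma normal_form_diag2:
  assumes M: "invertible M" and eig: "M *v u = a *s u" "M *v v = a *s v" "M *v w = b *s w"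
  shows "\<exists>g\<in>Aut_cp2. conjugate_in_Aut (plin M) g \<and> (\<exists>l0 l1. l0 \<noteq> 0 \<and> l1 \<noteq> 0 \<and>
    (\<forall>x y z. (x, y, z) \<noteq> (0, 0, 0) \<longrightarrow> g (hpt x y z) = hpt (l0 * x) (l0 * y) (l1 * z)))"
proof -
  obtain g where g: "g \<in> Aut_cp2" "conjugate_in_Aut (plin M) g"
    "\<And>x y z x' y' z'. (x, y, z) \<noteq> (0, 0, 0) \<Longrightarrow> M *v comb x y z = comb x' y' z' \<Longrightarrow>
       g (hpt x y z) = hpt x' y' z'"
    using conjugate_to_comb[OF M] by metis
  have "M *v comb x y z = comb (a * x) (a * y) (b * z)" for x y z
    unfolding comb_mult eig by (simp add: comb_def mult.commute)
  with g(3) have "\<forall>x y z. (x, y, z) \<noteq> (0, 0, 0) \<longrightarrow> g (hpt x y z) = hpt (a * x) (a * y) (b * z)"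
    by blast
  with g(1,2) eigenvalue_nonzero[OF M] basis_nonzero eig show ?thesis by metis
qed

lemma normal_form_block21:
  assumes M: "invertible M" and eig: "M *v u = a *s u" "M *v v = u + a *s v" "M *v w = b *s w"
  shows "\<exists>g\<in>Aut_cp2. conjugate_in_Aut (plin M) g \<and> (\<exists>l0 l1. l0 \<noteq> 0 \<and> l1 \<noteq> 0 \<and>
    (\<forall>x y z. (x, y, z) \<noteq> (0, 0, 0) \<longrightarrow> g (hpt x y z) = hpt (l0 * x + y) (l0 * y) (l1 * z)))"
proof -
  obtain g where g: "g \<in> Aut_cp2" "conjugate_in_Aut (plin M) g"
    "\<And>x y z x' y' z'. (x, y, z) \<noteq> (0, 0, 0) \<Longrightarrow> M *v comb x y z = comb x' y' z' \<Longrightarrow>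
       g (hpt x y z) = hpt x' y' z'"
    using conjugate_to_comb[OF M] by metis
  have "M *v comb x y z = comb (a * x + y) (a * y) (b * z)" for x y z
    unfolding comb_mult eig by (simp add: comb_def vec_eq_iff algebra_simps)
  with g(3) have "\<forall>x y z. (x, y, z) \<noteq> (0, 0, 0) \<longrightarrow> g (hpt x y z) = hpt (a * x + y) (a * y) (b * z)"
    by blast
  with g(1,2) eigenvalue_nonzero[OF M] basis_nonzero eig show ?thesis by metis
qed

lemma normal_form_block2:
  assumes M: "invertible M" and eig: "M *v u = a *s u" "M *v v = u + a *s v" "M *v w = a *s w"
  shows "\<exists>g\<in>Aut_cp2. conjugate_in_Aut (plin M) g \<and> (\<exists>l0. l0 \<noteq> 0 \<and>
    (\<forall>x y z. (x, y, z) \<noteq> (0, 0, 0) \<longrightarrow> g (hpt x y z) = hpt (l0 * x + y) (l0 * y) (l0 * z)))"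
proof -
  obtain g where g: "g \<in> Aut_cp2" "conjugate_in_Aut (plin M) g"
    "\<And>x y z x' y' z'. (x, y, z) \<noteq> (0, 0, 0) \<Longrightarrow> M *v comb x y z = comb x' y' z' \<Longrightarrow>
       g (hpt x y z) = hpt x' y' z'"
    using conjugate_to_comb[OF M] by metis
  have "M *v comb x y z = comb (a * x + y) (a * y) (a * z)" for x y z
    unfolding comb_mult eig by (simp add: comb_def vec_eq_iff algebra_simps)
  with g(3) have "\<forall>x y z. (x, y, z) \<noteq> (0, 0, 0) \<longrightarrow> g (hpt x y z) = hpt (a * x + y) (a * y) (a * z)"
    by blast
  with g(1,2) eigenvalue_nonzero[OF M] basis_nonzero eig show ?thesis by metis
qed

lemma normal_form_block3:
  assumes M: "invertible M" and eig: "M *v u = a *s u" "M *v v = u + a *s v" "M *v w = v + a *s w"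
  shows "\<exists>g\<in>Aut_cp2. conjugate_in_Aut (plin M) g \<and> (\<exists>l0. l0 \<noteq> 0 \<and>
    (\<forall>x y z. (x, y, z) \<noteq> (0, 0, 0) \<longrightarrow> g (hpt x y z) = hpt (l0 * x + y) (l0 * y + z) (l0 * z)))"
proof -
  obtain g where g: "g \<in> Aut_cp2" "conjugate_in_Aut (plin M) g"
    "\<And>x y z x' y' z'. (x, y, z) \<noteq> (0, 0, 0) \<Longrightarrow> M *v comb x y z = comb x' y' z' \<Longrightarrow>
       g (hpt x y z) = hpt x' y' z'"
    using conjugate_to_comb[OF M] by metis
  have "M *v comb x y z = comb (a * x + y) (a * y + z) (a * z)" for x y z
    unfolding comb_mult eig by (simp add: comb_def vec_eq_iff algebra_simps)
  with g(3) have "\<forall>x y z. (x, y, z) \<noteq> (0, 0, 0) \<longrightarrow> g (hpt x y z) = hpt (a * x + y) (a * y + z) (a * z)"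
    by blast
  with g(1,2) eigenvalue_nonzero[OF M] basis_nonzero eig show ?thesis by metis
qed

end

lemma identity_Aut: "id \<in> Aut_cp2"
proof -
  have "plin (mat 1) = id" by (simp add: fun_eq_iff plin_mat_1)
  moreover have "invertible (mat 1 :: complex ^ 3 ^ 3)" by (auto simp: invertible_def)
  ultimately show ?thesis using plin_Aut by metis
qed

theorem theorem4:
  fixes f :: "cp2 \<Rightarrow> cp2"
  assumes "biholomorphism f"
  shows
    "((pure_dimension (fixed_points f) 0 \<and> card (fixed_points f) = 1) \<or>
     (pure_dimension (fixed_points f) 0 \<and> card (fixed_points f) = 2) \<or>
     (pure_dimension (fixed_points f) 0 \<and> card (fixed_points f) = 3) \<or>
     (pure_dimension (fixed_points f) 1 \<and> projective_line (fixed_points f)) \<or>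
     point_and_line (fixed_points f) \<or>
     (cdimension (fixed_points f) = 2 \<and> fixed_points f = UNIV)) \<and>
     (card (fixed_points f) = 1 \<longrightarrow>
      (\<exists>g\<in>Aut_cp2. conjugate_in_Aut f g \<and> (\<exists>l0. l0 \<noteq> 0 \<and>
        (\<forall>x y z. (x, y, z) \<noteq> (0, 0, 0) \<longrightarrow>
           g (hpt x y z) = hpt (l0 * x + y) (l0 * y + z) (l0 * z))))) \<and>
     (card (fixed_points f) = 2 \<longrightarrow>
      (\<exists>g\<in>Aut_cp2. conjugate_in_Aut f g \<and> (\<exists>l0 l1. l0 \<noteq> 0 \<and> l1 \<noteq> 0 \<and>
        (\<forall>x y z. (x, y, z) \<noteq> (0, 0, 0) \<longrightarrow>
           g (hpt x y z) = hpt (l0 * x + y) (l0 * y) (l1 * z))))) \<and>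
     (card (fixed_points f) = 3 \<longrightarrow>
      (\<exists>g\<in>Aut_cp2. conjugate_in_Aut f g \<and> (\<exists>l0 l1 l2. l0 \<noteq> 0 \<and> l1 \<noteq> 0 \<and> l2 \<noteq> 0 \<and>
        (\<forall>x y z. (x, y, z) \<noteq> (0, 0, 0) \<longrightarrow>
           g (hpt x y z) = hpt (l0 * x) (l1 * y) (l2 * z))))) \<and>
     (point_and_line (fixed_points f) \<longrightarrow>
      (\<exists>g\<in>Aut_cp2. conjugate_in_Aut f g \<and> (\<exists>l0 l1. l0 \<noteq> 0 \<and> l1 \<noteq> 0 \<and>
        (\<forall>x y z. (x, y, z) \<noteq> (0, 0, 0) \<longrightarrow>
           g (hpt x y z) = hpt (l0 * x) (l0 * y) (l1 * z))))) \<and>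
     (projective_line (fixed_points f) \<longrightarrow>
      (\<exists>g\<in>Aut_cp2. conjugate_in_Aut f g \<and> (\<exists>l0. l0 \<noteq> 0 \<and>
        (\<forall>x y z. (x, y, z) \<noteq> (0, 0, 0) \<longrightarrow>
           g (hpt x y z) = hpt (l0 * x + y) (l0 * y) (l0 * z))))) \<and>
     (fixed_points f = UNIV \<longrightarrow>
      (\<exists>g\<in>Aut_cp2. conjugate_in_Aut f g \<and>
        (\<forall>x y z. (x, y, z) \<noteq> (0, 0, 0) \<longrightarrow> g (hpt x y z) = hpt x y z)))"
proof -
  obtain M where M: "invertible M" and f: "f = plin M"
    using assms by (rule biholomorphism_projective_linear)
  let ?S = "fixed_points (plin M)"
  \<comment> \<open>These facts make the premises of the implications for the other fixed point
    types false. An infinite set has \<open>card\<close> equal to 0, which excludes the values 1, 2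
    and 3.\<close>
  have finite_case: "\<not> projective_line ?S" "\<not> point_and_line ?S" "?S \<noteq> UNIV" if "finite ?S"
    using that projective_line_infinite point_and_line_infinite infinite_cp2 by metis+
  have infinite_case: "card ?S \<noteq> 1" "card ?S \<noteq> 2" "card ?S \<noteq> 3" if "infinite ?S"
    using that by simp_all
  show ?thesis
  proof (cases rule: jordan_form_3[of M])
    case (diag3 u v w a b c)
    interpret basis3 u v w by standard (rule diag3(1))
    have S: "?S = {pt 1 0 0, pt 0 1 0, pt 0 0 1}"
      by (rule fixed_points_diag3[OF M diag3(2-7)])
    have fin: "finite ?S" unfolding S by simp
    have card: "card ?S = 3" unfolding S by (rule card_pts)
    show ?thesis unfolding f
      using finite_case[OF fin] card pure_dimension_finite[OF fin] normal_form_diag3[OF M diag3(5-7)]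
      by (simp only: simp_thms) simp
  next
    case (diag2 u v w a b)
    interpret basis3 u v w by standard (rule diag2(1))
    have S: "?S = {pt 0 0 1} \<union> fixed_line" by (rule fixed_points_diag2[OF M diag2(2-5)])
    have "pt 0 0 1 \<notin> fixed_line" by (simp add: pt_in_fixed_line)
    then have pl: "point_and_line ?S" unfolding S point_and_line_def using projective_fixed_line by blast
    note infinite_case[OF point_and_line_infinite[OF pl]] point_and_line_not_line[OF pl]
      point_and_line_not_UNIV[OF pl]
    then show ?thesis unfolding f
      using pl normal_form_diag2[OF M diag2(3-5)] by (simp only: simp_thms)
  next
    case (scalar u v w a)
    interpret basis3 u v w by standard (rule scalar(1))
    have S: "?S = UNIV" by (rule fixed_points_scalar[OF M scalar(2-4)])
    \<comment> \<open>Every point is fixed, so the map itself is the normal form and the identity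
      serves as conjugating map.\<close>
    have "plin M = id" using S by (auto simp: fixed_points_def fun_eq_iff)
    then have "conjugate_in_Aut (plin M) id"
      unfolding conjugate_in_Aut_def using identity_Aut by (intro bexI[of _ id]) simp_all
    then have "\<exists>g\<in>Aut_cp2. conjugate_in_Aut (plin M) g \<and>
        (\<forall>x y z. (x, y, z) \<noteq> (0, 0, 0) \<longrightarrow> g (hpt x y z) = hpt x y z)"
      using identity_Aut by (intro bexI[of _ id]) simp_all
    moreover have "\<not> point_and_line ?S" "\<not> projective_line ?S"
      using S point_and_line_not_UNIV projective_line_not_UNIV by blast+
    moreover have "infinite ?S" unfolding S by (rule infinite_cp2)
    ultimately show ?thesis unfolding f using infinite_case cdimension_UNIV S by (simp only: simp_thms)
  next
    case (block21 u v w a b)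
    interpret basis3 u v w by standard (rule block21(1))
    have S: "?S = {pt 1 0 0, pt 0 0 1}" by (rule fixed_points_block21[OF M block21(2-5)])
    have fin: "finite ?S" unfolding S by simp
    have card: "card ?S = 2" unfolding S by (rule card_pts)
    show ?thesis unfolding f
      using finite_case[OF fin] card pure_dimension_finite[OF fin] normal_form_block21[OF M block21(3-5)]
      by (simp only: simp_thms) simp
  next
    case (block2 u v w a)
    interpret basis3 u v w by standard (rule block2(1))
    have pl: "projective_line ?S" by (rule fixed_points_block2[OF M block2(2-4)])
    have "\<not> point_and_line ?S" using pl point_and_line_not_line by blast
    then show ?thesis unfolding f
      using infinite_case[OF projective_line_infinite[OF pl]] pl projective_line_not_UNIV[OF pl]
        pure_dimension_line[OF pl] normal_form_block2[OF M block2(2-4)]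
      by (simp only: simp_thms)
  next
    case (block3 u v w a)
    interpret basis3 u v w by standard (rule block3(1))
    have S: "?S = {pt 1 0 0}" by (rule fixed_points_block3[OF M block3(2-4)])
    have fin: "finite ?S" unfolding S by simp
    have card: "card ?S = 1" unfolding S by simp
    show ?thesis unfolding f
      using finite_case[OF fin] card pure_dimension_finite[OF fin] normal_form_block3[OF M block3(2-4)]
      by (simp only: simp_thms) simp
  qed
qed

end
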